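(* Let $(X,\gamma,H)$ be an abstract Wiener space. For every open convex subset $C\subset X$, $\gamma(\partial C)=0$ and $P_\gamma(C)<+\infty$.
   Context: Setting: $X$ is a separable Banach space, $\gamma$ a non-degenerate centered Gaussian measure on $X$, $H$ its Cameron--Martin space: if $\mathcal{H}$ is the closure of $X^*$ in $L^2(X,\gamma)$ and $R:\mathcal{H}\to X$, $Rf=\int_X f(x)x\,d\gamma(x)$ (Bochner integral), then $H=R(\mathcal{H})$, with inner product $[\cdot,\cdot]_H$ and norm $|\cdot|_H$ transported from $L^2(X,\gamma)$ by $R$. For $h\in H$ let $\hat h=R^{-1}h\in\mathcal{H}$. Fix $x_j^*\in X^*$ such that $h_j=Rx_j^*$, $j\in\mathbb{N}$, is an orthonormal basis of $H$; $\partial_j$ is the derivative in the direction $h_j$. $\mathcal{F}C^1_b(X)$ is the set of functions $f(x)=\varphi(\langle x,\ell_1\rangle,\dots,\langle x,\ell_m\rangle)$ with $m\in\mathbb{N}$, $\ell_i\in X^*$, $\varphi\in C^1_b(\mathbb{R}^m)$; $\mathcal{F}C^1_b(X,H)$ is the linear span of the functions $f\ell$ with $f\in\mathcal{F}C^1_b(X)$, $\ell\in H$. The Gaussian divergence of $\varphi\in\mathcal{F}C^1_b(X,H)$ is $\mathrm{div}_\gamma\varphi=\sum_j\partial_j^*[\varphi,h_j]_H$ with $\partial_j^*f=\partial_jf-\hat h_jf$. Perimeter: for measurable $E\subseteq X$, $P_\gamma(E):=\sup\{\int_E\mathrm{div}_\gamma\varphi\,d\gamma:\ \varphi\in\mathcal{F}C^1_b(X,H),\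 |\varphi(x)|_H\le1\ \forall x\in X\}$. $\partial C$ denotes the topological boundary of $C$ in $X$. *)

theory Defs
  imports "HOL-Probability.Probability"
begin

definition centered_gaussian :: "'a::{banach, second_countable_topology} measure \<Rightarrow> bool" where
  "centered_gaussian \<gamma> \<longleftrightarrow> prob_space \<gamma> \<and> sets \<gamma> = sets borel \<and>
     (\<forall>l :: 'a \<Rightarrow>\<^sub>L real. distr \<gamma> borel (blinfun_apply l) = return borel 0 \<or>
        (\<exists>\<sigma>>0. distr \<gamma> borel (blinfun_apply l) = density lborel (normal_density 0 \<sigma>)))"

definition nondegenerate :: "'a::{banach, second_countable_topology} measure \<Rightarrow> bool" where
  "nondegenerate \<gamma> \<longleftrightarrow> (\<forall>l :: 'a \<Rightarrow>\<^sub>L real. l \<noteq> 0 \<longrightarrow> 0 < (LINT x|\<gamma>. (blinfun_apply l x)\<^sup>2))"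

text \<open>The Cameron--Martin space is determined by the measure, so it is not a separate parameter.\<close>

definition abstract_wiener_space :: "'a::{banach, second_countable_topology} measure \<Rightarrow> bool" where
  "abstract_wiener_space \<gamma> \<longleftrightarrow> centered_gaussian \<gamma> \<and> nondegenerate \<gamma>"

text \<open>Elements of the Lebesgue space of square-integrable functions are handled through
  representatives; nothing below depends, up to null sets, on the representative.\<close>

definition L2 :: "'a measure \<Rightarrow> ('a \<Rightarrow> real) set" where
  "L2 \<gamma> = {f \<in> borel_measurable \<gamma>. integrable \<gamma> (\<lambda>x. (f x)\<^sup>2)}"

definition L2_tendsto :: "'a measure \<Rightarrow> (nat \<Rightarrow> 'a \<Rightarrow> real) \<Rightarrow> ('a \<Rightarrow> real) \<Rightarrow> bool" where
  "L2_tendsto \<gamma> s f \<longleftrightarrow> (\<forall>n. s n \<in> L2 \<gamma>) \<and> f \<in> L2 \<gamma> \<and>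
     (\<lambda>n. LINT x|\<gamma>. (s n x - f x)\<^sup>2) \<longlonglongrightarrow> 0"

definition dual_closure :: "'a::{banach, second_countable_topology} measure \<Rightarrow> ('a \<Rightarrow> real) set" where
  "dual_closure \<gamma> = {f. \<exists>l :: nat \<Rightarrow> 'a \<Rightarrow>\<^sub>L real. L2_tendsto \<gamma> (\<lambda>n. blinfun_apply (l n)) f}"

definition R_map :: "'a::{banach, second_countable_topology} measure \<Rightarrow> ('a \<Rightarrow> real) \<Rightarrow> 'a" where
  "R_map \<gamma> f = (LINT x|\<gamma>. f x *\<^sub>R x)"

definition cameron_martin :: "'a::{banach, second_countable_topology} measure \<Rightarrow> 'a set" where
  "cameron_martin \<gamma> = R_map \<gamma> ` dual_closure \<gamma>"

text \<open>\<open>hat \<gamma> h\<close> is a representative of the class \<open>R\<^sup>-\<^sup>1 h\<close>, which is unique up to null sets.\<close>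

definition hat :: "'a::{banach, second_countable_topology} measure \<Rightarrow> 'a \<Rightarrow> 'a \<Rightarrow> real" where
  "hat \<gamma> h = (SOME f. f \<in> dual_closure \<gamma> \<and> R_map \<gamma> f = h)"

definition inner_H :: "'a::{banach, second_countable_topology} measure \<Rightarrow> 'a \<Rightarrow> 'a \<Rightarrow> real" where
  "inner_H \<gamma> h k = (LINT x|\<gamma>. hat \<gamma> h x * hat \<gamma> k x)"

definition norm_H :: "'a::{banach, second_countable_topology} measure \<Rightarrow> 'a \<Rightarrow> real" where
  "norm_H \<gamma> h = sqrt (inner_H \<gamma> h h)"

text \<open>The elements \<open>R_map \<gamma> (xs j)\<close> with \<open>j \<in> J\<close> form an orthonormal basis of the
  Cameron--Martin space. In the infinite-dimensional case one may take \<open>J = UNIV\<close>; a general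
  index set \<open>J\<close> is used so that finite-dimensional spaces are not excluded.\<close>

definition dual_onb ::
  "'a::{banach, second_countable_topology} measure \<Rightarrow> nat set \<Rightarrow> (nat \<Rightarrow> 'a \<Rightarrow>\<^sub>L real) \<Rightarrow> bool" where
  "dual_onb \<gamma> J xs \<longleftrightarrow>
     (\<forall>i\<in>J. \<forall>j\<in>J. inner_H \<gamma> (R_map \<gamma> (xs i)) (R_map \<gamma> (xs j)) = (if i = j then 1 else 0)) \<and>
     (\<forall>h\<in>cameron_martin \<gamma>. \<forall>\<epsilon>>0. \<exists>F c. finite F \<and> F \<subseteq> J \<and>
        norm_H \<gamma> (h - (\<Sum>j\<in>F. c j *\<^sub>R R_map \<gamma> (xs j))) < \<epsilon>)"

text \<open>Since the dimension \<open>m\<close> is a variable, \<open>\<real>\<^sup>m\<close> is the set \<open>Rn m\<close> of extensional functions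
  on \<open>{..<m}\<close>; the product topology induces the Euclidean topology on it. A function is \<open>C\<^sup>1\<close> if it
  is continuous and has continuous partial derivatives; here all of them are also bounded.\<close>

definition Rn :: "nat \<Rightarrow> (nat \<Rightarrow> real) set" where
  "Rn m = {..<m} \<rightarrow>\<^sub>E UNIV"

definition C1b :: "nat \<Rightarrow> ((nat \<Rightarrow> real) \<Rightarrow> real) set" where
  "C1b m = {\<phi>. continuous_on (Rn m) \<phi> \<and> bounded (\<phi> ` Rn m) \<and>
     (\<forall>i<m. \<exists>D. continuous_on (Rn m) D \<and> bounded (D ` Rn m) \<and>
        (\<forall>u\<in>Rn m. ((\<lambda>t. \<phi> (u(i := t))) has_real_derivative D u) (at (u i))))}"

definition FC1b :: "('a::real_normed_vector \<Rightarrow> real) set" where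
  "FC1b = {f. \<exists>m (l :: nat \<Rightarrow> 'a \<Rightarrow>\<^sub>L real). \<exists>\<phi>\<in>C1b m.
     f = (\<lambda>x. \<phi> (\<lambda>i\<in>{..<m}. blinfun_apply (l i) x))}"

definition FC1b_H :: "'a::{banach, second_countable_topology} measure \<Rightarrow> ('a \<Rightarrow> 'a) set" where
  "FC1b_H \<gamma> = {\<phi>. \<exists>(n::nat) c f h. (\<forall>i<n. f i \<in> FC1b \<and> h i \<in> cameron_martin \<gamma>) \<and>
     \<phi> = (\<lambda>x. \<Sum>i<n. c i *\<^sub>R (f i x *\<^sub>R h i))}"

definition dir_deriv :: "'a::real_normed_vector \<Rightarrow> ('a \<Rightarrow> real) \<Rightarrow> 'a \<Rightarrow> real" where
  "dir_deriv h f x = deriv (\<lambda>t. f (x + t *\<^sub>R h)) 0"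

definition dir_deriv_adj ::
  "'a::{banach, second_countable_topology} measure \<Rightarrow> 'a \<Rightarrow> ('a \<Rightarrow> real) \<Rightarrow> 'a \<Rightarrow> real" where
  "dir_deriv_adj \<gamma> h f x = dir_deriv h f x - hat \<gamma> h x * f x"

text \<open>The terms of the series defining the divergence involve the classes \<open>hat \<gamma> h\<close>, so the
  series is summed in the space of square-integrable functions, where it converges for every
  field in \<open>FC1b_H \<gamma>\<close>; the sum is determined up to null sets.\<close>

definition gauss_div ::
  "'a::{banach, second_countable_topology} measure \<Rightarrow> nat set \<Rightarrow> (nat \<Rightarrow> 'a \<Rightarrow>\<^sub>L real) \<Rightarrow>
     ('a \<Rightarrow> 'a) \<Rightarrow> 'a \<Rightarrow> real" where
  "gauss_div \<gamma> J xs \<phi> = (SOME g. L2_tendsto \<gamma>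
     (\<lambda>n x. \<Sum>j\<in>J \<inter> {..<n}.
        dir_deriv_adj \<gamma> (R_map \<gamma> (xs j)) (\<lambda>y. inner_H \<gamma> (\<phi> y) (R_map \<gamma> (xs j))) x) g)"

definition gauss_perimeter ::
  "'a::{banach, second_countable_topology} measure \<Rightarrow> nat set \<Rightarrow> (nat \<Rightarrow> 'a \<Rightarrow>\<^sub>L real) \<Rightarrow>
     'a set \<Rightarrow> ereal" where
  "gauss_perimeter \<gamma> J xs E =
     (SUP \<phi>\<in>{\<phi> \<in> FC1b_H \<gamma>. \<forall>x. norm_H \<gamma> (\<phi> x) \<le> 1}. ereal (LINT x:E|\<gamma>. gauss_div \<gamma> J xs \<phi> x))"

end

theory Submission
  imports Defs
begin

text \<open>The boundary of an open convex set \<open>C\<close> is null because \<open>C\<close> can be entered from each of its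
  boundary points \<open>x\<close> in some direction \<open>h\<close> from the dense subspace of the vectors
  \<open>R_map \<gamma> l\<close> with a continuous functional \<open>l\<close>. On a line parallel to \<open>h\<close> there is at most one boundary point \<open>x\<close> with
  \<open>x + h \<in> C\<close>. Since \<open>\<gamma>\<close> splits as the law of \<open>y + t *\<^sub>R h\<close> with \<open>t\<close> normal and independent
  of \<open>y\<close>, the set of these points is null, and countably many \<open>h\<close> suffice
  (\<open>frontier_convex_null\<close>).

  For the perimeter suppose that \<open>C\<close> has positive measure and contains the ball of radius \<open>r\<close> around
  \<open>x0\<close>. Write the closure of \<open>C\<close> as the intersection of half-spaces \<open>l k (x - x0) \<le> 1\<close>; then the
  norm of each \<open>l k\<close> is at most \<open>1 / r\<close>. Smooth cutoffs \<open>w\<close> of the first \<open>N\<close> half-spaces converge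
  almost everywhere to the indicator of \<open>C\<close>, and integration by parts turns the integral of
  \<open>w\<close> times the divergence of a field into minus the integral of the derivative of \<open>w\<close> along the field.
  A field of Cameron--Martin length at most one has bounded norm, so \<open>w\<close> decreases along it at most at
  a constant times the rate of growth of the cutoff in the parameter \<open>\<tau>\<close> that moves all \<open>N\<close> half-spaces
  outwards at once. The integral of the cutoff is log-concave in \<open>\<tau>\<close> by the Prekopa--Leindler
  inequality for \<open>\<gamma>\<close>, so its slope at \<open>\<tau> = 0\<close> is bounded by a chord to the left, that is, by
  the measure of a smaller homothetic copy of \<open>C\<close> (\<open>cutoff_slope_integral_le\<close>). This bound depends
  neither on \<open>N\<close> nor on the field.

  Three classical tools are developed on the way: the Hahn--Banach theorem, which provides the
  half-spaces and the density of the Cameron--Martin directions; the fact that finitely many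
  Gaussian functionals split into independent components (\<open>gaussian_split\<close>), which by induction gives
  the Prekopa--Leindler inequality (\<open>prekopa_leindler_gaussian\<close>); and a Fernique-type estimate, again
  from log-concavity, that the norm is square integrable, which makes \<open>R_map\<close> a
  genuine integral that is injective modulo null sets.\<close>

section \<open>The Hahn--Banach theorem and half-spaces\<close>

definition sublinear :: "('a::real_vector \<Rightarrow> real) \<Rightarrow> bool" where
  "sublinear p \<longleftrightarrow> (\<forall>x y. p (x + y) \<le> p x + p y) \<and> (\<forall>x t. 0 \<le> t \<longrightarrow> p (t *\<^sub>R x) = t * p x)"

lemma sublinearI:
  assumes add: "\<And>x y. p (x + y) \<le> p x + p y"
    and scale: "\<And>t x. 0 < t \<Longrightarrow> p (t *\<^sub>R x) \<le> t * p x"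
    and zero: "p 0 = 0"
  shows "sublinear p"
proof -
  have "p (t *\<^sub>R x) = t * p x" if "0 \<le> t" for t x
  proof (cases "t = 0")
    case False
    with that have t: "0 < t" by simp
    have "p x \<le> inverse t * p (t *\<^sub>R x)"
      using scale[of "inverse t" "t *\<^sub>R x"] t by simp
    then have "t * p x \<le> p (t *\<^sub>R x)"
      using t by (simp add: field_simps)
    with scale[OF t, of x] show ?thesis by simp
  qed (simp add: zero)
  with add show ?thesis by (simp add: sublinear_def)
qed

lemma sublinear_add: "sublinear p \<Longrightarrow> p (x + y) \<le> p x + p y"
  by (simp add: sublinear_def)

lemma sublinear_scale: "sublinear p \<Longrightarrow> 0 \<le> t \<Longrightarrow> p (t *\<^sub>R x) = t * p x"
  by (simp add: sublinear_def)

lemma sublinear_zero: "sublinear p \<Longrightarrow> p 0 = 0"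
  using sublinear_scale[of p 0 0] by simp

lemma sublinear_lower: "sublinear p \<Longrightarrow> - p (- x) \<le> p x"
  using sublinear_add[of p x "- x"] by (simp add: sublinear_zero)

text \<open>The largest among the sublinear functionals below \<open>p\<close> that take the value \<open>- p y\<close> at \<open>- y\<close> and
  hence are linear on the line spanned by \<open>y\<close>.\<close>

definition straighten :: "('a::real_vector \<Rightarrow> real) \<Rightarrow> 'a \<Rightarrow> 'a \<Rightarrow> real" where
  "straighten p y x = (INF t\<in>{0..}. p (x + t *\<^sub>R y) - t * p y)"

lemma straighten_bdd:
  assumes "sublinear p"
  shows "bdd_below ((\<lambda>t. p (x + t *\<^sub>R y) - t * p y) ` {0..})"
proof (rule bdd_belowI2[where m = "- p (- x)"])
  fix t :: real assume "t \<in> {0..}"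
  then show "- p (- x) \<le> p (x + t *\<^sub>R y) - t * p y"
    using sublinear_add[OF assms, of "- x" "x + t *\<^sub>R y"] sublinear_scale[OF assms, of t y] by simp
qed

lemma straighten_le:
  assumes "sublinear p" "0 \<le> t"
  shows "straighten p y x \<le> p (x + t *\<^sub>R y) - t * p y"
  unfolding straighten_def using straighten_bdd[OF assms(1)] assms(2) by (intro cINF_lower) auto

lemma straighten_greatest:
  assumes "\<And>t. 0 \<le> t \<Longrightarrow> c \<le> p (x + t *\<^sub>R y) - t * p y"
  shows "c \<le> straighten p y x"
  unfolding straighten_def using assms by (intro cINF_greatest) auto

lemma sublinear_straighten:
  assumes p: "sublinear p"
  shows "sublinear (straighten p y)"
proof (rule sublinearI)
  fix x z
  have "straighten p y (x + z) - (p (x + t *\<^sub>R y) - t * p y) \<le> p (z + s *\<^sub>R y) - s * p y"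
    if "0 \<le> t" "0 \<le> s" for s t
    using straighten_le[OF p, of "t + s" y "x + z"] that
      sublinear_add[OF p, of "x + t *\<^sub>R y" "z + s *\<^sub>R y"]
    by (simp add: algebra_simps)
  then have "straighten p y (x + z) - (p (x + t *\<^sub>R y) - t * p y) \<le> straighten p y z" if "0 \<le> t" for t
    using that by (intro straighten_greatest) auto
  then have "straighten p y (x + z) - straighten p y z \<le> p (x + t *\<^sub>R y) - t * p y" if "0 \<le> t" for t
    using that by (fastforce simp: algebra_simps)
  then have "straighten p y (x + z) - straighten p y z \<le> straighten p y x"
    by (rule straighten_greatest)
  then show "straighten p y (x + z) \<le> straighten p y x + straighten p y z" by simp
next
  fix t :: real and x assume t: "0 < t"
  have "inverse t * straighten p y (t *\<^sub>R x) \<le> p (x + s *\<^sub>R y) - s * p y" if "0 \<le> s" for s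
  proof -
    have "straighten p y (t *\<^sub>R x) \<le> p (t *\<^sub>R (x + s *\<^sub>R y)) - t * s * p y"
      using straighten_le[OF p, of "t * s" y "t *\<^sub>R x"] t that by (simp add: scaleR_right_distrib)
    also have "\<dots> = t * (p (x + s *\<^sub>R y) - s * p y)"
      using t by (simp add: sublinear_scale[OF p] right_diff_distrib)
    finally show ?thesis using t by (simp add: field_simps)
  qed
  then have "inverse t * straighten p y (t *\<^sub>R x) \<le> straighten p y x"
    by (rule straighten_greatest)
  then show "straighten p y (t *\<^sub>R x) \<le> t * straighten p y x"
    using t by (simp add: field_simps)
next
  show "straighten p y 0 = 0"
  proof (rule antisym)
    show "straighten p y 0 \<le> 0"
      using straighten_le[OF p, of 0 y 0] by (simp add: sublinear_zero[OF p])
    show "0 \<le> straighten p y 0"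
      by (rule straighten_greatest) (simp add: sublinear_scale[OF p])
  qed
qed

text \<open>Below every sublinear functional lies a minimal one: a chain of sublinear functionals
  below \<open>p\<close> is bounded below by \<open>x \<mapsto> - p (- x)\<close>, and its pointwise infimum is sublinear.\<close>

lemma minimal_sublinear_exists:
  assumes p: "sublinear p"
  obtains q where "sublinear q" "q \<le> p" "\<And>r. sublinear r \<Longrightarrow> r \<le> q \<Longrightarrow> r = q"
proof -
  define A where "A = {q. sublinear q \<and> q \<le> p}"
  have po: "partial_order_on A (relation_of (\<lambda>a b. b \<le> a) A)"
    by (rule partial_order_on_relation_ofI) auto
  have ch: "\<exists>u\<in>A. \<forall>a\<in>K. u \<le> a" if K: "K \<in> Chains (relation_of (\<lambda>a b. b \<le> a) A)" for K
  proof (cases "K = {}")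
    case True
    then show ?thesis using p by (auto simp: A_def)
  next
    case False
    have KA: "a \<in> A" if "a \<in> K" for a
      using K that unfolding Chains_def relation_of_def by auto
    have lin: "a \<le> b \<or> b \<le> a" if "a \<in> K" "b \<in> K" for a b
      using K that unfolding Chains_def relation_of_def by auto
    define u where "u x = (INF q\<in>K. q x)" for x
    have bdd: "bdd_below ((\<lambda>q. q x) ` K)" for x
    proof (rule bdd_belowI2[where m = "- p (- x)"])
      fix q assume "q \<in> K"
      then have "sublinear q" "q (- x) \<le> p (- x)" using KA by (auto simp: A_def le_fun_def)
      then show "- p (- x) \<le> q x" using sublinear_lower[of q x] by simp
    qed
    have ule: "u x \<le> q x" if "q \<in> K" for q x
      unfolding u_def using bdd that by (intro cINF_lower)
    have ugr: "c \<le> u x" if "\<And>q. q \<in> K \<Longrightarrow> c \<le> q x" for c x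
      unfolding u_def using False that by (intro cINF_greatest) auto
    have "sublinear u"
    proof (rule sublinearI)
      fix x y
      have *: "u (x + y) \<le> q x + q' y" if "q \<in> K" "q' \<in> K" for q q'
      proof -
        have "\<exists>r\<in>K. r \<le> q \<and> r \<le> q'"
        proof (cases "q \<le> q'")
          case False
          then have "q' \<le> q" using lin[OF that] by simp
          then show ?thesis using that(2) by (intro bexI[of _ q']) auto
        qed (use that(1) in \<open>intro bexI[of _ q]; simp\<close>)
        then obtain r where r: "r \<in> K" "r \<le> q" "r \<le> q'" by auto
        then have "u (x + y) \<le> r x + r y"
          using ule[of r "x + y"] KA[of r] sublinear_add[of r x y] by (auto simp: A_def)
        then show ?thesis using r by (fastforce simp: le_fun_def intro: order_trans add_mono)
      qed
      have "u (x + y) - q x \<le> u y" if "q \<in> K" for q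
        using *[OF that] by (intro ugr) (simp add: algebra_simps)
      then have "u (x + y) - u y \<le> u x" by (intro ugr) (simp add: algebra_simps)
      then show "u (x + y) \<le> u x + u y" by simp
    next
      fix t :: real and x assume t: "0 < t"
      have "inverse t * u (t *\<^sub>R x) \<le> u x"
      proof (rule ugr)
        fix q assume q: "q \<in> K"
        then have "u (t *\<^sub>R x) \<le> t * q x"
          using ule[OF q, of "t *\<^sub>R x"] KA[OF q] t by (auto simp: A_def sublinear_scale)
        then show "inverse t * u (t *\<^sub>R x) \<le> q x" using t by (simp add: field_simps)
      qed
      then show "u (t *\<^sub>R x) \<le> t * u x" using t by (simp add: field_simps)
    next
      have "u 0 = (INF q\<in>K. 0)" unfolding u_def
        using KA by (intro INF_cong) (auto simp: A_def sublinear_zero)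
      then show "u 0 = 0" using False by simp
    qed
    moreover have "u \<le> p"
    proof -
      obtain q where "q \<in> K" using False by auto
      then show ?thesis using ule KA[of q] by (fastforce simp: A_def le_fun_def intro: order_trans)
    qed
    ultimately show ?thesis using ule by (intro bexI[of _ u]) (auto simp: A_def le_fun_def)
  qed
  from predicate_Zorn[OF po ch] obtain q where "q \<in> A" "\<forall>a\<in>A. a \<le> q \<longrightarrow> a = q" by blast
  then show thesis
    by (intro that[of q]) (auto simp: A_def intro: order_trans)
qed

text \<open>Straightening a minimal sublinear functional along any vector changes nothing, so it is
  already linear; straightening \<open>p\<close> along \<open>y\<close> before minimising forces equality at \<open>y\<close>.\<close>

theorem hahn_banach_sublinear:
  assumes p: "sublinear p"
  obtains l where "linear l" "\<And>x. l x \<le> p x" "l y = p y"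
proof -
  obtain q where q: "sublinear q" "q \<le> straighten p y"
    and qmin: "\<And>r. sublinear r \<Longrightarrow> r \<le> q \<Longrightarrow> r = q"
    by (rule minimal_sublinear_exists[OF sublinear_straighten[OF p, of y]]) (rule that)
  have "straighten q z \<le> q" for z
    using straighten_le[OF q(1), of 0 z] by (auto simp: le_fun_def)
  then have "straighten q z = q" for z
    by (intro qmin sublinear_straighten q(1))
  then have *: "q x + q z \<le> q (x + z)" for x z
    using straighten_le[OF q(1), of 1 z x] by simp
  have add: "q (x + z) = q x + q z" for x z
    using * sublinear_add[OF q(1)] by (intro antisym)
  have neg: "q (- x) = - q x" for x
    using add[of x "- x"] sublinear_zero[OF q(1)] by simp
  have "linear q"
  proof (rule linearI)
    fix t x
    show "q (t *\<^sub>R x) = t *\<^sub>R q x"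
    proof (cases "0 \<le> t")
      case False
      then have "q (- ((- t) *\<^sub>R x)) = - (- t * q x)"
        unfolding neg by (subst sublinear_scale[OF q(1)]) auto
      then show ?thesis by simp
    qed (simp add: sublinear_scale[OF q(1)])
  qed (rule add)
  moreover have le: "q x \<le> p x" for x
    using q(2) straighten_le[OF p, of 0 y x] by (fastforce simp: le_fun_def intro: order_trans)
  moreover have "q y = p y"
  proof (rule antisym[OF le])
    have "q (- y) \<le> - p y"
      using q(2) straighten_le[OF p, of 1 y "- y"] sublinear_zero[OF p]
      by (fastforce simp: le_fun_def intro: order_trans)
    then show "p y \<le> q y" by (simp add: neg)
  qed
  ultimately show thesis by (rule that)
qed

definition minkowski_functional :: "'a::real_vector set \<Rightarrow> 'a \<Rightarrow> real" where
  "minkowski_functional U x = Inf {t. 0 < t \<and> x \<in> (*\<^sub>R) t ` U}"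

context
  fixes U :: "'a::real_normed_vector set" and r :: real
  assumes U: "convex U" and r: "0 < r" and ball: "ball 0 r \<subseteq> U"
begin

lemma minkowski_set_nonempty:
  assumes "norm x / r < t"
  shows "0 < t \<and> x \<in> (*\<^sub>R) t ` U"
proof -
  have t: "0 < t" using assms r by (smt (verit) divide_nonneg_pos norm_ge_zero)
  have "inverse t *\<^sub>R x \<in> ball 0 r"
    using assms t r by (simp add: field_simps)
  then have "inverse t *\<^sub>R x \<in> U" using ball by auto
  then show ?thesis using t by (auto intro!: image_eqI[where x = "inverse t *\<^sub>R x"])
qed

lemma minkowski_le: "0 < t \<Longrightarrow> x \<in> (*\<^sub>R) t ` U \<Longrightarrow> minkowski_functional U x \<le> t"
  unfolding minkowski_functional_def by (intro cInf_lower bdd_belowI[of _ 0]) auto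

lemma minkowski_nonneg: "0 \<le> minkowski_functional U x"
  unfolding minkowski_functional_def using minkowski_set_nonempty[of x "norm x / r + 1"]
  by (intro cInf_greatest) auto

lemma minkowski_lessE:
  assumes "minkowski_functional U x < s"
  obtains t where "0 < t" "t < s" "x \<in> (*\<^sub>R) t ` U"
proof -
  have "\<exists>t\<in>{t. 0 < t \<and> x \<in> (*\<^sub>R) t ` U}. t < s"
    using assms minkowski_set_nonempty[of x "norm x / r + 1"] unfolding minkowski_functional_def
    by (intro cInf_lessD) auto
  then show thesis using that by auto
qed

lemma minkowski_norm: "minkowski_functional U x \<le> norm x / r"
proof (rule field_le_epsilon)
  fix e :: real assume "0 < e"
  then show "minkowski_functional U x \<le> norm x / r + e"
    using minkowski_set_nonempty[of x "norm x / r + e"] by (auto intro: minkowski_le)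
qed

lemma sublinear_minkowski: "sublinear (minkowski_functional U)"
proof (rule sublinearI)
  fix x y
  show "minkowski_functional U (x + y) \<le> minkowski_functional U x + minkowski_functional U y"
  proof (rule field_le_epsilon)
    fix e :: real assume e: "0 < e"
    from e obtain s where s: "0 < s" "s < minkowski_functional U x + e/2" "x \<in> (*\<^sub>R) s ` U"
      using minkowski_lessE[of x "minkowski_functional U x + e/2"] by auto
    from e obtain t where t: "0 < t" "t < minkowski_functional U y + e/2" "y \<in> (*\<^sub>R) t ` U"
      using minkowski_lessE[of y "minkowski_functional U y + e/2"] by auto
    from s t obtain a b where ab: "a \<in> U" "b \<in> U" "x = s *\<^sub>R a" "y = t *\<^sub>R b" by auto
    have "(s / (s + t)) *\<^sub>R a + (t / (s + t)) *\<^sub>R b \<in> U"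
      using s t ab U by (intro convexD) (auto simp: add_divide_distrib[symmetric])
    moreover have "x + y = (s + t) *\<^sub>R ((s / (s + t)) *\<^sub>R a + (t / (s + t)) *\<^sub>R b)"
      using s t ab by (simp add: scaleR_right_distrib)
    ultimately have "minkowski_functional U (x + y) \<le> s + t" using s t by (intro minkowski_le) auto
    then show "minkowski_functional U (x + y) \<le> minkowski_functional U x + minkowski_functional U y + e" using s t by simp
  qed
next
  fix t :: real and x assume t: "0 < t"
  have "minkowski_functional U (t *\<^sub>R x) \<le> t * minkowski_functional U x + e" if e: "0 < e" for e
  proof -
    from e t obtain s where s: "0 < s" "s < minkowski_functional U x + e/t" "x \<in> (*\<^sub>R) s ` U"
      using minkowski_lessE[of x "minkowski_functional U x + e/t"] by auto
    then have "t *\<^sub>R x \<in> (*\<^sub>R) (t * s) ` U" by auto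
    then have "minkowski_functional U (t *\<^sub>R x) \<le> t * s" using s t by (intro minkowski_le) auto
    also have "\<dots> \<le> t * (minkowski_functional U x + e/t)" using s t by (intro mult_left_mono) auto
    also have "\<dots> = t * minkowski_functional U x + e" using t by (simp add: field_simps)
    finally show ?thesis .
  qed
  then show "minkowski_functional U (t *\<^sub>R x) \<le> t * minkowski_functional U x" by (rule field_le_epsilon)
next
  show "minkowski_functional U 0 = 0" using minkowski_norm[of 0] minkowski_nonneg[of 0] by simp
qed

lemma minkowski_le_1:
  assumes "x \<in> U"
  shows "minkowski_functional U x \<le> 1"
  using assms by (intro minkowski_le) auto

text \<open>A point with functional at most one is a limit of points of \<open>U\<close>, namely of its own contractions.\<close>

lemma minkowski_gt_1:
  assumes "x \<notin> closure U"
  shows "1 < minkowski_functional U x"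
proof (rule ccontr)
  assume "\<not> 1 < minkowski_functional U x"
  then have g: "minkowski_functional U x \<le> 1" by simp
  have 0: "0 \<in> U" using ball r by auto
  have sx: "s *\<^sub>R x \<in> U" if s: "0 < s" "s < 1" for s
  proof -
    have "minkowski_functional U x < inverse s" using g s by (smt (verit) one_less_inverse)
    then obtain t where t: "0 < t" "t < inverse s" "x \<in> (*\<^sub>R) t ` U" by (rule minkowski_lessE)
    then obtain a where a: "a \<in> U" "x = t *\<^sub>R a" by auto
    have st: "s * t < 1" using t s by (simp add: field_simps)
    have "(s * t) *\<^sub>R a + (1 - s * t) *\<^sub>R 0 \<in> U"
      using a t s st U 0 by (intro convexD) (auto intro: less_imp_le)
    then show ?thesis using a by simp
  qed
  have "(\<lambda>n. (1 - 1 / real (n + 2)) *\<^sub>R x) \<longlonglongrightarrow> (1 - 0) *\<^sub>R x"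
    by (intro tendsto_intros LIMSEQ_ignore_initial_segment[OF lim_1_over_n, of 2])
  moreover have "(1 - 1 / real (n + 2)) *\<^sub>R x \<in> U" for n by (intro sx) auto
  ultimately have "x \<in> closure U"
    unfolding closure_sequential
    by (intro exI[of _ "\<lambda>n. (1 - 1 / real (n + 2)) *\<^sub>R x"]) simp
  with assms show False by simp
qed

end

text \<open>The Minkowski functional turns the analytic Hahn--Banach theorem into separation of a point from
  an open convex set.\<close>

lemma separate_point_from_convex:
  fixes C :: "'a::real_normed_vector set"
  assumes C: "convex C" and r: "0 < r" "ball x0 r \<subseteq> C" and y: "y \<notin> closure C"
  obtains l :: "'a \<Rightarrow>\<^sub>L real" where "\<And>x. x \<in> C \<Longrightarrow> l (x - x0) \<le> 1" "1 < l (y - x0)"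
    "\<And>v. l v \<le> norm v / r"
proof -
  define U where "U = (\<lambda>x. x - x0) ` C"
  have "convex U"
    using convex_translation[OF C, of "- x0"] by (simp add: U_def)
  moreover have "ball (0::'a) r \<subseteq> U"
  proof
    fix v :: 'a assume "v \<in> ball 0 r"
    then have "x0 + v \<in> C" using r(2) by (auto simp: subset_eq dist_norm)
    then show "v \<in> U" unfolding U_def by (rule rev_image_eqI) simp
  qed
  ultimately have U: "convex U" "ball 0 r \<subseteq> U" .
  have ynU: "y - x0 \<notin> closure U"
    using y closure_translation[of "- x0" C] unfolding U_def by auto
  note g = U(1) r(1) U(2)
  obtain l where l: "linear l" "\<And>x. l x \<le> minkowski_functional U x" "l (y - x0) = minkowski_functional U (y - x0)"
    using hahn_banach_sublinear[OF sublinear_minkowski[OF g]] by blast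
  have le: "l v \<le> norm v / r" for v
    using l(2) minkowski_norm[OF g] order_trans by blast
  have abs: "\<bar>l v\<bar> \<le> norm v / r" for v
    using le[of v] le[of "- v"] linear_neg[OF l(1), of v] by (auto simp: abs_le_iff)
  have bl: "bounded_linear l"
    by (rule bounded_linear_intro[of l "1 / r"])
      (use l(1) abs in \<open>auto simp: linear_add linear_scale\<close>)
  show thesis
  proof (rule that[of "Blinfun l"])
    fix x assume "x \<in> C"
    then have "minkowski_functional U (x - x0) \<le> 1" by (intro minkowski_le_1[OF g]) (auto simp: U_def)
    then show "blinfun_apply (Blinfun l) (x - x0) \<le> 1"
      using l(2)[of "x - x0"] by (simp add: bounded_linear_Blinfun_apply[OF bl])
  next
    show "1 < blinfun_apply (Blinfun l) (y - x0)"
      using minkowski_gt_1[OF g ynU] l(3) by (simp add: bounded_linear_Blinfun_apply[OF bl])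
  next
    show "blinfun_apply (Blinfun l) v \<le> norm v / r" for v
      using le by (simp add: bounded_linear_Blinfun_apply[OF bl])
  qed
qed

text \<open>By the Lindeloef property countably many of the separating functionals already cut out the
  closure.\<close>

lemma closure_convex_countable_halfspaces:
  fixes C :: "'a::{real_normed_vector, second_countable_topology} set"
  assumes C: "convex C" and r: "0 < r" "ball x0 r \<subseteq> C"
  obtains l :: "nat \<Rightarrow> 'a \<Rightarrow>\<^sub>L real" where "\<And>k v. l k v \<le> norm v / r"
    "closure C = {x. \<forall>k. l k (x - x0) \<le> 1}"
proof -
  define H where "H = {l :: 'a \<Rightarrow>\<^sub>L real. (\<forall>x\<in>C. l (x - x0) \<le> 1) \<and> (\<forall>v. l v \<le> norm v / r)}"
  define S where "S l = {x. 1 < blinfun_apply l (x - x0)}" for l :: "'a \<Rightarrow>\<^sub>L real"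
  have "open (S l)" for l
    unfolding S_def by (intro open_Collect_less continuous_intros)
  then have "\<And>A. A \<in> S ` H \<Longrightarrow> open A" by auto
  from Lindelof[OF this] obtain F where F: "F \<subseteq> S ` H" "countable F" "\<Union>F = \<Union>(S ` H)"
    by blast
  then obtain H' where H': "H' \<subseteq> H" "countable H'" "F = S ` H'"
    using countable_subset_image[of F S H] by auto
  have "0 \<in> H" using r(1) by (auto simp: H_def)
  define G where "G = insert 0 H'"
  have G: "countable G" "G \<noteq> {}" "G \<subseteq> H" using H' \<open>0 \<in> H\<close> by (auto simp: G_def)
  define l where "l = from_nat_into G"
  have lG: "range l = G" unfolding l_def using G by (simp add: range_from_nat_into)
  have lH: "l k \<in> H" for k using lG G by auto
  show thesis
  proof (rule that[of l])
    show "l k v \<le> norm v / r" for k v using lH[of k] by (auto simp: H_def)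
    have "C \<subseteq> {x. \<forall>k. l k (x - x0) \<le> 1}" using lH by (auto simp: H_def)
    moreover have "closed {x. \<forall>k. blinfun_apply (l k) (x - x0) \<le> 1}"
      by (intro closed_Collect_all closed_Collect_le continuous_intros)
    ultimately have "closure C \<subseteq> {x. \<forall>k. l k (x - x0) \<le> 1}" by (rule closure_minimal)
    moreover have "y \<in> closure C" if y: "\<forall>k. l k (y - x0) \<le> 1" for y
    proof (rule ccontr)
      assume "y \<notin> closure C"
      then obtain m :: "'a \<Rightarrow>\<^sub>L real" where "\<And>x. x \<in> C \<Longrightarrow> m (x - x0) \<le> 1" "1 < m (y - x0)"
        "\<And>v. m v \<le> norm v / r"
        by (rule separate_point_from_convex[OF C r]) (rule that)
      then have "m \<in> H" "y \<in> S m" by (auto simp: H_def S_def)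
      then have "y \<in> \<Union>(S ` H')" using F(3) H'(3) by blast
      then obtain m where m: "m \<in> H'" "y \<in> S m" by auto
      then have "m \<in> range l" using lG by (simp add: G_def)
      then obtain k where "m = l k" by auto
      then show False using m y by (auto simp: S_def not_le[symmetric] simp del: not_le)
    qed
    ultimately show "closure C = {x. \<forall>k. l k (x - x0) \<le> 1}" by blast
  qed
qed

text \<open>Applied to the unit ball this yields a countable norming family of functionals.\<close>

lemma cball_countable_functionals:
  obtains l :: "nat \<Rightarrow> 'a::{real_normed_vector, second_countable_topology} \<Rightarrow>\<^sub>L real"
  where "\<And>x s. 0 \<le> s \<Longrightarrow> norm x \<le> s \<longleftrightarrow> (\<forall>k. \<bar>l k x\<bar> \<le> s)"
proof -
  obtain l :: "nat \<Rightarrow> 'a \<Rightarrow>\<^sub>L real" where l: "\<And>k v. l k v \<le> norm v / 1"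
    "closure (ball 0 1) = {x. \<forall>k. l k (x - 0) \<le> 1}"
    using closure_convex_countable_halfspaces[of "ball (0::'a) 1" 1 0] by auto
  have abs: "\<bar>l k v\<bar> \<le> norm v" for k v
    using l(1)[of k v] l(1)[of k "- v"] by (auto simp: blinfun.minus_right)
  have 1: "norm x \<le> 1" if "\<forall>k. l k x \<le> 1" for x
    using l(2) that by auto
  have pos: "norm x \<le> s" if s: "0 < s" and x: "\<forall>k. \<bar>l k x\<bar> \<le> s" for s x
  proof -
    have "l k (inverse s *\<^sub>R x) \<le> 1" for k
      using x s by (auto simp: blinfun.scaleR_right field_simps dest: spec[of _ k])
    then have "norm (inverse s *\<^sub>R x) \<le> 1" using 1 by blast
    then show ?thesis using s by (simp add: field_simps)
  qed
  show thesis
  proof (rule that[of l])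
    fix x :: 'a and s :: real assume s: "0 \<le> s"
    show "norm x \<le> s \<longleftrightarrow> (\<forall>k. \<bar>l k x\<bar> \<le> s)"
    proof
      show "norm x \<le> s \<Longrightarrow> \<forall>k. \<bar>l k x\<bar> \<le> s" using abs order_trans by blast
      assume x: "\<forall>k. \<bar>l k x\<bar> \<le> s"
      show "norm x \<le> s"
      proof (rule field_le_epsilon)
        fix e :: real assume "0 < e"
        then show "norm x \<le> s + e" using x s by (intro pos) (auto intro: order_trans)
      qed
    qed
  qed
qed

section \<open>The Prekopa--Leindler inequality on the line\<close>

text \<open>Brunn--Minkowski on the line. For compact sets one translates so that \<open>K\<close> ends where \<open>L\<close>
  begins: then \<open>K + min L\<close> and \<open>max K + L\<close> overlap in one point and lie in \<open>K + L\<close>. Inner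
  regularity gives the general case.\<close>

lemma brunn_minkowski_line_compact:
  fixes K L :: "real set"
  assumes "compact K" "compact L" "K \<noteq> {}" "L \<noteq> {}"
    and S: "S \<in> sets lborel" "\<And>a b. a \<in> K \<Longrightarrow> b \<in> L \<Longrightarrow> (a + b) / 2 \<in> S"
  shows "emeasure lborel K + emeasure lborel L \<le> 2 * emeasure lborel S"
proof -
  obtain k where k: "k \<in> K" "\<And>a. a \<in> K \<Longrightarrow> a \<le> k"
    using compact_attains_sup[of K] assms by auto
  obtain l where l: "l \<in> L" "\<And>b. b \<in> L \<Longrightarrow> l \<le> b"
    using compact_attains_inf[of L] assms by auto
  have KL: "K \<in> sets borel" "L \<in> sets borel"
    using assms by (auto intro: borel_closed compact_imp_closed)
  have half: "emeasure lborel A = 2 * emeasure lborel {x. 2 * x - c \<in> A}" if "A \<in> sets borel" for A and c :: real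
  proof -
    have "emeasure lborel A = emeasure (density (distr lborel borel (\<lambda>x. - c + 2 * x)) (\<lambda>_. \<bar>2\<bar>)) A"
      using lborel_real_affine[of 2 "- c"] by simp
    also have "\<dots> = 2 * emeasure lborel ((\<lambda>x. - c + 2 * x) -` A)"
      using that by (simp add: emeasure_density emeasure_distr nn_integral_cmult)
    also have "(\<lambda>x. - c + 2 * x) -` A = {x. 2 * x - c \<in> A}" by auto
    finally show ?thesis .
  qed
  define D where "D = {x. 2 * x - l \<in> K}"
  define E where "E = {x. 2 * x - k \<in> L}"
  have m[measurable]: "D \<in> sets borel" "E \<in> sets borel" "S \<in> sets borel"
    using KL S unfolding D_def E_def by (auto intro!: pred_sets2)
  have "D \<union> E \<subseteq> S"
  proof
    fix x assume "x \<in> D \<union> E"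
    then show "x \<in> S" using S(2)[of "2 * x - l" l] S(2)[of k "2 * x - k"] k l
      by (auto simp: D_def E_def)
  qed
  have sub: "D \<inter> E \<subseteq> {(k + l) / 2}"
  proof
    fix x assume "x \<in> D \<inter> E"
    then have "2 * x - l \<le> k" "l \<le> 2 * x - k" using k l by (auto simp: D_def E_def)
    then show "x \<in> {(k + l) / 2}" by simp
  qed
  have "emeasure lborel (D \<inter> E) = 0"
    using emeasure_mono[OF sub, of lborel] by simp
  then have "emeasure lborel (E - D) = emeasure lborel E"
    by (subst emeasure_Diff_null_set[symmetric, of "D \<inter> E"])
       (auto simp: null_sets_def Diff_Int intro!: arg_cong[where f = "emeasure lborel"])
  then have "emeasure lborel D + emeasure lborel E = emeasure lborel (D \<union> (E - D))"
    by (subst plus_emeasure[symmetric]) auto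
  also have "\<dots> \<le> emeasure lborel S"
    using \<open>D \<union> E \<subseteq> S\<close> by (intro emeasure_mono) auto
  finally have "2 * (emeasure lborel D + emeasure lborel E) \<le> 2 * emeasure lborel S"
    by (rule mult_left_mono) simp
  then show ?thesis
    using half[OF KL(1), of l] half[OF KL(2), of k] by (simp add: D_def E_def distrib_left)
qed

text \<open>Inner regularity is known for finite measures; it transfers to Lebesgue measure restricted to
  growing intervals.\<close>

lemma emeasure_lborel_inner_compact:
  fixes A :: "real set"
  assumes A: "A \<in> sets lborel"
  shows "emeasure lborel A = (SUP K\<in>{K. K \<subseteq> A \<and> compact K}. emeasure lborel K)"
proof (rule antisym)
  define I where "I n = {- real n..real n}" for n
  have "(\<Union>n. A \<inter> I n) = A"
  proof safe
    fix x assume "x \<in> A"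
    moreover obtain n where "\<bar>x\<bar> \<le> real n" using real_arch_simple by blast
    ultimately have "x \<in> A \<inter> I n" by (auto simp: I_def)
    then show "x \<in> (\<Union>n. A \<inter> I n)" by blast
  qed
  then have "emeasure lborel A = (SUP n. emeasure lborel (A \<inter> I n))"
    using A by (subst SUP_emeasure_incseq) (auto simp: incseq_def I_def)
  also have "\<dots> \<le> (SUP K\<in>{K. K \<subseteq> A \<and> compact K}. emeasure lborel K)"
  proof (rule SUP_least)
    fix n
    let ?M = "density lborel (indicator (I n))"
    have M: "emeasure ?M B = emeasure lborel (B \<inter> I n)" if "B \<in> sets borel" for B
      using that by (subst emeasure_density)
        (auto simp: I_def indicator_inter_arith[symmetric] Int_commute simp flip: nn_integral_indicator)
    have "emeasure lborel (A \<inter> I n) = emeasure ?M A" using A M by simp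
    also have "\<dots> = (SUP K\<in>{K. K \<subseteq> A \<and> compact K}. emeasure ?M K)"
      using A M[of UNIV] by (intro inner_regular) (auto simp: I_def)
    also have "\<dots> \<le> (SUP K\<in>{K. K \<subseteq> A \<and> compact K}. emeasure lborel K)"
    proof (intro SUP_subset_mono order_refl)
      fix K assume "K \<in> {K. K \<subseteq> A \<and> compact K}"
      then have "K \<in> sets borel" by (auto intro: borel_compact)
      then show "emeasure ?M K \<le> emeasure lborel K"
        by (simp add: M) (intro emeasure_mono, auto)
    qed
    finally show "emeasure lborel (A \<inter> I n)
      \<le> (SUP K\<in>{K. K \<subseteq> A \<and> compact K}. emeasure lborel K)" .
  qed
  finally show "emeasure lborel A \<le> (SUP K\<in>{K. K \<subseteq> A \<and> compact K}. emeasure lborel K)" .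
next
  show "(SUP K\<in>{K. K \<subseteq> A \<and> compact K}. emeasure lborel K) \<le> emeasure lborel A"
    using A by (intro SUP_least emeasure_mono) auto
qed

lemma brunn_minkowski_line:
  fixes A B :: "real set"
  assumes A: "A \<in> sets lborel" "A \<noteq> {}" and B: "B \<in> sets lborel" "B \<noteq> {}"
    and S: "S \<in> sets lborel" "\<And>a b. a \<in> A \<Longrightarrow> b \<in> B \<Longrightarrow> (a + b) / 2 \<in> S"
  shows "emeasure lborel A + emeasure lborel B \<le> 2 * emeasure lborel S"
proof -
  obtain a b where a: "a \<in> A" and b: "b \<in> B" using A B by auto
  \<comment> \<open>Adding one point keeps the compact subsets nonempty without changing their measure.\<close>
  have KL: "emeasure lborel K + emeasure lborel L \<le> 2 * emeasure lborel S"
    if "K \<subseteq> A" "compact K" "L \<subseteq> B" "compact L" for K L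
  proof -
    have "emeasure lborel K + emeasure lborel L
        \<le> emeasure lborel (insert a K) + emeasure lborel (insert b L)"
      using that by (intro add_mono emeasure_mono) (auto intro!: borel_compact compact_insert)
    also have "\<dots> \<le> 2 * emeasure lborel S"
      using that a b S by (intro brunn_minkowski_line_compact compact_insert) auto
    finally show ?thesis .
  qed
  have ne: "{K. K \<subseteq> X \<and> compact K} \<noteq> {}" for X :: "real set" by auto
  have "emeasure lborel A + emeasure lborel L \<le> 2 * emeasure lborel S"
    if "L \<subseteq> B" "compact L" for L
    using KL that unfolding emeasure_lborel_inner_compact[OF A(1)]
    unfolding ennreal_SUP_add_left[OF ne, symmetric] by (intro SUP_least) auto
  then have "emeasure lborel A + (SUP L\<in>{L. L \<subseteq> B \<and> compact L}. emeasure lborel L)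
      \<le> 2 * emeasure lborel S"
    by (subst ennreal_SUP_add_right[OF ne]) (auto intro!: SUP_least)
  then show ?thesis
    unfolding emeasure_lborel_inner_compact[OF B(1)] .
qed

text \<open>The layer-cake formula, cut off at the supremum \<open>a\<close> and rescaled to levels in \<open>(0, 1)\<close>.\<close>

lemma layer_cake:
  fixes f :: "real \<Rightarrow> real"
  assumes f[measurable]: "f \<in> borel_measurable borel" and a: "0 < a" and f0: "\<And>x. 0 \<le> f x"
  shows "(\<integral>\<^sup>+t\<in>{0..<1}. emeasure lborel {x. a * t < f x} \<partial>lborel)
    = (\<integral>\<^sup>+x. min 1 (ennreal (f x / a)) \<partial>lborel)"
proof -
  have "(\<integral>\<^sup>+t\<in>{0..<1}. emeasure lborel {x. a * t < f x} \<partial>lborel)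
      = (\<integral>\<^sup>+t. (\<integral>\<^sup>+x. indicator {0..<1} t * indicator {x. a * t < f x} x \<partial>lborel) \<partial>lborel)"
    by (intro nn_integral_cong) (simp add: nn_integral_cmult mult.commute)
  also have "\<dots> = (\<integral>\<^sup>+x. (\<integral>\<^sup>+t. indicator {0..<1} t * indicator {x. a * t < f x} x \<partial>lborel) \<partial>lborel)"
    by (rule lborel_pair.Fubini') (auto simp: split_beta' pred_def)
  also have "\<dots> = (\<integral>\<^sup>+x. min 1 (ennreal (f x / a)) \<partial>lborel)"
  proof (rule nn_integral_cong)
    fix x
    have "(\<integral>\<^sup>+t. indicator {0..<1} t * indicator {x. a * t < f x} x \<partial>lborel)
      = (\<integral>\<^sup>+t. indicator {0..<min 1 (f x / a)} t \<partial>lborel)"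
      using a by (intro nn_integral_cong) (auto simp: indicator_def field_simps)
    also have "\<dots> = min 1 (ennreal (f x / a))"
      using f0[of x] a by (simp add: min_def divide_right_mono flip: ennreal_1)
    finally show "(\<integral>\<^sup>+t. indicator {0..<1} t * indicator {x. a * t < f x} x \<partial>lborel)
      = min 1 (ennreal (f x / a))" .
  qed
  finally show ?thesis .
qed

text \<open>Midpoint form of the Prekopa--Leindler inequality on the line: after rescaling \<open>f\<close> and \<open>g\<close>
  to supremum one, the superlevel sets satisfy the hypothesis of Brunn--Minkowski, and
  integrating over levels gives the arithmetic mean, which dominates the geometric one.\<close>

lemma prekopa_leindler_line:
  fixes f g h :: "real \<Rightarrow> real"
  assumes f: "integrable lborel f" "\<And>x. 0 \<le> f x" "bdd_above (range f)"
    and g: "integrable lborel g" "\<And>x. 0 \<le> g x" "bdd_above (range g)"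
    and h: "integrable lborel h" "\<And>x. 0 \<le> h x"
    and fgh: "\<And>x y. f x * g y \<le> (h ((x + y) / 2))\<^sup>2"
  shows "(LINT x|lborel. f x) * (LINT x|lborel. g x) \<le> (LINT x|lborel. h x)\<^sup>2"
proof -
  have [measurable]: "f \<in> borel_measurable borel" "g \<in> borel_measurable borel"
    "h \<in> borel_measurable borel"
    using f(1) g(1) h(1) by (auto dest: borel_measurable_integrable)
  define a where "a = (SUP x. f x)"
  define b where "b = (SUP x. g x)"
  have fa: "f x \<le> a" and gb: "g x \<le> b" for x
    unfolding a_def b_def using f(3) g(3) by (auto intro: cSUP_upper)
  show ?thesis
  proof (cases "a \<le> 0 \<or> b \<le> 0")
    case True
    then have "(\<forall>x. f x = 0) \<or> (\<forall>x. g x = 0)"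
      using fa gb f(2) g(2) by (meson order_antisym order_trans)
    then show ?thesis by auto
  next
    case False
    then have ab: "0 < a" "0 < b" by auto
    define c where "c = sqrt (a * b)"
    have c: "0 < c" "c\<^sup>2 = a * b" using ab by (auto simp: c_def)
    have lev: "emeasure lborel {x. a * t < f x} + emeasure lborel {x. b * t < g x}
        \<le> 2 * emeasure lborel {x. c * t < h x}" if t: "0 \<le> t" "t < 1" for t
    proof (rule brunn_minkowski_line)
      have "a * t < a" "b * t < b" using ab t by auto
      then show "{x. a * t < f x} \<noteq> {}" "{x. b * t < g x} \<noteq> {}"
        using less_cSUP_iff[of UNIV f] less_cSUP_iff[of UNIV g] f(3) g(3)
        by (auto simp: a_def b_def)
    next
      fix x y assume "x \<in> {x. a * t < f x}" "y \<in> {x. b * t < g x}"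
      then have "(a * t) * (b * t) < f x * g y"
        using t ab by (intro mult_strict_mono') auto
      also have "\<dots> \<le> (h ((x + y) / 2))\<^sup>2" by (rule fgh)
      also have "(a * t) * (b * t) = (c * t)\<^sup>2"
        by (simp add: power_mult_distrib c(2)) (simp add: power2_eq_square)
      finally have "(c * t)\<^sup>2 < (h ((x + y) / 2))\<^sup>2" .
      then show "(x + y) / 2 \<in> {x. c * t < h x}"
        using h(2) by (auto intro: power_less_imp_less_base)
    qed auto
    have one: "min 1 (ennreal (f x / a)) = ennreal (f x / a)" 
       "min 1 (ennreal (g x / b)) = ennreal (g x / b)" for x
      using fa[of x] gb[of x] ab by (auto simp: min_def ennreal_le_1)
    have m[measurable]: "(\<lambda>t. emeasure lborel {x. k * t < u x}) \<in> borel_measurable borel"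
      if [measurable]: "u \<in> borel_measurable borel" for k and u :: "real \<Rightarrow> real"
    proof -
      have "{p \<in> space (lborel \<Otimes>\<^sub>M lborel). k * fst p < u (snd p)} \<in> sets (lborel \<Otimes>\<^sub>M lborel)"
        by measurable
      from lborel.measurable_emeasure_Pair[OF this] show ?thesis
        by (simp add: space_pair_measure vimage_def)
    qed
    have "ennreal (LINT x|lborel. f x / a) + ennreal (LINT x|lborel. g x / b)
        = (\<integral>\<^sup>+x. f x / a \<partial>lborel) + (\<integral>\<^sup>+x. g x / b \<partial>lborel)"
      using f g ab by (subst (1 2) nn_integral_eq_integral) auto
    also have "\<dots> = (\<integral>\<^sup>+t\<in>{0..<1}. emeasure lborel {x. a * t < f x} \<partial>lborel)
        + (\<integral>\<^sup>+t\<in>{0..<1}. emeasure lborel {x. b * t < g x} \<partial>lborel)"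
      using f(2) g(2) ab by (simp add: layer_cake one)
    also have "\<dots> = (\<integral>\<^sup>+t\<in>{0..<1}. emeasure lborel {x. a * t < f x}
        + emeasure lborel {x. b * t < g x} \<partial>lborel)"
      by (subst nn_integral_add[symmetric]) (auto simp: distrib_right)
    also have "\<dots> \<le> (\<integral>\<^sup>+t\<in>{0..<1}. 2 * emeasure lborel {x. c * t < h x} \<partial>lborel)"
      using lev by (intro nn_integral_mono) (auto simp: indicator_def)
    also have "\<dots> = 2 * (\<integral>\<^sup>+t\<in>{0..<1}. emeasure lborel {x. c * t < h x} \<partial>lborel)"
      by (simp add: nn_integral_cmult mult.assoc)
    also have "\<dots> \<le> 2 * (\<integral>\<^sup>+x. h x / c \<partial>lborel)"
      using c h(2) by (auto simp: layer_cake intro!: mult_left_mono nn_integral_mono)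
    also have "\<dots> = ennreal 2 * ennreal (LINT x|lborel. h x / c)"
      using h c by (subst nn_integral_eq_integral) auto
    finally have "(LINT x|lborel. f x) / a + (LINT x|lborel. g x) / b \<le> 2 * ((LINT x|lborel. h x) / c)"
      using f(2) g(2) h(2) ab c
      by (simp add: ennreal_le_iff integral_nonneg_AE flip: ennreal_plus ennreal_mult ennreal_numeral)
    moreover define F G H where "F = (LINT x|lborel. f x) / a" and "G = (LINT x|lborel. g x) / b"
      and "H = (LINT x|lborel. h x) / c"
    moreover have "0 \<le> F" "0 \<le> G" "0 \<le> H"
      using f(2) g(2) h(2) ab c by (auto simp: F_def G_def H_def)
    ultimately have "F + G \<le> 2 * H" "0 \<le> F" "0 \<le> G" "0 \<le> H" by auto
    then have "(F + G)\<^sup>2 \<le> (2 * H)\<^sup>2" by (intro power_mono) auto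
    moreover have "4 * (F * G) \<le> (F + G)\<^sup>2"
      using zero_le_power2[of "F - G"] by (simp add: power2_eq_square algebra_simps)
    ultimately have "F * G \<le> H\<^sup>2" by (simp add: power_mult_distrib)
    then have "a * b * (F * G) \<le> c\<^sup>2 * H\<^sup>2"
      using ab c by (simp add: mult_left_mono)
    then show ?thesis using ab c by (simp add: F_def G_def H_def power_divide)
  qed
qed

section \<open>Uniqueness of joint laws\<close>

text \<open>Normalising the weighted measures reduces this to Levy's uniqueness theorem. The phase \<open>\<theta>\<close> covers cosine
  and sine at once.\<close>

lemma weighted_law_unique:
  fixes X :: "'a \<Rightarrow> real" and Y :: "'b \<Rightarrow> real"
  assumes M: "finite_measure M" and N: "finite_measure N"
    and [measurable]: "X \<in> borel_measurable M" "Y \<in> borel_measurable N"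
      "w \<in> borel_measurable M" "v \<in> borel_measurable N"
    and w: "\<And>x. 0 \<le> w x" "\<And>x. w x \<le> B" and v: "\<And>x. 0 \<le> v x" "\<And>x. v x \<le> B"
    and eq: "\<And>s \<theta>. (LINT x|M. w x * cos (s * X x + \<theta>)) = (LINT x|N. v x * cos (s * Y x + \<theta>))"
    and A: "A \<in> sets borel"
  shows "(LINT x|M. w x * indicator A (X x)) = (LINT x|N. v x * indicator A (Y x))"
proof -
  interpret M: finite_measure M by fact
  interpret N: finite_measure N by fact
  define m where "m = (LINT x|M. w x)"
  have intw: "integrable M (\<lambda>x. w x * f x)" if [measurable]: "f \<in> borel_measurable M"
    and f: "\<And>x. \<bar>f x\<bar> \<le> 1" for f
    using w f by (intro M.integrable_const_bound[of _ B])
      (auto simp: abs_mult intro!: mult_left_le[THEN order_trans])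
  have intv: "integrable N (\<lambda>x. v x * f x)" if [measurable]: "f \<in> borel_measurable N"
    and f: "\<And>x. \<bar>f x\<bar> \<le> 1" for f
    using v f by (intro N.integrable_const_bound[of _ B])
      (auto simp: abs_mult intro!: mult_left_le[THEN order_trans])
  have mv: "m = (LINT x|N. v x)" using eq[of 0 0] by (simp add: m_def)
  note [measurable] = A
  have "0 \<le> m" using w by (simp add: m_def)
  then consider "m = 0" | "0 < m" by linarith
  then show ?thesis
  proof cases
    case 1
    have "(LINT x|M. w x * indicator A (X x)) \<le> (LINT x|M. w x)"
      using w intw[of "\<lambda>_. 1"]
      by (intro integral_mono intw) (auto simp: indicator_def mult_left_le)
    moreover have "(LINT x|N. v x * indicator A (Y x)) \<le> (LINT x|N. v x)"
      using v intv[of "\<lambda>_. 1"]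
      by (intro integral_mono intv) (auto simp: indicator_def mult_left_le)
    moreover have "0 \<le> (LINT x|M. w x * indicator A (X x))" "0 \<le> (LINT x|N. v x * indicator A (Y x))"
      using w v by auto
    ultimately show ?thesis using 1 mv by (simp add: m_def)
  next
    case 2
    define M1 where "M1 = distr (density M (\<lambda>x. w x / m)) borel X"
    define N1 where "N1 = distr (density N (\<lambda>x. v x / m)) borel Y"
    have "(\<integral>\<^sup>+x. w x / m \<partial>M) = ennreal (LINT x|M. w x / m)"
      using w 2 intw[of "\<lambda>_. 1"] by (intro nn_integral_eq_integral) auto
    then have pM: "prob_space (density M (\<lambda>x. w x / m))"
      using 2 by (intro prob_spaceI) (simp add: emeasure_density m_def cong: nn_integral_cong)
    have "(\<integral>\<^sup>+x. v x / m \<partial>N) = ennreal (LINT x|N. v x / m)"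
      using v 2 intv[of "\<lambda>_. 1"] by (intro nn_integral_eq_integral) auto
    then have pN: "prob_space (density N (\<lambda>x. v x / m))"
      using 2 mv by (intro prob_spaceI) (simp add: emeasure_density cong: nn_integral_cong)
    have rd: "real_distribution M1" "real_distribution N1"
      unfolding M1_def N1_def real_distribution_def real_distribution_axioms_def
      using prob_space.prob_space_distr[OF pM, of X borel] prob_space.prob_space_distr[OF pN, of Y borel]
      by auto
    have int1: "(LINT x|M1. f x) = (LINT x|M. w x * f (X x)) / m"
      if [measurable]: "f \<in> borel_measurable borel" for f :: "real \<Rightarrow> real"
      unfolding M1_def using w 2 by (simp add: integral_distr integral_density)
    have int2: "(LINT x|N1. f x) = (LINT x|N. v x * f (Y x)) / m"
      if [measurable]: "f \<in> borel_measurable borel" for f :: "real \<Rightarrow> real"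
      unfolding N1_def using v 2 by (simp add: integral_distr integral_density)
    have cs: "(LINT x|M1. cos (s * x + \<theta>)) = (LINT x|N1. cos (s * x + \<theta>))" for s \<theta>
      by (simp add: int1 int2 eq)
    have "char M1 = char N1"
    proof
      fix s
      have sin: "sin (s * x) = cos (s * x + (- pi / 2))" for x
        by (simp add: cos_diff)
      interpret M1: real_distribution M1 by fact
      interpret N1: real_distribution N1 by fact
      have "integrable M1 (\<lambda>x. iexp (s * x))" "integrable N1 (\<lambda>x. iexp (s * x))"
        by (auto intro!: M1.integrable_iexp N1.integrable_iexp)
      then show "char M1 s = char N1 s"
        using cs[of s 0] cs[of s "- pi / 2"]
        by (intro complex_eqI) (simp_all add: char_def sin Re_exp Im_exp flip: integral_Re integral_Im)
    qed
    then have "M1 = N1" by (rule Levy_uniqueness[OF rd])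
    then have "(LINT x|M1. indicat_real A x) = (LINT x|N1. indicat_real A x)" by simp
    then show ?thesis
      using 2 unfolding int1[OF borel_measurable_indicator[OF A]] int2[OF borel_measurable_indicator[OF A]]
      by simp
  qed
qed

text \<open>The joint law of finitely many variables is determined by the characteristic function of their
  linear combinations. Events in the coordinates are fixed one at a time: weighting with
  \<open>1 + cos \<dots>\<close> keeps the measure positive, and products of cosines are sums of cosines of linear
  combinations, so each step only needs uniqueness on the line.\<close>

lemma joint_law_unique:
  fixes X :: "'i \<Rightarrow> 'a \<Rightarrow> real" and Y :: "'i \<Rightarrow> 'b \<Rightarrow> real"
  assumes M: "prob_space M" and N: "prob_space N" and I: "finite I"
    and X: "\<And>i. i \<in> I \<Longrightarrow> X i \<in> borel_measurable M"
    and Y: "\<And>i. i \<in> I \<Longrightarrow> Y i \<in> borel_measurable N"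
    and eq: "\<And>t \<theta>. (LINT x|M. cos ((\<Sum>i\<in>I. t i * X i x) + \<theta>))
                = (LINT x|N. cos ((\<Sum>i\<in>I. t i * Y i x) + \<theta>))"
  shows "distr M (PiM I (\<lambda>_. borel)) (\<lambda>x. \<lambda>i\<in>I. X i x)
       = distr N (PiM I (\<lambda>_. borel)) (\<lambda>x. \<lambda>i\<in>I. Y i x)"
proof -
  interpret M: prob_space M by fact
  interpret N: prob_space N by fact
  define SX where "SX t x = (\<Sum>i\<in>I. t i * X i x)" for t x
  define SY where "SY t x = (\<Sum>i\<in>I. t i * Y i x)" for t x
  have [measurable]: "SX t \<in> borel_measurable M" "SY t \<in> borel_measurable N" for t
    using X Y by (auto simp: SX_def[abs_def] SY_def[abs_def])
  define DX where "DX J A x = (\<Prod>i\<in>J. indicator (A i) (X i x) :: real)" for J and A :: "'i \<Rightarrow> real set" and x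
  define DY where "DY J A x = (\<Prod>i\<in>J. indicator (A i) (Y i x) :: real)" for J and A :: "'i \<Rightarrow> real set" and x
  have D01: "0 \<le> DX J A x" "DX J A x \<le> 1" "0 \<le> DY J A y" "DY J A y \<le> 1" for J A x y
    unfolding DX_def DY_def by (auto intro!: prod_nonneg prod_le_1)
  have P: "(LINT x|M. DX J A x * cos (SX t x + \<theta>)) = (LINT x|N. DY J A x * cos (SY t x + \<theta>))"
    if "finite J" "J \<subseteq> I" "\<And>i. i \<in> J \<Longrightarrow> A i \<in> sets borel" for J A t \<theta>
    using that
  proof (induction J arbitrary: t \<theta> rule: finite_induct)
    case empty
    then show ?case using eq by (simp add: DX_def DY_def SX_def SY_def)
  next
    case (insert j J)
    have IH: "(LINT x|M. DX J A x * cos (SX t x + \<theta>)) = (LINT x|N. DY J A x * cos (SY t x + \<theta>))" for t \<theta>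
      using insert by auto
    have [measurable]: "X j \<in> borel_measurable M" "Y j \<in> borel_measurable N" "A j \<in> sets borel"
      using insert X Y by auto
    have XJ: "X i \<in> borel_measurable M" "Y i \<in> borel_measurable N" "A i \<in> sets borel" if "i \<in> J" for i
      using insert X Y that by auto
    have DXm[measurable]: "DX J A \<in> borel_measurable M"
      unfolding DX_def[abs_def] using XJ
      by (intro borel_measurable_prod borel_measurable_indicator' measurable_sets) auto
    have DYm[measurable]: "DY J A \<in> borel_measurable N"
      unfolding DY_def[abs_def] using XJ
      by (intro borel_measurable_prod borel_measurable_indicator' measurable_sets) auto
    have intM: "integrable M (\<lambda>x. DX J A x * f x)" if [measurable]: "f \<in> borel_measurable M"
      and "\<And>x. \<bar>f x\<bar> \<le> 1" for f
      using that D01[of J A] by (intro M.integrable_const_bound[of _ 1])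
        (auto simp: abs_mult intro!: mult_le_one)
    have intN: "integrable N (\<lambda>x. DY J A x * f x)" if [measurable]: "f \<in> borel_measurable N"
      and "\<And>x. \<bar>f x\<bar> \<le> 1" for f
      using that D01[of J A] by (intro N.integrable_const_bound[of _ 1])
        (auto simp: abs_mult intro!: mult_le_one)
    have upd: "s * X j x + SX t x = SX (t(j := t j + s)) x" "s * Y j y + SY t y = SY (t(j := t j + s)) y"
      for s t x y
      unfolding SX_def SY_def using insert I
      by (auto simp: sum.remove[of I j] algebra_simps)
    have Z: "SX (\<lambda>_. 0) x = 0" "SY (\<lambda>_. 0) y = 0" for x y by (auto simp: SX_def SY_def)
    have key: "(LINT x|M. DX J A x * (1 + cos (SX t x + \<theta>)) * indicator (A j) (X j x))
        = (LINT x|N. DY J A x * (1 + cos (SY t x + \<theta>)) * indicator (A j) (Y j x))" for t \<theta>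
    proof (rule weighted_law_unique[where B = 2])
      fix s \<theta>'
      have tri: "d * (1 + cos (u + \<theta>)) * cos (v + \<theta>') =
        d * cos (v + 0 + \<theta>') + (d * cos (v + u + (\<theta>' + \<theta>)) + d * cos (- v + u + (\<theta> - \<theta>'))) / 2"
        for d u v :: real
      proof -
        have "cos (u + \<theta>) * cos (v + \<theta>') = (cos (v + u + (\<theta>' + \<theta>)) + cos (- v + u + (\<theta> - \<theta>'))) / 2"
          by (subst cos_times_cos) (simp add: algebra_simps)
        then show ?thesis by (simp add: algebra_simps)
      qed
      have "(LINT x|M. DX J A x * (1 + cos (SX t x + \<theta>)) * cos (s * X j x + \<theta>')) =
        (LINT x|M. DX J A x * cos (s * X j x + SX (\<lambda>_. 0) x + \<theta>')) +
        ((LINT x|M. DX J A x * cos (s * X j x + SX t x + (\<theta>' + \<theta>))) +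
         (LINT x|M. DX J A x * cos ((- s) * X j x + SX t x + (\<theta> - \<theta>')))) / 2"
        unfolding tri Z by (simp add: intM)
      also have "\<dots> = (LINT x|N. DY J A x * cos (s * Y j x + SY (\<lambda>_. 0) x + \<theta>')) +
        ((LINT x|N. DY J A x * cos (s * Y j x + SY t x + (\<theta>' + \<theta>))) +
         (LINT x|N. DY J A x * cos ((- s) * Y j x + SY t x + (\<theta> - \<theta>')))) / 2"
        unfolding upd IH ..
      also have "\<dots> = (LINT x|N. DY J A x * (1 + cos (SY t x + \<theta>)) * cos (s * Y j x + \<theta>'))"
        unfolding tri Z by (simp add: intN)
      finally show "(LINT x|M. DX J A x * (1 + cos (SX t x + \<theta>)) * cos (s * X j x + \<theta>')) =
        (LINT x|N. DY J A x * (1 + cos (SY t x + \<theta>)) * cos (s * Y j x + \<theta>'))" .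
    next
      have c: "0 \<le> 1 + cos y" "1 + cos y \<le> 2" for y :: real
        using cos_ge_minus_one[of y] cos_le_one[of y] by linarith+
      have "d * (1 + cos y) \<le> 2" if "0 \<le> d" "d \<le> 1" for d y :: real
        using mult_mono[OF that(2) c(2)[of y]] c[of y] by simp
      then show "DX J A x * (1 + cos (SX t x + \<theta>)) \<le> 2" "DY J A y * (1 + cos (SY t y + \<theta>)) \<le> 2" for x y
        using D01 by auto
      show "0 \<le> DX J A x * (1 + cos (SX t x + \<theta>))" "0 \<le> DY J A y * (1 + cos (SY t y + \<theta>))" for x y
        using D01 c by (auto intro!: mult_nonneg_nonneg)
    qed (auto intro: M.finite_measure_axioms N.finite_measure_axioms)
    have split: "d * (1 + c) * k = k * d + k * d * c" for d c k :: real
      by (simp add: algebra_simps)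
    have ins: "DX (insert j J) A x = indicator (A j) (X j x) * DX J A x"
      "DY (insert j J) A y = indicator (A j) (Y j y) * DY J A y" for x y
      using insert by (auto simp: DX_def DY_def)
    have i1: "integrable M (\<lambda>x. indicator (A j) (X j x) * DX J A x)"
      "integrable N (\<lambda>x. indicator (A j) (Y j x) * DY J A x)"
      using intM[of "\<lambda>x. indicator (A j) (X j x)"] intN[of "\<lambda>x. indicator (A j) (Y j x)"]
      by (auto simp: mult.commute indicator_def)
    have i2: "integrable M (\<lambda>x. indicator (A j) (X j x) * DX J A x * cos (SX t x + \<theta>))"
      "integrable N (\<lambda>x. indicator (A j) (Y j x) * DY J A x * cos (SY t x + \<theta>))" for t \<theta>
      by (rule Bochner_Integration.integrable_bound[OF i1(1)], simp,
          auto simp: abs_mult intro!: AE_I2 mult_left_le)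
         (rule Bochner_Integration.integrable_bound[OF i1(2)], simp,
          auto simp: abs_mult intro!: AE_I2 mult_left_le)
    have e: "(LINT x|M. indicator (A j) (X j x) * DX J A x)
        + (LINT x|M. indicator (A j) (X j x) * DX J A x * cos (SX t x + \<theta>))
      = (LINT x|N. indicator (A j) (Y j x) * DY J A x)
        + (LINT x|N. indicator (A j) (Y j x) * DY J A x * cos (SY t x + \<theta>))" for t \<theta>
      using key[of t \<theta>] unfolding split by (simp only: i1 i2 Bochner_Integration.integral_add)
    have "(LINT x|M. indicator (A j) (X j x) * DX J A x) = (LINT x|N. indicator (A j) (Y j x) * DY J A x)"
      using e[of "\<lambda>_. 0" 0] by (simp add: Z)
    with e[of t \<theta>] show ?case unfolding ins by simp
  qed
  have [measurable]: "(\<lambda>x. \<lambda>i\<in>I. X i x) \<in> measurable M (PiM I (\<lambda>_. borel))"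
    "(\<lambda>x. \<lambda>i\<in>I. Y i x) \<in> measurable N (PiM I (\<lambda>_. borel))"
    using X Y by (auto intro!: measurable_restrict)
  show ?thesis
  proof (rule measure_eqI_PiM_finite[OF I])
    fix A :: "'i \<Rightarrow> real set" assume A: "\<And>i. i \<in> I \<Longrightarrow> A i \<in> sets borel"
    have [measurable]: "Pi\<^sub>E I A \<in> sets (PiM I (\<lambda>_. borel))"
      using I A by (intro sets_PiM_I_finite) auto
    have ind: "indicator (Pi\<^sub>E I A) (\<lambda>i\<in>I. X i x) = DX I A x"
      "indicator (Pi\<^sub>E I A) (\<lambda>i\<in>I. Y i y) = DY I A y" for x y
      unfolding DX_def DY_def using I by (auto simp: indicator_def PiE_iff prod_zero_iff)
    have "measure (distr M (PiM I (\<lambda>_. borel)) (\<lambda>x. \<lambda>i\<in>I. X i x)) (Pi\<^sub>E I A)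
      = (LINT z|distr M (PiM I (\<lambda>_. borel)) (\<lambda>x. \<lambda>i\<in>I. X i x). indicator (Pi\<^sub>E I A) z)"
      by simp
    also have "\<dots> = (LINT x|M. DX I A x)" by (subst integral_distr) (auto simp: ind)
    also have "\<dots> = (LINT y|N. DY I A y)" using P[of I A "\<lambda>_. 0" 0] I A by (simp add: SX_def SY_def)
    also have "\<dots> = (LINT z|distr N (PiM I (\<lambda>_. borel)) (\<lambda>x. \<lambda>i\<in>I. Y i x). indicator (Pi\<^sub>E I A) z)"
      by (subst integral_distr) (auto simp: ind)
    also have "\<dots> = measure (distr N (PiM I (\<lambda>_. borel)) (\<lambda>x. \<lambda>i\<in>I. Y i x)) (Pi\<^sub>E I A)"
      by simp
    finally show "emeasure (distr M (PiM I (\<lambda>_. borel)) (\<lambda>x. \<lambda>i\<in>I. X i x)) (Pi\<^sub>E I A)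
      = emeasure (distr N (PiM I (\<lambda>_. borel)) (\<lambda>x. \<lambda>i\<in>I. Y i x)) (Pi\<^sub>E I A)"
      by (simp add: M.prob_space_distr N.prob_space_distr finite_measure.emeasure_eq_measure
          prob_space.finite_measure)
  next
    show "range (\<lambda>_::nat. \<Pi>\<^sub>E i\<in>I. UNIV) \<subseteq> prod_algebra I (\<lambda>_. borel :: real measure)"
      using I by (auto intro!: prod_algebraI_finite)
    show "(\<Union>i::nat. \<Pi>\<^sub>E i\<in>I. UNIV) = space (PiM I (\<lambda>_. borel :: real measure))"
      by (simp add: space_PiM)
    show "emeasure (distr M (PiM I (\<lambda>_. borel)) (\<lambda>x. \<lambda>i\<in>I. X i x)) (\<Pi>\<^sub>E i\<in>I. UNIV) \<noteq> \<infinity>"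
      by (simp add: M.prob_space_distr finite_measure.emeasure_eq_measure prob_space.finite_measure)
  qed auto
qed

section \<open>Square-integrable functions\<close>

lemma L2_measurable [measurable_dest]: "f \<in> L2 M \<Longrightarrow> f \<in> borel_measurable M"
  by (simp add: L2_def)

lemma L2_square_integrable: "f \<in> L2 M \<Longrightarrow> integrable M (\<lambda>x. (f x)\<^sup>2)"
  by (simp add: L2_def)

lemma abs_mult_le_squares: "\<bar>a * b\<bar> \<le> a\<^sup>2 + b\<^sup>2" for a b :: real
  using sum_squares_bound[of "\<bar>a\<bar>" "\<bar>b\<bar>"] mult_nonneg_nonneg[of "\<bar>a\<bar>" "\<bar>b\<bar>"]
  by (simp add: abs_mult del: mult_nonneg_nonneg)

lemma L2_mult_integrable:
  assumes "f \<in> L2 M" "g \<in> L2 M"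
  shows "integrable M (\<lambda>x. f x * g x)"
proof (rule Bochner_Integration.integrable_bound)
  show "integrable M (\<lambda>x. (f x)\<^sup>2 + (g x)\<^sup>2)"
    using assms by (intro Bochner_Integration.integrable_add L2_square_integrable)
  show "(\<lambda>x. f x * g x) \<in> borel_measurable M"
    using assms by (intro borel_measurable_times L2_measurable)
  show "AE x in M. norm (f x * g x) \<le> norm ((f x)\<^sup>2 + (g x)\<^sup>2)"
    using abs_mult_le_squares by (intro AE_I2) simp
qed

lemma L2_lincomb:
  assumes "f \<in> L2 M" "g \<in> L2 M"
  shows "(\<lambda>x. a * f x + b * g x) \<in> L2 M"
proof -
  have "integrable M (\<lambda>x. a\<^sup>2 * (f x)\<^sup>2 + 2 * a * b * (f x * g x) + b\<^sup>2 * (g x)\<^sup>2)"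
    using assms by (intro Bochner_Integration.integrable_add integrable_mult_right
        L2_mult_integrable L2_square_integrable)
  moreover have "a\<^sup>2 * u\<^sup>2 + 2 * a * b * (u * v) + b\<^sup>2 * v\<^sup>2 = (a * u + b * v)\<^sup>2" for u v
    by (simp add: power2_eq_square algebra_simps)
  moreover have "(\<lambda>x. a * f x + b * g x) \<in> borel_measurable M"
    using assms by (intro borel_measurable_add borel_measurable_times borel_measurable_const L2_measurable)
  ultimately show ?thesis by (simp add: L2_def)
qed

lemma L2_add: "f \<in> L2 M \<Longrightarrow> g \<in> L2 M \<Longrightarrow> (\<lambda>x. f x + g x) \<in> L2 M"
  using L2_lincomb[of f M g 1 1] by simp

lemma L2_diff: "f \<in> L2 M \<Longrightarrow> g \<in> L2 M \<Longrightarrow> (\<lambda>x. f x - g x) \<in> L2 M"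
  using L2_lincomb[of f M g 1 "-1"] by simp

lemma L2_cmult: "f \<in> L2 M \<Longrightarrow> (\<lambda>x. a * f x) \<in> L2 M"
  using L2_lincomb[of f M f a 0] by simp

lemma L2_sum:
  assumes "finite I" "\<And>i. i \<in> I \<Longrightarrow> f i \<in> L2 M"
  shows "(\<lambda>x. \<Sum>i\<in>I. f i x) \<in> L2 M"
  using assms
proof (induction I rule: finite_induct)
  case empty
  then show ?case by (simp add: L2_def)
next
  case (insert j I)
  then show ?case using L2_add[of "f j" M] by simp
qed

lemma L2_mult_bounded:
  assumes f: "f \<in> L2 M" and [measurable]: "w \<in> borel_measurable M" and w: "\<And>x. \<bar>w x\<bar> \<le> B"
  shows "(\<lambda>x. w x * f x) \<in> L2 M"
proof -
  note [measurable] = L2_measurable[OF f]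
  have "integrable M (\<lambda>x. (w x * f x)\<^sup>2)"
  proof (rule Bochner_Integration.integrable_bound)
    show "integrable M (\<lambda>x. B\<^sup>2 * (f x)\<^sup>2)"
      using f by (intro integrable_mult_right L2_square_integrable)
    have "(w x * f x)\<^sup>2 \<le> B\<^sup>2 * (f x)\<^sup>2" for x
      using power_mono[OF w[of x], of 2] by (simp add: power_mult_distrib mult_right_mono)
    then show "AE x in M. norm ((w x * f x)\<^sup>2) \<le> norm (B\<^sup>2 * (f x)\<^sup>2)"
      by (intro AE_I2) simp
  qed measurable
  then show ?thesis by (simp add: L2_def)
qed

lemma Cauchy_Schwarz_L2:
  assumes f: "f \<in> L2 M" and g: "g \<in> L2 M"
  shows "\<bar>LINT x|M. f x * g x\<bar> \<le> sqrt (LINT x|M. (f x)\<^sup>2) * sqrt (LINT x|M. (g x)\<^sup>2)"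
proof -
  define F G B where "F = (LINT x|M. (f x)\<^sup>2)" and "G = (LINT x|M. (g x)\<^sup>2)"
    and "B = (LINT x|M. f x * g x)"
  have q: "0 \<le> s\<^sup>2 * F + 2 * s * t * B + t\<^sup>2 * G" for s t
  proof -
    have "0 \<le> (LINT x|M. (s * f x + t * g x)\<^sup>2)" by simp
    also have "\<dots> = (LINT x|M. s\<^sup>2 * (f x)\<^sup>2 + 2 * s * t * (f x * g x) + t\<^sup>2 * (g x)\<^sup>2)"
      by (simp add: power2_eq_square algebra_simps)
    also have "\<dots> = s\<^sup>2 * F + 2 * s * t * B + t\<^sup>2 * G"
      using f g by (simp add: F_def G_def B_def L2_mult_integrable L2_square_integrable)
    finally show ?thesis .
  qed
  have FG: "0 \<le> F" "0 \<le> G" by (auto simp: F_def G_def)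
  have "B\<^sup>2 \<le> F * G"
  proof (cases "F = 0")
    case True
    have "B = 0"
    proof (rule ccontr)
      assume B: "B \<noteq> 0"
      have "2 * (- (G + 1) / (2 * B)) * B + G = - 1" using B by (simp add: field_simps)
      then show False using q[of "- (G + 1) / (2 * B)" 1] True by simp
    qed
    then show ?thesis using FG by simp
  next
    case False
    with FG have "0 < F" by simp
    moreover have "0 \<le> F * (F * G - B\<^sup>2)"
      using q[of B "- F"] by (simp add: power2_eq_square algebra_simps)
    ultimately show ?thesis by (simp add: zero_le_mult_iff)
  qed
  then have "\<bar>B\<bar> \<le> sqrt (F * G)" by (metis real_sqrt_abs real_sqrt_le_mono)
  then show ?thesis by (simp add: B_def F_def G_def real_sqrt_mult)
qed

lemma L2_tendsto_unique:
  assumes "L2_tendsto M s f" "L2_tendsto M s g"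
  shows "AE x in M. f x = g x"
proof -
  have L: "s n \<in> L2 M" "f \<in> L2 M" "g \<in> L2 M" for n
    using assms by (auto simp: L2_tendsto_def)
  have "(\<lambda>n. 2 * (LINT x|M. (s n x - f x)\<^sup>2) + 2 * (LINT x|M. (s n x - g x)\<^sup>2)) \<longlonglongrightarrow> 2 * 0 + 2 * 0"
    using assms by (intro tendsto_intros) (auto simp: L2_tendsto_def)
  moreover have "(LINT x|M. (f x - g x)\<^sup>2)
      \<le> 2 * (LINT x|M. (s n x - f x)\<^sup>2) + 2 * (LINT x|M. (s n x - g x)\<^sup>2)" for n
  proof -
    have i: "integrable M (\<lambda>x. (s n x - f x)\<^sup>2)" "integrable M (\<lambda>x. (s n x - g x)\<^sup>2)"
      "integrable M (\<lambda>x. (f x - g x)\<^sup>2)"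
      by (intro L2_square_integrable L2_diff L)+
    have "(u - v)\<^sup>2 \<le> 2 * (w - u)\<^sup>2 + 2 * (w - v)\<^sup>2" for u v w :: real
      using zero_le_power2[of "(w - u) + (w - v)"] by (simp add: power2_eq_square algebra_simps)
    then have "(LINT x|M. (f x - g x)\<^sup>2) \<le> (LINT x|M. 2 * (s n x - f x)\<^sup>2 + 2 * (s n x - g x)\<^sup>2)"
      using i by (intro integral_mono) auto
    then show ?thesis using i by simp
  qed
  ultimately have "(LINT x|M. (f x - g x)\<^sup>2) \<le> 2 * 0 + 2 * 0"
    by (intro LIMSEQ_le_const) auto
  then have "(LINT x|M. (f x - g x)\<^sup>2) = 0" by (simp add: order_antisym)
  then have "AE x in M. (f x - g x)\<^sup>2 = 0"
    using integral_nonneg_eq_0_iff_AE[OF L2_square_integrable[OF L2_diff[OF L(2,3)]]] by simp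
  then show ?thesis by simp
qed

lemma L2_tendsto_lincomb:
  assumes s: "L2_tendsto M s f" and t: "L2_tendsto M t g"
  shows "L2_tendsto M (\<lambda>n x. a * s n x + b * t n x) (\<lambda>x. a * f x + b * g x)"
proof -
  have L: "s n \<in> L2 M" "t n \<in> L2 M" "f \<in> L2 M" "g \<in> L2 M" for n
    using s t by (auto simp: L2_tendsto_def)
  have bound: "(LINT x|M. (a * s n x + b * t n x - (a * f x + b * g x))\<^sup>2)
      \<le> 2 * a\<^sup>2 * (LINT x|M. (s n x - f x)\<^sup>2) + 2 * b\<^sup>2 * (LINT x|M. (t n x - g x)\<^sup>2)" for n
  proof -
    have i: "integrable M (\<lambda>x. (s n x - f x)\<^sup>2)" "integrable M (\<lambda>x. (t n x - g x)\<^sup>2)"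
      "integrable M (\<lambda>x. (a * s n x + b * t n x - (a * f x + b * g x))\<^sup>2)"
      by (intro L2_square_integrable L2_diff L2_lincomb L)+
    have "(a * u + b * v - (a * u' + b * v'))\<^sup>2 \<le> 2 * a\<^sup>2 * (u - u')\<^sup>2 + 2 * b\<^sup>2 * (v - v')\<^sup>2" for u v u' v'
      using zero_le_power2[of "a * (u - u') - b * (v - v')"] by (simp add: power2_eq_square algebra_simps)
    then have "(LINT x|M. (a * s n x + b * t n x - (a * f x + b * g x))\<^sup>2)
      \<le> (LINT x|M. 2 * a\<^sup>2 * (s n x - f x)\<^sup>2 + 2 * b\<^sup>2 * (t n x - g x)\<^sup>2)"
      using i by (intro integral_mono) auto
    then show ?thesis using i by simp
  qed
  have "(\<lambda>n. 2 * a\<^sup>2 * (LINT x|M. (s n x - f x)\<^sup>2) + 2 * b\<^sup>2 * (LINT x|M. (t n x - g x)\<^sup>2))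
      \<longlonglongrightarrow> 2 * a\<^sup>2 * 0 + 2 * b\<^sup>2 * 0"
    using s t by (intro tendsto_intros) (auto simp: L2_tendsto_def)
  then have "(\<lambda>n. 2 * a\<^sup>2 * (LINT x|M. (s n x - f x)\<^sup>2) + 2 * b\<^sup>2 * (LINT x|M. (t n x - g x)\<^sup>2)) \<longlonglongrightarrow> 0"
    by (simp only: mult_zero_right add_0_right)
  then have "(\<lambda>n. LINT x|M. (a * s n x + b * t n x - (a * f x + b * g x))\<^sup>2) \<longlonglongrightarrow> 0"
    by (rule Lim_null_comparison[OF always_eventually, rotated])
      (intro allI ord_eq_le_trans[OF _ bound], simp)
  then show ?thesis
    unfolding L2_tendsto_def by (intro conjI allI L2_lincomb L)
qed

lemma L2_tendsto_sum:
  assumes "finite I" "\<And>i. i \<in> I \<Longrightarrow> L2_tendsto M (s i) (f i)"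
  shows "L2_tendsto M (\<lambda>n x. \<Sum>i\<in>I. a i * s i n x) (\<lambda>x. \<Sum>i\<in>I. a i * f i x)"
  using assms
proof (induction I rule: finite_induct)
  case empty
  then show ?case by (simp add: L2_tendsto_def L2_def)
next
  case (insert j I)
  then show ?case
    using L2_tendsto_lincomb[of M "s j" "f j" "\<lambda>n x. \<Sum>i\<in>I. a i * s i n x" "\<lambda>x. \<Sum>i\<in>I. a i * f i x" "a j" 1]
    by simp
qed

section \<open>Gaussian measures\<close>

lemma cos_std_normal: "(LINT t|std_normal_distribution. cos (s * t + \<theta>)) = cos \<theta> * exp (- s\<^sup>2 / 2)"
proof -
  interpret prob_space std_normal_distribution by (rule prob_space_normal_density) simp
  have i: "integrable std_normal_distribution (\<lambda>t. iexp (s * t))"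
    by (rule integrable_iexp) auto
  have "(LINT t|std_normal_distribution. cos (s * t)) = exp (- s\<^sup>2 / 2)"
    "(LINT t|std_normal_distribution. sin (s * t)) = 0"
    using fun_cong[OF char_std_normal_distribution, of s] integral_Re[OF i] integral_Im[OF i]
    by (simp_all add: char_def Re_exp Im_exp)
  moreover have "integrable std_normal_distribution (\<lambda>t. cos (s * t))"
    "integrable std_normal_distribution (\<lambda>t. sin (s * t))"
    using integrable_Re[OF i] integrable_Im[OF i] by (simp_all add: Re_exp Im_exp)
  ultimately show ?thesis by (simp add: cos_add mult.commute)
qed

lemma blinfun_borel[measurable]:
  "blinfun_apply (l :: 'a::real_normed_vector \<Rightarrow>\<^sub>L real) \<in> borel_measurable borel"
  by (intro borel_measurable_continuous_onI continuous_intros)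

locale gaussian_measure =
  fixes \<gamma> :: "'a::{banach, second_countable_topology} measure"
  assumes gaussian: "centered_gaussian \<gamma>"

sublocale gaussian_measure \<subseteq> prob_space \<gamma>
  using gaussian unfolding centered_gaussian_def by blast

context gaussian_measure
begin

lemma gaussian_sets[measurable_cong, simp]: "sets \<gamma> = sets borel"
  using gaussian unfolding centered_gaussian_def by blast

lemma gaussian_space[simp]: "space \<gamma> = UNIV"
  using sets_eq_imp_space_eq[OF gaussian_sets] by simp

lemma prob_UNIV [simp]: "prob UNIV = 1"
  using prob_space by simp

text \<open>Allowing \<open>\<sigma> = 0\<close> treats the two cases of the definition of a Gaussian law together.\<close>

lemma gaussian_law:
  fixes l :: "'a \<Rightarrow>\<^sub>L real"
  obtains \<sigma> where "distr \<gamma> borel (blinfun_apply l) = distr std_normal_distribution borel (\<lambda>t. \<sigma> * t)"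
proof -
  interpret N: prob_space std_normal_distribution by (rule prob_space_normal_density) simp
  consider "distr \<gamma> borel (blinfun_apply l) = return borel 0"
    | \<sigma> where "0 < \<sigma>" "distr \<gamma> borel (blinfun_apply l) = density lborel (normal_density 0 \<sigma>)"
    using gaussian unfolding centered_gaussian_def by blast
  then show thesis
  proof cases
    case 1
    then show ?thesis by (intro that[of 0]) (simp add: N.distr_const)
  next
    case (2 \<sigma>)
    have "distributed std_normal_distribution lborel (\<lambda>x. x) std_normal_density"
      by (simp add: distributed_def distr_id2)
    from N.normal_density_affine[OF this, of \<sigma> 0] 2(1)
    have "distr std_normal_distribution lborel (\<lambda>x. \<sigma> * x) = density lborel (normal_density 0 \<sigma>)"
      by (simp add: distributed_def)
    moreover have "distr std_normal_distribution lborel (\<lambda>x. \<sigma> * x)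
        = distr std_normal_distribution borel (\<lambda>x. \<sigma> * x)"
      by (rule distr_cong) auto
    ultimately show ?thesis using 2 by (intro that[of \<sigma>]) simp
  qed
qed

lemma gaussian_integral:
  fixes l :: "'a \<Rightarrow>\<^sub>L real"
  obtains \<sigma> where "\<And>f :: real \<Rightarrow> real. f \<in> borel_measurable borel \<Longrightarrow>
      (LINT x|\<gamma>. f (blinfun_apply l x)) = (LINT t|std_normal_distribution. f (\<sigma> * t))"
    "\<And>f :: real \<Rightarrow> real. f \<in> borel_measurable borel \<Longrightarrow>
      integrable \<gamma> (\<lambda>x. f (blinfun_apply l x)) \<longleftrightarrow> integrable std_normal_distribution (\<lambda>t. f (\<sigma> * t))"
proof -
  obtain \<sigma> where \<sigma>: "distr \<gamma> borel (blinfun_apply l) = distr std_normal_distribution borel (\<lambda>t. \<sigma> * t)"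
    by (rule gaussian_law)
  show thesis
  proof (rule that[of \<sigma>])
    fix f :: "real \<Rightarrow> real" assume [measurable]: "f \<in> borel_measurable borel"
    have "(LINT x|\<gamma>. f (blinfun_apply l x)) = (LINT u|distr \<gamma> borel (blinfun_apply l). f u)"
      by (simp add: integral_distr)
    also have "\<dots> = (LINT t|std_normal_distribution. f (\<sigma> * t))"
      unfolding \<sigma> by (rule integral_distr) auto
    finally show "(LINT x|\<gamma>. f (blinfun_apply l x)) = (LINT t|std_normal_distribution. f (\<sigma> * t))" .
    have "integrable \<gamma> (\<lambda>x. f (blinfun_apply l x)) \<longleftrightarrow> integrable (distr \<gamma> borel (blinfun_apply l)) f"
      by (simp add: integrable_distr_eq)
    also have "\<dots> \<longleftrightarrow> integrable std_normal_distribution (\<lambda>t. f (\<sigma> * t))"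
      unfolding \<sigma> by (rule integrable_distr_eq) auto
    finally show "integrable \<gamma> (\<lambda>x. f (blinfun_apply l x))
      \<longleftrightarrow> integrable std_normal_distribution (\<lambda>t. f (\<sigma> * t))" .
  qed
qed

lemma gaussian_square_integrable:
  fixes l :: "'a \<Rightarrow>\<^sub>L real"
  shows "integrable \<gamma> (\<lambda>x. (blinfun_apply l x)\<^sup>2)"
proof -
  obtain \<sigma> where "\<And>f :: real \<Rightarrow> real. f \<in> borel_measurable borel \<Longrightarrow>
      integrable \<gamma> (\<lambda>x. f (blinfun_apply l x)) \<longleftrightarrow> integrable std_normal_distribution (\<lambda>t. f (\<sigma> * t))"
    by (rule gaussian_integral[of l]) (rule that)
  from this[of "\<lambda>u. u\<^sup>2"] show ?thesis
    using integrable_std_normal_distribution_moment[of 2] by (simp add: power_mult_distrib)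
qed

lemma gaussian_char:
  fixes l :: "'a \<Rightarrow>\<^sub>L real"
  shows "(LINT x|\<gamma>. cos (blinfun_apply l x + \<theta>)) = cos \<theta> * exp (- (LINT x|\<gamma>. (blinfun_apply l x)\<^sup>2) / 2)"
proof -
  obtain \<sigma> where \<sigma>: "\<And>f :: real \<Rightarrow> real. f \<in> borel_measurable borel \<Longrightarrow>
      (LINT x|\<gamma>. f (blinfun_apply l x)) = (LINT t|std_normal_distribution. f (\<sigma> * t))"
    by (rule gaussian_integral[of l]) (rule that)
  have "(LINT x|\<gamma>. (blinfun_apply l x)\<^sup>2) = (LINT t|std_normal_distribution. (\<sigma> * t)\<^sup>2)"
    by (rule \<sigma>) simp
  also have "\<dots> = \<sigma>\<^sup>2"
    using std_normal_distribution_even_moments[of 1] by (simp add: power_mult_distrib)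
  finally show ?thesis
    using \<sigma>[of "\<lambda>u. cos (u + \<theta>)"] by (simp add: cos_std_normal)
qed

lemma blinfun_L2: "blinfun_apply l \<in> L2 \<gamma>"
  using gaussian_square_integrable by (simp add: L2_def)

lemma gaussian_mult_integrable:
  fixes l k :: "'a \<Rightarrow>\<^sub>L real"
  shows "integrable \<gamma> (\<lambda>x. blinfun_apply l x * blinfun_apply k x)"
  by (intro L2_mult_integrable blinfun_L2)

text \<open>A unit functional \<open>e\<close> splits off an independent standard normal component: uncorrelated
  Gaussian functionals are independent, as the characteristic function shows.\<close>

lemma gaussian_split:
  fixes l :: "'i \<Rightarrow> 'a \<Rightarrow>\<^sub>L real" and e :: "'a \<Rightarrow>\<^sub>L real"
  assumes I: "finite I" and e: "(LINT x|\<gamma>. (e x)\<^sup>2) = 1"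
    and c: "\<And>i. i \<in> I \<Longrightarrow> c i = (LINT x|\<gamma>. l i x * e x)"
  shows "distr \<gamma> (PiM I (\<lambda>_. borel)) (\<lambda>x. \<lambda>i\<in>I. l i x)
    = distr (std_normal_distribution \<Otimes>\<^sub>M \<gamma>) (PiM I (\<lambda>_. borel)) (\<lambda>p. \<lambda>i\<in>I. l i (snd p) - c i * e (snd p) + fst p * c i)"
proof -
  interpret N: prob_space std_normal_distribution by (rule prob_space_normal_density) simp
  interpret P: pair_prob_space std_normal_distribution \<gamma> ..
  show ?thesis
  proof (rule joint_law_unique[OF prob_space_axioms P.prob_space_axioms I])
    fix t \<theta>
    define m where "m = (\<Sum>i\<in>I. t i *\<^sub>R l i)"
    define a where "a = (\<Sum>i\<in>I. t i * c i)"
    define k where "k = m - a *\<^sub>R e"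
    have m: "(\<Sum>i\<in>I. t i * l i x) = m x" for x
      by (simp add: m_def blinfun.sum_left blinfun.scaleR_left)
    have a: "a = (LINT x|\<gamma>. m x * e x)"
      unfolding a_def m[symmetric] using c
      by (simp add: sum_distrib_right mult.assoc gaussian_mult_integrable)
    have k: "k x = m x - a * e x" for x by (simp add: k_def blinfun.diff_left blinfun.scaleR_left)
    have "(LINT x|\<gamma>. (k x)\<^sup>2) = (LINT x|\<gamma>. (m x)\<^sup>2 - 2 * a * (m x * e x) + a\<^sup>2 * (e x)\<^sup>2)"
      by (simp add: k power2_eq_square algebra_simps)
    also have "\<dots> = (LINT x|\<gamma>. (m x)\<^sup>2) - a\<^sup>2"
      by (simp add: gaussian_mult_integrable gaussian_square_integrable e a[symmetric])
        (simp add: power2_eq_square)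
    finally have var: "(LINT x|\<gamma>. (k x)\<^sup>2) = (LINT x|\<gamma>. (m x)\<^sup>2) - a\<^sup>2" .
    have Y: "(\<Sum>i\<in>I. t i * (l i x - c i * e x + s * c i)) + \<theta> = k x + (a * s + \<theta>)" for s x
      unfolding k m[symmetric] a_def
      by (simp add: distrib_left right_diff_distrib sum.distrib sum_subtractf sum_distrib_left mult_ac)
    have "(LINT p|(std_normal_distribution \<Otimes>\<^sub>M \<gamma>). cos (k (snd p) + (a * fst p + \<theta>)))
      = (LINT s|std_normal_distribution. (LINT x|\<gamma>. cos (k x + (a * s + \<theta>))))"
      by (subst P.integral_fst'[symmetric]) (auto intro!: P.integrable_const_bound[of _ 1])
    also have "\<dots> = (LINT s|std_normal_distribution. cos (a * s + \<theta>)) * exp (- (LINT x|\<gamma>. (k x)\<^sup>2) / 2)"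
      unfolding gaussian_char by simp
    also have "\<dots> = cos \<theta> * exp (- (LINT x|\<gamma>. (m x)\<^sup>2) / 2)"
      unfolding cos_std_normal var by (simp add: exp_add[symmetric] diff_divide_distrib)
    finally show "(LINT x|\<gamma>. cos ((\<Sum>i\<in>I. t i * l i x) + \<theta>))
      = (LINT p|(std_normal_distribution \<Otimes>\<^sub>M \<gamma>). cos ((\<Sum>i\<in>I. t i * (l i (snd p) - c i * e (snd p) + fst p * c i)) + \<theta>))"
      unfolding Y m gaussian_char by simp
  qed auto
qed

end

section \<open>Log-concavity and the second moment of the norm\<close>

lemma std_normal_density_midpoint:
  "std_normal_density x * std_normal_density y \<le> (std_normal_density ((x + y) / 2))\<^sup>2"
proof -
  have "exp (- x\<^sup>2 / 2) * exp (- y\<^sup>2 / 2) \<le> (exp (- ((x + y) / 2)\<^sup>2 / 2))\<^sup>2"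
    using zero_le_power2[of "x - y"]
    by (simp add: exp_add[symmetric] power2_eq_square[of "exp _"] field_simps power2_eq_square)
  then show ?thesis
    by (simp add: std_normal_density_def power_divide divide_right_mono)
qed

text \<open>The density of the normal law is log-concave, so the inequality on the line carries over.\<close>

lemma prekopa_leindler_normal:
  fixes f g h :: "real \<Rightarrow> real"
  assumes [measurable]: "f \<in> borel_measurable borel" "g \<in> borel_measurable borel" "h \<in> borel_measurable borel"
    and f: "\<And>x. 0 \<le> f x" "\<And>x. f x \<le> 1" and g: "\<And>x. 0 \<le> g x" "\<And>x. g x \<le> 1"
    and h: "\<And>x. 0 \<le> h x" "\<And>x. h x \<le> 1"
    and fgh: "\<And>x y. f x * g y \<le> (h ((x + y) / 2))\<^sup>2"
  shows "(LINT t|std_normal_distribution. f t) * (LINT t|std_normal_distribution. g t)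
      \<le> (LINT t|std_normal_distribution. h t)\<^sup>2"
proof -
  let ?d = std_normal_density
  have d1: "?d x \<le> 1" for x
  proof -
    have "1 \<le> sqrt (2 * pi)" using pi_gt3 by simp
    then have "1 / sqrt (2 * pi) * exp (- x\<^sup>2 / 2) \<le> 1 * 1"
      by (intro mult_mono) auto
    then show ?thesis by (simp add: std_normal_density_def)
  qed
  have int: "integrable lborel (\<lambda>x. ?d x * u x)"
    if [measurable]: "u \<in> borel_measurable borel" and "\<And>x. 0 \<le> u x" "\<And>x. u x \<le> 1" for u :: "real \<Rightarrow> real"
    using that by (intro Bochner_Integration.integrable_bound[OF integrable_normal_density[of 1 0]])
      (auto simp: abs_mult intro!: AE_I2 mult_left_le)
  have bdd: "bdd_above (range (\<lambda>x. ?d x * u x))" if "\<And>x. 0 \<le> u x" "\<And>x. u x \<le> 1" for u :: "real \<Rightarrow> real"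
    using that d1 by (intro bdd_aboveI[of _ 1]) (auto intro!: mult_le_one)
  have "(LINT x|lborel. ?d x * f x) * (LINT x|lborel. ?d x * g x) \<le> (LINT x|lborel. ?d x * h x)\<^sup>2"
  proof (rule prekopa_leindler_line)
    fix x y
    have "?d x * f x * (?d y * g y) = (?d x * ?d y) * (f x * g y)" by simp
    also have "\<dots> \<le> (?d ((x + y) / 2))\<^sup>2 * (h ((x + y) / 2))\<^sup>2"
      using f g by (intro mult_mono std_normal_density_midpoint fgh) auto
    finally show "?d x * f x * (?d y * g y) \<le> (?d ((x + y) / 2) * h ((x + y) / 2))\<^sup>2"
      by (simp add: power_mult_distrib)
  qed (use f g h int bdd in auto)
  then show ?thesis by (simp add: integral_density)
qed

text \<open>The inequality for functions of finitely many functionals follows by splitting off one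
  independent normal component at a time and applying the one-dimensional inequality to the
  partial integrals. A functional of variance zero vanishes almost everywhere.\<close>

lemma (in gaussian_measure) prekopa_leindler_gaussian:
  fixes l :: "nat \<Rightarrow> 'a \<Rightarrow>\<^sub>L real"
    and F G K :: "(nat \<Rightarrow> real) \<Rightarrow> real"
  assumes "F \<in> borel_measurable (PiM {..<n} (\<lambda>_. borel))" "\<And>a. 0 \<le> F a" "\<And>a. F a \<le> 1"
    and "G \<in> borel_measurable (PiM {..<n} (\<lambda>_. borel))" "\<And>a. 0 \<le> G a" "\<And>a. G a \<le> 1"
    and "K \<in> borel_measurable (PiM {..<n} (\<lambda>_. borel))" "\<And>a. 0 \<le> K a" "\<And>a. K a \<le> 1"
    and "\<And>a b. F (\<lambda>k\<in>{..<n}. a k) * G (\<lambda>k\<in>{..<n}. b k)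
                    \<le> (K (\<lambda>k\<in>{..<n}. (a k + b k) / 2))\<^sup>2"
  shows "(LINT x|\<gamma>. F (\<lambda>k\<in>{..<n}. blinfun_apply (l k) x)) * (LINT x|\<gamma>. G (\<lambda>k\<in>{..<n}. blinfun_apply (l k) x))
      \<le> (LINT x|\<gamma>. K (\<lambda>k\<in>{..<n}. blinfun_apply (l k) x))\<^sup>2"
  using assms
proof (induction n arbitrary: F G K l)
  case 0
  have *: "(\<lambda>k\<in>{..<0::nat}. a k) = (\<lambda>_. undefined)" for a :: "nat \<Rightarrow> real"
    by (simp add: restrict_def)
  show ?case using "0.prems"(10)[of "\<lambda>_. 0" "\<lambda>_. 0"] unfolding * by simp
next
  case (Suc n)
  interpret N: prob_space std_normal_distribution by (rule prob_space_normal_density) simp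
  interpret P: pair_prob_space std_normal_distribution \<gamma> ..
  define v where "v = (LINT x|\<gamma>. (blinfun_apply (l n) x)\<^sup>2)"
  define e where "e = (1 / sqrt v) *\<^sub>R l n"
  define c where "c k = (LINT x|\<gamma>. blinfun_apply (l k) x * blinfun_apply e x)" for k
  define m where "m k = l k - c k *\<^sub>R e" for k
  define sh where "sh t a = (\<lambda>k\<in>{..<Suc n}. (if k < n then a k else 0) + t * c k)"
    for t :: real and a :: "nat \<Rightarrow> real"
  have sh[measurable]: "(\<lambda>p. sh (fst p) (snd p)) \<in> measurable (borel \<Otimes>\<^sub>M PiM {..<n} (\<lambda>_. borel))
      (PiM {..<Suc n} (\<lambda>_. borel))"
    unfolding sh_def
  proof (intro measurable_restrict)
    fix k
    show "(\<lambda>p. (if k < n then snd p k else 0) + fst p * c k)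
        \<in> borel_measurable (borel \<Otimes>\<^sub>M PiM {..<n} (\<lambda>_. borel))"
      by (cases "k < n") auto
  qed
  have mid: "U (sh s (\<lambda>k\<in>{..<n}. a k)) * V (sh t (\<lambda>k\<in>{..<n}. b k))
      \<le> (W (sh ((s + t) / 2) (\<lambda>k\<in>{..<n}. (a k + b k) / 2)))\<^sup>2"
    if UVW: "\<And>a b. U (\<lambda>k\<in>{..<Suc n}. a k) * V (\<lambda>k\<in>{..<Suc n}. b k)
      \<le> (W (\<lambda>k\<in>{..<Suc n}. (a k + b k) / 2 :: real))\<^sup>2" for U V W :: "(nat \<Rightarrow> real) \<Rightarrow> real" and s t a b
  proof -
    let ?a = "\<lambda>k. (if k < n then (\<lambda>k\<in>{..<n}. a k) k else 0) + s * c k"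
    let ?b = "\<lambda>k. (if k < n then (\<lambda>k\<in>{..<n}. b k) k else 0) + t * c k"
    have "sh ((s + t) / 2) (\<lambda>k\<in>{..<n}. (a k + b k) / 2) = (\<lambda>k\<in>{..<Suc n}. (?a k + ?b k) / 2)"
      by (auto simp: sh_def fun_eq_iff field_simps)
    then show ?thesis using UVW[of ?a ?b] by (simp add: sh_def)
  qed
  have shm: "(\<lambda>x. U (sh t (\<lambda>k\<in>{..<n}. blinfun_apply (m k) x))) \<in> borel_measurable \<gamma>"
    "(\<lambda>a. U (sh t a)) \<in> borel_measurable (PiM {..<n} (\<lambda>_. borel))"
    "(\<lambda>p. U (sh (fst p) (\<lambda>k\<in>{..<n}. blinfun_apply (m k) (snd p)))) \<in> borel_measurable (borel \<Otimes>\<^sub>M \<gamma>)"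
    if [measurable]: "U \<in> borel_measurable (PiM {..<Suc n} (\<lambda>_. borel))"
    for U :: "(nat \<Rightarrow> real) \<Rightarrow> real" and t
  proof -
    have A: "(\<lambda>p. U (sh (fst p) (snd p))) \<in> borel_measurable (borel \<Otimes>\<^sub>M PiM {..<n} (\<lambda>_. borel))"
      by measurable
    have B: "(\<lambda>x. \<lambda>k\<in>{..<n}. blinfun_apply (m k) x) \<in> measurable \<gamma> (PiM {..<n} (\<lambda>_. borel))"
      by (intro measurable_restrict) auto
    show C: "(\<lambda>a. U (sh t a)) \<in> borel_measurable (PiM {..<n} (\<lambda>_. borel))"
      using measurable_compose[OF measurable_Pair1' A, of t] by simp
    show "(\<lambda>x. U (sh t (\<lambda>k\<in>{..<n}. blinfun_apply (m k) x))) \<in> borel_measurable \<gamma>"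
      by (rule measurable_compose[OF B C])
    have "(\<lambda>p. (fst p, \<lambda>k\<in>{..<n}. blinfun_apply (m k) (snd p))) \<in> measurable (borel \<Otimes>\<^sub>M \<gamma>) (borel \<Otimes>\<^sub>M PiM {..<n} (\<lambda>_. borel))"
      by (intro measurable_Pair measurable_fst measurable_compose[OF measurable_snd B])
    from measurable_compose[OF this A]
    show "(\<lambda>p. U (sh (fst p) (\<lambda>k\<in>{..<n}. blinfun_apply (m k) (snd p)))) \<in> borel_measurable (borel \<Otimes>\<^sub>M \<gamma>)" by simp
  qed
  define I where "I U t = (LINT x|\<gamma>. U (sh t (\<lambda>k\<in>{..<n}. blinfun_apply (m k) x)))" for U :: "(nat \<Rightarrow> real) \<Rightarrow> real" and t
  have I: "I F s * I G t \<le> (I K ((s + t) / 2))\<^sup>2" for s t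
    unfolding I_def
    by (rule Suc.IH[of "\<lambda>a. F (sh s a)" "\<lambda>a. G (sh t a)" "\<lambda>a. K (sh ((s + t) / 2) a)" m])
      (rule shm(2)[OF Suc.prems(1)] shm(2)[OF Suc.prems(4)] shm(2)[OF Suc.prems(7)] Suc.prems(2,3,5,6,8,9)
        mid[of F G K, OF Suc.prems(10)])+
  show ?case
  proof (cases "v = 0")
    case True
    have "e = 0" using True by (simp add: e_def)
    have "AE x in \<gamma>. blinfun_apply (l n) x = 0"
      using True integral_nonneg_eq_0_iff_AE[OF gaussian_square_integrable[of "l n"]]
      by (auto simp: v_def)
    then have "AE x in \<gamma>. (\<lambda>k\<in>{..<Suc n}. blinfun_apply (l k) x) = sh 0 (\<lambda>k\<in>{..<n}. blinfun_apply (m k) x)"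
      by eventually_elim (auto simp: sh_def m_def fun_eq_iff less_Suc_eq \<open>e = 0\<close>)
    then have red: "(LINT x|\<gamma>. U (\<lambda>k\<in>{..<Suc n}. blinfun_apply (l k) x)) = I U 0"
      if "U \<in> borel_measurable (PiM {..<Suc n} (\<lambda>_. borel))" for U :: "(nat \<Rightarrow> real) \<Rightarrow> real"
      unfolding I_def using that
      by (intro integral_cong_AE measurable_compose[OF _ that] measurable_restrict shm) auto
    show ?thesis
      using I[of 0 0] unfolding red[OF Suc.prems(1)] red[OF Suc.prems(4)] red[OF Suc.prems(7)] by simp
  next
    case False
    moreover have "0 \<le> v" by (simp add: v_def)
    ultimately have v: "0 < v" by simp
    have e1: "(LINT x|\<gamma>. (blinfun_apply e x)\<^sup>2) = 1"
      using v by (simp add: e_def blinfun.scaleR_left power_mult_distrib power_divide v_def[symmetric])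
    have cn: "c n = sqrt v"
    proof -
      have "c n = (LINT x|\<gamma>. (blinfun_apply (l n) x)\<^sup>2 / sqrt v)"
        by (simp add: c_def e_def blinfun.scaleR_left power2_eq_square)
      then show ?thesis using v by (simp add: v_def[symmetric] real_div_sqrt)
    qed
    have mn: "m n = 0" using v by (simp add: m_def cn e_def)
    have red: "(LINT x|\<gamma>. U (\<lambda>k\<in>{..<Suc n}. blinfun_apply (l k) x)) = (LINT t|std_normal_distribution. I U t)"
      "I U \<in> borel_measurable borel"
      if U: "U \<in> borel_measurable (PiM {..<Suc n} (\<lambda>_. borel))" "\<And>a. 0 \<le> U a" "\<And>a. U a \<le> 1"
      for U :: "(nat \<Rightarrow> real) \<Rightarrow> real"
    proof -
      have [measurable]: "(\<lambda>p. U (sh (fst p) (\<lambda>k\<in>{..<n}. blinfun_apply (m k) (snd p)))) \<in> borel_measurable (borel \<Otimes>\<^sub>M \<gamma>)"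
        by (rule shm[OF U(1)])
      have pt: "(\<lambda>k\<in>{..<Suc n}. blinfun_apply (l k) x - c k * blinfun_apply e x + t * c k) = sh t (\<lambda>k\<in>{..<n}. blinfun_apply (m k) x)" for t x
        using mn by (auto simp: sh_def m_def fun_eq_iff less_Suc_eq blinfun.diff_left blinfun.scaleR_left
            dest: arg_cong[where f = "\<lambda>f. blinfun_apply f x"])
      have M: "(\<lambda>p. sh (fst p) (\<lambda>k\<in>{..<n}. blinfun_apply (m k) (snd p)))
          \<in> measurable (std_normal_distribution \<Otimes>\<^sub>M \<gamma>) (PiM {..<Suc n} (\<lambda>_. borel))"
        unfolding pt[symmetric] by (intro measurable_restrict) auto
      have "(LINT x|\<gamma>. U (\<lambda>k\<in>{..<Suc n}. blinfun_apply (l k) x))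
        = (LINT a|distr \<gamma> (PiM {..<Suc n} (\<lambda>_. borel)) (\<lambda>x. \<lambda>k\<in>{..<Suc n}. blinfun_apply (l k) x). U a)"
        by (intro integral_distr[symmetric] measurable_restrict U) auto
      also have "\<dots> = (LINT p|(std_normal_distribution \<Otimes>\<^sub>M \<gamma>). U (sh (fst p) (\<lambda>k\<in>{..<n}. blinfun_apply (m k) (snd p))))"
        unfolding gaussian_split[OF finite_lessThan e1 c_def] pt
        by (rule integral_distr[OF M U(1)])
      also have "\<dots> = (LINT t|std_normal_distribution. I U t)"
        unfolding I_def using U
        by (subst P.integral_fst'[symmetric]) (auto intro!: P.integrable_const_bound[of _ 1])
      finally show "(LINT x|\<gamma>. U (\<lambda>k\<in>{..<Suc n}. blinfun_apply (l k) x)) = (LINT t|std_normal_distribution. I U t)" .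
      show "I U \<in> borel_measurable borel"
        unfolding I_def[abs_def]
        by (rule borel_measurable_lebesgue_integral) (use shm(3)[OF U(1)] in \<open>simp add: split_beta'\<close>)
    qed
    have I01: "0 \<le> I U t" "I U t \<le> 1"
      if U: "U \<in> borel_measurable (PiM {..<Suc n} (\<lambda>_. borel))" "\<And>a. 0 \<le> U a" "\<And>a. U a \<le> 1"
      for U :: "(nat \<Rightarrow> real) \<Rightarrow> real" and t
    proof -
      show "0 \<le> I U t" using U by (simp add: I_def)
      have "I U t \<le> (LINT x|\<gamma>. 1)"
        unfolding I_def using U shm(1)[OF U(1)]
        by (intro integral_mono integrable_const_bound[of _ 1]) auto
      then show "I U t \<le> 1" by simp
    qed
    show ?thesis
      unfolding red(1)[OF Suc.prems(1-3)] red(1)[OF Suc.prems(4-6)] red(1)[OF Suc.prems(7-9)]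
      by (rule prekopa_leindler_normal) (use Suc.prems in \<open>auto intro!: red(2) I01 I\<close>)
  qed
qed

text \<open>If a seminorm exceeds \<open>3 * s\<close> at one point and is at most \<open>s\<close> at another, then it exceeds \<open>s\<close>
  at their midpoint. The Prekopa--Leindler inequality for the indicators of these sets gives the
  estimate for the maximum of finitely many norming functionals, and in the limit for the norm.\<close>

lemma (in gaussian_measure) norm_tail:
  assumes s: "0 \<le> s"
  shows "prob {x. 3 * s < norm x} * (1 - prob {x. s < norm x}) \<le> (prob {x. s < norm x})\<^sup>2"
proof -
  obtain l :: "nat \<Rightarrow> 'a \<Rightarrow>\<^sub>L real" where l: "\<And>x s. 0 \<le> s \<Longrightarrow> norm x \<le> s \<longleftrightarrow> (\<forall>k. \<bar>l k x\<bar> \<le> s)"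
    by (rule cball_countable_functionals) (rule that)
  define A where "A r n = {x. \<exists>k<n. r < \<bar>l k x\<bar>}" for r :: real and n :: nat
  have [measurable]: "A r n \<in> sets borel" for r n
    unfolding A_def by measurable
  have lim: "(\<lambda>n. prob (A r n)) \<longlonglongrightarrow> prob {x. r < norm x}" if "0 \<le> r" for r
  proof -
    have "r < norm x \<longleftrightarrow> (\<exists>k. r < \<bar>l k x\<bar>)" for x
      using l[OF that, of x] by (metis not_le)
    then have "(\<Union>n. A r n) = {x. r < norm x}"
      by (auto simp: A_def)
    moreover have "incseq (A r)"
      by (auto simp: incseq_def A_def intro: less_le_trans)
    then have "(\<lambda>n. prob (A r n)) \<longlonglongrightarrow> prob (\<Union>n. A r n)"
      by (intro finite_Lim_measure_incseq) auto
    ultimately show ?thesis by simp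
  qed
  have "prob (A (3 * s) n) * (1 - prob (A s n)) \<le> (prob (A s n))\<^sup>2" for n
  proof -
    define T :: "real \<Rightarrow> (nat \<Rightarrow> real) set"
      where "T r = {a. \<exists>k\<in>{..<n}. r < \<bar>a k\<bar>}" for r
    have T: "T r \<inter> space (PiM {..<n} (\<lambda>_. borel)) \<in> sets (PiM {..<n} (\<lambda>_. borel))" for r
    proof -
      have "{a \<in> space (PiM {..<n} (\<lambda>_. borel)). \<exists>k\<in>{..<n}. r < \<bar>a k :: real\<bar>} \<in> sets (PiM {..<n} (\<lambda>_. borel))"
        by measurable
      then show ?thesis by (simp add: T_def Int_def conj_commute)
    qed
    have Tm: "indicat_real (T r) \<in> borel_measurable (PiM {..<n} (\<lambda>_. borel))" for r
      using T by (simp add: borel_measurable_indicator_iff)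
    have PL: "indicat_real (T (3 * s)) (\<lambda>k\<in>{..<n}. a k) * (1 - indicator (T s) (\<lambda>k\<in>{..<n}. b k))
        \<le> (indicat_real (T s) (\<lambda>k\<in>{..<n}. (a k + b k) / 2))\<^sup>2" for a b
    proof (cases "(\<lambda>k\<in>{..<n}. a k) \<in> T (3 * s) \<and> (\<lambda>k\<in>{..<n}. b k) \<notin> T s")
      case True
      then obtain k where k: "k < n" "3 * s < \<bar>a k\<bar>" "\<bar>b k\<bar> \<le> s"
        by (auto simp: T_def not_less)
      then have "s < \<bar>(a k + b k) / 2\<bar>"
        using abs_triangle_ineq[of "a k + b k" "- b k"] by simp
      then have "(\<lambda>k\<in>{..<n}. (a k + b k) / 2) \<in> T s" using k(1) by (auto simp: T_def)
      then show ?thesis by (simp add: indicator_def)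
    qed (auto simp: indicator_def)
    have "(LINT x|\<gamma>. indicat_real (T (3 * s)) (\<lambda>k\<in>{..<n}. l k x))
        * (LINT x|\<gamma>. 1 - indicat_real (T s) (\<lambda>k\<in>{..<n}. l k x))
        \<le> (LINT x|\<gamma>. indicat_real (T s) (\<lambda>k\<in>{..<n}. l k x))\<^sup>2"
    proof (rule prekopa_leindler_gaussian[of "indicat_real (T (3 * s))" n
          "\<lambda>a. 1 - indicat_real (T s) a" "indicat_real (T s)" l, OF _ _ _ _ _ _ _ _ _ PL])
      show "(\<lambda>a. 1 - indicat_real (T s) a) \<in> borel_measurable (PiM {..<n} (\<lambda>_. borel))"
        by (intro borel_measurable_diff Tm borel_measurable_const)
    qed (rule Tm | simp add: indicator_def)+
    moreover have "indicator (T r) (\<lambda>k\<in>{..<n}. l k x) = indicat_real (A r n) x" for r x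
      by (auto simp: T_def A_def indicator_def)
    ultimately show ?thesis
      using prob_space by (simp add: emeasure_eq_measure)
  qed
  moreover have "(\<lambda>n. prob (A (3 * s) n) * (1 - prob (A s n)))
      \<longlonglongrightarrow> prob {x. 3 * s < norm x} * (1 - prob {x. s < norm x})"
    using s by (intro tendsto_intros lim) auto
  moreover have "(\<lambda>n. (prob (A s n))\<^sup>2) \<longlonglongrightarrow> (prob {x. s < norm x})\<^sup>2"
    using s by (intro tendsto_intros lim) auto
  ultimately show ?thesis by (blast intro: LIMSEQ_le)
qed

text \<open>Below, \<open>s\<close> is so large that the tail at \<open>s\<close> is at most 1/19; then each factor three in the radius
  costs a factor 18 in probability, which beats the factor 9 in the square of the norm.\<close>

lemma (in gaussian_measure) norm_square_integrable: "integrable \<gamma> (\<lambda>x. (norm x)\<^sup>2)"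
proof -
  define Q where "Q s = prob {x. s < norm x}" for s :: real
  have "(\<lambda>n. prob {x. norm x \<le> real n}) \<longlonglongrightarrow> prob (\<Union>n. {x. norm x \<le> real n})"
    by (rule finite_Lim_measure_incseq) (auto simp: incseq_def)
  moreover have "(\<Union>n. {x :: 'a. norm x \<le> real n}) = UNIV"
    using real_arch_simple by auto
  ultimately have "(\<lambda>n. prob {x. norm x \<le> real n}) \<longlonglongrightarrow> 1" using prob_space by simp
  from order_tendstoD(1)[OF this, of "18 / 19"]
  obtain n where n: "18 / 19 < prob {x. norm x \<le> real n}"
    by (auto simp: eventually_sequentially)
  have "{x. norm x \<le> real n} \<subseteq> {x. norm x \<le> real (Suc n)}" by auto
  then have "prob {x. norm x \<le> real n} \<le> prob {x. norm x \<le> real (Suc n)}"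
    by (intro finite_measure_mono) auto
  with n have n': "18 / 19 < prob {x. norm x \<le> real (Suc n)}" by simp
  define s where "s = real (Suc n)"
  have s: "0 < s" by (simp add: s_def)
  have "Q s = 1 - prob {x. norm x \<le> s}"
    unfolding Q_def using prob_compl[of "{x. norm x \<le> s}"]
    by (simp add: Compl_eq_Diff_UNIV[symmetric] Collect_neg_eq[symmetric] not_le)
  then have Qs: "Q s \<le> 1 / 19" using n' by (simp add: s_def)
  have Q0: "0 \<le> Q r" for r by (simp add: Q_def)
  have Qanti: "Q r' \<le> Q r" if "r \<le> r'" for r r'
    unfolding Q_def using that by (intro finite_measure_mono) auto
  have decay: "Q (3 ^ j * s) \<le> (1 / 18) ^ j" for j
  proof (induction j)
    case 0
    then show ?case using Qs by simp
  next
    case (Suc j)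
    have "s \<le> 3 ^ j * s" using s by (simp add: field_simps)
    then have q: "Q (3 ^ j * s) \<le> 1 / 19" using Qanti Qs order_trans by blast
    have "Q (3 * (3 ^ j * s)) * (1 - Q (3 ^ j * s)) \<le> (Q (3 ^ j * s))\<^sup>2"
      unfolding Q_def by (rule norm_tail) (use s in simp)
    moreover have "Q (3 * (3 ^ j * s)) * (18 / 19) \<le> Q (3 * (3 ^ j * s)) * (1 - Q (3 ^ j * s))"
      using q Q0 by (intro mult_left_mono) auto
    moreover have "(Q (3 ^ j * s))\<^sup>2 \<le> Q (3 ^ j * s) * (1 / 19)"
      using q Q0 by (simp add: power2_eq_square mult_left_mono del: times_divide_eq_right)
    ultimately have "Q (3 * (3 ^ j * s)) \<le> Q (3 ^ j * s) * (1 / 18)" by simp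
    also have "\<dots> \<le> (1 / 18) ^ j * (1 / 18)" using Suc by (intro mult_right_mono) auto
    finally show ?case by (simp add: mult_ac)
  qed
  have "(\<integral>\<^sup>+x. (norm x)\<^sup>2 \<partial>\<gamma>)
      \<le> (\<integral>\<^sup>+x. ennreal (s\<^sup>2)
        + (\<Sum>j. ennreal ((3 ^ Suc j * s)\<^sup>2) * indicator {x. 3 ^ j * s < norm x} x) \<partial>\<gamma>)"
  proof (rule nn_integral_mono)
    fix x
    let ?S = "\<Sum>j. ennreal ((3 ^ Suc j * s)\<^sup>2) * indicator {x. 3 ^ j * s < norm x} x"
    show "ennreal ((norm x)\<^sup>2) \<le> ennreal (s\<^sup>2) + ?S"
    proof (cases "norm x \<le> s")
      case True
      then have "ennreal ((norm x)\<^sup>2) \<le> ennreal (s\<^sup>2)" by (intro ennreal_leI power_mono) auto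
      then show ?thesis by (simp add: add_increasing2)
    next
      case False
      define j where "j = (LEAST j. norm x \<le> 3 ^ j * s)"
      obtain m where "norm x / s < 3 ^ m" using real_arch_pow[of 3 "norm x / s"] by auto
      then have ex: "norm x \<le> 3 ^ m * s" using s by (simp add: field_simps)
      have j: "norm x \<le> 3 ^ j * s" unfolding j_def by (rule LeastI[of _ m]) (rule ex)
      with False obtain i where i: "j = Suc i" by (cases j) auto
      have "\<not> norm x \<le> 3 ^ i * s"
        using not_less_Least[of i "\<lambda>j. norm x \<le> 3 ^ j * s"] i by (simp add: j_def[symmetric])
      then have "ennreal ((norm x)\<^sup>2) \<le> ennreal ((3 ^ Suc i * s)\<^sup>2) * indicator {x. 3 ^ i * s < norm x} x"
        using j i by (auto simp del: power_Suc intro!: ennreal_leI power_mono)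
      also have "\<dots> = (\<Sum>j\<in>{i}. ennreal ((3 ^ Suc j * s)\<^sup>2) * indicator {x. 3 ^ j * s < norm x} x)"
        by (simp only: sum.insert sum.empty finite.emptyI empty_iff not_False_eq_True add_0_right)
      also have "\<dots> \<le> ?S"
        by (rule sum_le_suminf) auto
      finally show ?thesis by (simp add: add_increasing)
    qed
  qed
  also have "\<dots> = ennreal (s\<^sup>2) + (\<Sum>j. ennreal ((3 ^ Suc j * s)\<^sup>2) * ennreal (Q (3 ^ j * s)))"
    using emeasure_space_1
    by (simp add: nn_integral_add nn_integral_suminf nn_integral_cmult Q_def emeasure_eq_measure)
  also have "\<dots> \<le> ennreal (s\<^sup>2) + (\<Sum>j. ennreal (9 * s\<^sup>2 * (1 / 2) ^ j))"
  proof (intro add_left_mono suminf_le)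
    fix j
    have "(3 ^ Suc j * s)\<^sup>2 * Q (3 ^ j * s) \<le> (3 ^ Suc j * s)\<^sup>2 * (1 / 18) ^ j"
      using decay by (intro mult_left_mono) auto
    also have "\<dots> = 9 * s\<^sup>2 * (9 ^ j * (1 / 18) ^ j)"
      by (simp add: power_mult_distrib power2_eq_square)
        (simp add: power_mult_distrib[symmetric])
    also have "\<dots> = 9 * s\<^sup>2 * (1 / 2) ^ j"
      by (simp add: power_mult_distrib[symmetric])
    finally show "ennreal ((3 ^ Suc j * s)\<^sup>2) * ennreal (Q (3 ^ j * s)) \<le> ennreal (9 * s\<^sup>2 * (1 / 2) ^ j)"
      by (simp add: ennreal_mult[symmetric] Q0 ennreal_leI)
  qed auto
  also have "\<dots> < \<infinity>"
  proof -
    have "summable (\<lambda>j. 9 * s\<^sup>2 * (1 / 2) ^ j)" by (intro summable_mult summable_geometric) auto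
    then show ?thesis by (subst suminf_ennreal2) auto
  qed
  finally show ?thesis by (intro integrableI_bounded) auto
qed

section \<open>The Cameron--Martin space\<close>

text \<open>Since \<open>norm\<close> is square integrable, \<open>R_map\<close> is a genuine Bochner integral on \<open>L2\<close>.\<close>

context gaussian_measure
begin

lemma L2_integrable:
  assumes "f \<in> L2 \<gamma>"
  shows "integrable \<gamma> f"
proof -
  have "(\<lambda>x. 1) \<in> L2 \<gamma>" by (simp add: L2_def)
  from L2_mult_integrable[OF assms this] show ?thesis by simp
qed

lemma dual_closure_L2: "f \<in> dual_closure \<gamma> \<Longrightarrow> f \<in> L2 \<gamma>"
  by (auto simp: dual_closure_def L2_tendsto_def)

lemma blinfun_dual_closure: "blinfun_apply l \<in> dual_closure \<gamma>"
  unfolding dual_closure_def L2_tendsto_def by (auto intro!: exI[of _ "\<lambda>_. l"] blinfun_L2)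

lemma dual_closureE:
  assumes "f \<in> dual_closure \<gamma>"
  obtains l where "L2_tendsto \<gamma> (\<lambda>n. blinfun_apply (l n)) f"
  using assms by (auto simp: dual_closure_def)

lemma dual_closure_lincomb:
  assumes f: "f \<in> dual_closure \<gamma>" and g: "g \<in> dual_closure \<gamma>"
  shows "(\<lambda>x. a * f x + b * g x) \<in> dual_closure \<gamma>"
proof -
  obtain l where l: "L2_tendsto \<gamma> (\<lambda>n. blinfun_apply (l n)) f"
    using f by (rule dual_closureE)
  obtain k where k: "L2_tendsto \<gamma> (\<lambda>n. blinfun_apply (k n)) g"
    using g by (rule dual_closureE)
  have "L2_tendsto \<gamma> (\<lambda>n. blinfun_apply (a *\<^sub>R l n + b *\<^sub>R k n)) (\<lambda>x. a * f x + b * g x)"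
    using L2_tendsto_lincomb[OF l k, of a b]
    by (simp add: plus_blinfun.rep_eq scaleR_blinfun.rep_eq)
  then show ?thesis
    unfolding dual_closure_def by (intro CollectI exI[of _ "\<lambda>n. a *\<^sub>R l n + b *\<^sub>R k n"])
qed

lemma dual_closure_diff:
  "f \<in> dual_closure \<gamma> \<Longrightarrow> g \<in> dual_closure \<gamma> \<Longrightarrow> (\<lambda>x. f x - g x) \<in> dual_closure \<gamma>"
  using dual_closure_lincomb[of f g 1 "-1"] by simp

lemma dual_closure_sum:
  assumes "finite I" "\<And>i. i \<in> I \<Longrightarrow> f i \<in> dual_closure \<gamma>"
  shows "(\<lambda>x. \<Sum>i\<in>I. a i * f i x) \<in> dual_closure \<gamma>"
  using assms
proof (induction I rule: finite_induct)
  case empty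
  then show ?case using blinfun_dual_closure[of 0] by (simp add: zero_blinfun.rep_eq)
next
  case (insert j I)
  then show ?case
    using dual_closure_lincomb[of "f j" "\<lambda>x. \<Sum>i\<in>I. a i * f i x" "a j" 1] by simp
qed

text \<open>A bound for the norm of the inclusion of the Cameron--Martin space.\<close>

definition norm_bound :: real where
  "norm_bound = sqrt (LINT x|\<gamma>. (norm x)\<^sup>2)"

lemma norm_L2: "norm \<in> L2 \<gamma>"
  using norm_square_integrable by (simp add: L2_def)

lemma R_integrable:
  assumes "f \<in> L2 \<gamma>"
  shows "integrable \<gamma> (\<lambda>x. f x *\<^sub>R x)"
proof -
  note [measurable] = L2_measurable[OF assms]
  have "integrable \<gamma> (\<lambda>x. norm (f x *\<^sub>R x))"
    using integrable_norm[OF L2_mult_integrable[OF assms norm_L2]] by (simp add: abs_mult)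
  then show ?thesis by (rule integrable_norm_cancel) measurable
qed

lemma norm_R_map:
  assumes f: "f \<in> L2 \<gamma>"
  shows "norm (R_map \<gamma> f) \<le> norm_bound * sqrt (LINT x|\<gamma>. (f x)\<^sup>2)"
proof -
  have f': "(\<lambda>x. \<bar>f x\<bar>) \<in> L2 \<gamma>" using f by (auto simp: L2_def)
  have "norm (R_map \<gamma> f) \<le> (LINT x|\<gamma>. norm (f x *\<^sub>R x))"
    unfolding R_map_def by (rule integral_norm_bound)
  also have "\<dots> \<le> \<bar>LINT x|\<gamma>. \<bar>f x\<bar> * norm x\<bar>" by simp
  also have "\<dots> \<le> sqrt (LINT x|\<gamma>. \<bar>f x\<bar>\<^sup>2) * norm_bound"
    unfolding norm_bound_def by (rule Cauchy_Schwarz_L2[OF f' norm_L2])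
  finally show ?thesis by (simp add: mult.commute)
qed

lemma blinfun_R_map: "f \<in> L2 \<gamma> \<Longrightarrow> blinfun_apply l (R_map \<gamma> f) = (LINT x|\<gamma>. f x * l x)"
  unfolding R_map_def
  using integral_bounded_linear[OF blinfun.bounded_linear_right R_integrable, of f l]
  by (simp add: blinfun.scaleR_right)

lemma R_map_sum:
  assumes "finite I" "\<And>i. i \<in> I \<Longrightarrow> f i \<in> L2 \<gamma>"
  shows "R_map \<gamma> (\<lambda>x. \<Sum>i\<in>I. a i * f i x) = (\<Sum>i\<in>I. a i *\<^sub>R R_map \<gamma> (f i))"
proof -
  have "R_map \<gamma> (\<lambda>x. \<Sum>i\<in>I. a i * f i x) = (LINT x|\<gamma>. (\<Sum>i\<in>I. a i *\<^sub>R (f i x *\<^sub>R x)))"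
    by (simp add: R_map_def scaleR_sum_left)
  also have "\<dots> = (\<Sum>i\<in>I. LINT x|\<gamma>. a i *\<^sub>R (f i x *\<^sub>R x))"
    by (intro Bochner_Integration.integral_sum integrable_scaleR_right R_integrable assms)
  also have "\<dots> = (\<Sum>i\<in>I. a i *\<^sub>R R_map \<gamma> (f i))"
    unfolding R_map_def by (intro sum.cong refl integral_scaleR_right)
  finally show ?thesis .
qed

lemma R_map_diff:
  "f \<in> L2 \<gamma> \<Longrightarrow> g \<in> L2 \<gamma> \<Longrightarrow> R_map \<gamma> (\<lambda>x. f x - g x) = R_map \<gamma> f - R_map \<gamma> g"
  using R_integrable by (simp add: R_map_def scaleR_diff_left)

text \<open>An element of the closure of the dual that is orthogonal to the dual is orthogonal to
  itself; hence \<open>R_map\<close> is injective on this closure up to null sets.\<close>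

lemma dual_closure_orthogonal:
  assumes f: "f \<in> dual_closure \<gamma>" and orth: "\<And>l. (LINT x|\<gamma>. f x * blinfun_apply l x) = 0"
  shows "AE x in \<gamma>. f x = 0"
proof -
  note f2 = dual_closure_L2[OF f]
  obtain l where "L2_tendsto \<gamma> (\<lambda>n. blinfun_apply (l n)) f"
    using f by (rule dual_closureE)
  then have l: "(\<lambda>n. LINT x|\<gamma>. (blinfun_apply (l n) x - f x)\<^sup>2) \<longlonglongrightarrow> 0"
    by (simp add: L2_tendsto_def)
  let ?F = "LINT x|\<gamma>. (f x)\<^sup>2"
  have "?F \<le> sqrt ?F * sqrt (LINT x|\<gamma>. (blinfun_apply (l n) x - f x)\<^sup>2)" for n
  proof -
    have "(LINT x|\<gamma>. f x * (blinfun_apply (l n) x - f x)) = - ?F"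
      using L2_mult_integrable[OF f2 blinfun_L2[of "l n"]] L2_square_integrable[OF f2] orth
      by (simp add: right_diff_distrib power2_eq_square)
    then show ?thesis
      using Cauchy_Schwarz_L2[OF f2 L2_diff[OF blinfun_L2[of "l n"] f2]] by simp
  qed
  moreover have "(\<lambda>n. sqrt ?F * sqrt (LINT x|\<gamma>. (blinfun_apply (l n) x - f x)\<^sup>2)) \<longlonglongrightarrow> sqrt ?F * sqrt 0"
    by (intro tendsto_intros l)
  ultimately have "?F \<le> sqrt ?F * sqrt 0" by (intro LIMSEQ_le_const) auto
  then have "?F = 0" by (simp add: order_antisym)
  then show ?thesis
    using integral_nonneg_eq_0_iff_AE[OF L2_square_integrable[OF f2]] by simp
qed

lemma R_map_inj:
  assumes f: "f \<in> dual_closure \<gamma>" and g: "g \<in> dual_closure \<gamma>" and eq: "R_map \<gamma> f = R_map \<gamma> g"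
  shows "AE x in \<gamma>. f x = g x"
proof -
  note L = dual_closure_L2[OF f] dual_closure_L2[OF g]
  have "AE x in \<gamma>. f x - g x = 0"
  proof (rule dual_closure_orthogonal[OF dual_closure_diff[OF f g]])
    fix l
    have "R_map \<gamma> (\<lambda>x. f x - g x) = 0" using eq by (simp add: R_map_diff[OF L])
    then show "(LINT x|\<gamma>. (f x - g x) * blinfun_apply l x) = 0"
      using blinfun_R_map[OF L2_diff[OF L], of l] by (simp add: blinfun.zero_right)
  qed
  then show ?thesis by simp
qed

lemma
  assumes "h \<in> cameron_martin \<gamma>"
  shows hat_dual_closure: "hat \<gamma> h \<in> dual_closure \<gamma>" and R_map_hat: "R_map \<gamma> (hat \<gamma> h) = h"
proof -
  have "\<exists>f. f \<in> dual_closure \<gamma> \<and> R_map \<gamma> f = h"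
    using assms by (auto simp: cameron_martin_def)
  then have "hat \<gamma> h \<in> dual_closure \<gamma> \<and> R_map \<gamma> (hat \<gamma> h) = h"
    unfolding hat_def by (rule someI_ex)
  then show "hat \<gamma> h \<in> dual_closure \<gamma>" "R_map \<gamma> (hat \<gamma> h) = h" by auto
qed

lemma hat_R_map:
  assumes f: "f \<in> dual_closure \<gamma>"
  shows "AE x in \<gamma>. hat \<gamma> (R_map \<gamma> f) x = f x"
  by (rule R_map_inj[OF hat_dual_closure f R_map_hat]) (use f in \<open>auto simp: cameron_martin_def\<close>)

lemma norm_le_norm_H:
  assumes h: "h \<in> cameron_martin \<gamma>"
  shows "norm h \<le> norm_bound * norm_H \<gamma> h"
  using norm_R_map[OF dual_closure_L2[OF hat_dual_closure[OF h]]] R_map_hat[OF h]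
  by (simp add: norm_H_def inner_H_def power2_eq_square)

end

section \<open>Splitting along Cameron--Martin directions\<close>

definition polyhedra :: "'a::real_normed_vector set set" where
  "polyhedra = {{x. \<forall>p\<in>S. blinfun_apply (fst p) x \<le> snd p} | S :: (('a \<Rightarrow>\<^sub>L real) \<times> real) set. finite S}"

lemma polyhedraI:
  fixes S :: "(('a::real_normed_vector \<Rightarrow>\<^sub>L real) \<times> real) set"
  shows "finite S \<Longrightarrow> {x. \<forall>p\<in>S. blinfun_apply (fst p) x \<le> snd p} \<in> polyhedra"
  unfolding polyhedra_def by (intro CollectI exI[of _ S] conjI refl)

text \<open>A closed ball is a countable intersection of polyhedra because of the countable norming family,
  and an open set is a countable union of closed balls.\<close>

lemma sets_borel_polyhedra:
  "sets (borel :: 'a::{real_normed_vector, second_countable_topology} measure) = sigma_sets UNIV polyhedra"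
proof -
  define P :: "'a measure" where "P = sigma UNIV polyhedra"
  have setsP: "sets P = sigma_sets UNIV polyhedra" and spaceP: "space P = UNIV"
    by (auto simp: P_def)
  obtain l :: "nat \<Rightarrow> 'a \<Rightarrow>\<^sub>L real" where l: "\<And>x s. 0 \<le> s \<Longrightarrow> norm x \<le> s \<longleftrightarrow> (\<forall>k. \<bar>l k x\<bar> \<le> s)"
    by (rule cball_countable_functionals) (rule that)
  have cb: "cball c e \<in> sets P" if e: "0 \<le> e" for c e
  proof -
    let ?S = "\<lambda>k. {(l k, e + l k c), (- l k, e - l k c)}"
    have "cball c e = (\<Inter>k. {x. \<forall>p\<in>?S k. blinfun_apply (fst p) x \<le> snd p})"
      using l[OF e] by (auto simp: dist_norm norm_minus_commute[of c] blinfun.diff_right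
          blinfun.minus_left abs_le_iff algebra_simps)
    moreover have "{x. \<forall>p\<in>?S k. blinfun_apply (fst p) x \<le> snd p} \<in> sets P" for k
      unfolding setsP by (intro sigma_sets.Basic polyhedraI) simp
    ultimately show ?thesis by (auto intro!: sets.countable_INT')
  qed
  have op: "U \<in> sets P" if U: "open U" for U
  proof -
    define I where "I = {(c, e). 0 < e \<and> cball c e \<subseteq> U}"
    have "\<And>B. B \<in> (\<lambda>(c, e). ball c e) ` I \<Longrightarrow> open B" by auto
    from Lindelof[OF this] obtain F where F: "F \<subseteq> (\<lambda>(c, e). ball c e) ` I" "countable F"
      "\<Union>F = \<Union>((\<lambda>(c, e). ball c e) ` I)" by blast
    then obtain I' where I': "I' \<subseteq> I" "countable I'" "F = (\<lambda>(c, e). ball c e) ` I'"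
      using countable_subset_image[of F "\<lambda>(c, e). ball c e" I] by auto
    have UF: "x \<in> \<Union>F" if x: "x \<in> U" for x
    proof -
      obtain e where "0 < e" "cball x e \<subseteq> U" using U x by (auto simp: open_contains_cball)
      then show ?thesis
        unfolding F(3) by (intro UnionI[of "ball x e"] image_eqI[of _ _ "(x, e)"]) (auto simp: I_def)
    qed
    have "U = (\<Union>(c, e)\<in>I'. cball c e)"
    proof (intro equalityI subsetI)
      fix x assume "x \<in> U"
      then obtain c e where "(c, e) \<in> I'" "x \<in> ball c e"
        using UF[of x] unfolding I'(3) by auto
      then show "x \<in> (\<Union>(c, e)\<in>I'. cball c e)" by (intro UN_I[of "(c, e)"]) auto
    qed (use I'(1) in \<open>auto simp: I_def\<close>)
    moreover have "(case p of (c, e) \<Rightarrow> cball c e) \<in> sets P" if "p \<in> I'" for p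
      using that I'(1) by (auto simp: I_def intro!: cb)
    ultimately show ?thesis using I'(2) by (auto intro!: sets.countable_UN')
  qed
  have "sets (borel :: 'a measure) = sigma_sets UNIV {S. open S}"
    by (simp add: borel_def)
  also have "\<dots> = sigma_sets UNIV polyhedra"
  proof (rule sigma_sets_eqI)
    fix U :: "'a set" assume "U \<in> {S. open S}"
    then show "U \<in> sigma_sets UNIV polyhedra" using op setsP by simp
  next
    fix A :: "'a set" assume "A \<in> polyhedra"
    then obtain S :: "(('a \<Rightarrow>\<^sub>L real) \<times> real) set"
      where "A = (\<Inter>p\<in>S. {x. blinfun_apply (fst p) x \<le> snd p})" by (auto simp: polyhedra_def)
    then have "closed A" by (auto intro!: closed_INT closed_Collect_le continuous_intros)
    then have "A \<in> sets borel" by (rule borel_closed)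
    then show "A \<in> sigma_sets UNIV {S. open S}" by (simp add: borel_def)
  qed
  finally show ?thesis .
qed

lemma Int_stable_polyhedra: "Int_stable polyhedra"
proof (rule Int_stableI)
  fix A B :: "'a set" assume "A \<in> polyhedra" "B \<in> polyhedra"
  then obtain S T :: "(('a \<Rightarrow>\<^sub>L real) \<times> real) set" where "finite S" "A = {x. \<forall>p\<in>S. blinfun_apply (fst p) x \<le> snd p}"
    "finite T" "B = {x. \<forall>p\<in>T. blinfun_apply (fst p) x \<le> snd p}"
    unfolding polyhedra_def by blast
  then have "finite (S \<union> T)" "A \<inter> B = {x. \<forall>p\<in>S \<union> T. blinfun_apply (fst p) x \<le> snd p}" by auto
  then show "A \<inter> B \<in> polyhedra" using polyhedraI[of "S \<union> T"] by simp
qed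

context gaussian_measure
begin

text \<open>Polyhedra only involve finitely many functionals, so the splitting of their joint law yields
  a splitting of \<open>\<gamma>\<close> itself along the Cameron--Martin vector \<open>R_map \<gamma> e\<close>.\<close>

lemma gaussian_split_borel:
  fixes e :: "'a \<Rightarrow>\<^sub>L real"
  assumes e: "(LINT x|\<gamma>. (e x)\<^sup>2) = 1"
  defines "T \<equiv> (\<lambda>p. snd p - e (snd p) *\<^sub>R R_map \<gamma> e + fst p *\<^sub>R R_map \<gamma> e)"
  shows "T \<in> borel_measurable (std_normal_distribution \<Otimes>\<^sub>M \<gamma>)"
    and "\<gamma> = distr (std_normal_distribution \<Otimes>\<^sub>M \<gamma>) borel T"
proof -
  interpret N: prob_space std_normal_distribution by (rule prob_space_normal_density) simp
  interpret P: pair_prob_space std_normal_distribution \<gamma> ..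
  show [measurable]: "T \<in> borel_measurable (std_normal_distribution \<Otimes>\<^sub>M \<gamma>)"
    unfolding T_def by measurable
  show "\<gamma> = distr (std_normal_distribution \<Otimes>\<^sub>M \<gamma>) borel T"
  proof (rule measure_eqI_generator_eq[OF Int_stable_polyhedra, where \<Omega> = UNIV and A = "\<lambda>_. UNIV"])
    show "sets \<gamma> = sigma_sets UNIV polyhedra"
      "sets (distr (std_normal_distribution \<Otimes>\<^sub>M \<gamma>) borel T) = sigma_sets UNIV polyhedra"
      by (simp_all add: sets_borel_polyhedra)
    show "range (\<lambda>_. UNIV) \<subseteq> (polyhedra :: 'a set set)"
      using polyhedraI[of "{}"] by auto
  next
    fix X :: "'a set" assume X: "X \<in> polyhedra"
    then have "X \<in> sets borel" unfolding sets_borel_polyhedra by (rule sigma_sets.Basic)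
    obtain S :: "(('a \<Rightarrow>\<^sub>L real) \<times> real) set" where S: "finite S" "X = {x. \<forall>p\<in>S. blinfun_apply (fst p) x \<le> snd p}"
      using X unfolding polyhedra_def by blast
    define Q where "Q = (\<Pi>\<^sub>E p\<in>S. {..snd p})"
    have [measurable]: "Q \<in> sets (PiM S (\<lambda>_. borel))"
      unfolding Q_def using S(1) by (intro sets_PiM_I_finite) auto
    have QX: "(\<lambda>p\<in>S. blinfun_apply (fst p) x) \<in> Q \<longleftrightarrow> x \<in> X" for x
      unfolding S(2) Q_def by (simp add: PiE_iff)
    define c where "c p = (LINT x|\<gamma>. blinfun_apply (fst p) x * e x)" for p :: "('a \<Rightarrow>\<^sub>L real) \<times> real"
    have Tp: "blinfun_apply (fst p) (T q) = fst p (snd q) - c p * e (snd q) + fst q * c p" for p q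
      using blinfun_R_map[OF blinfun_L2, of "fst p" e]
      by (simp add: T_def c_def blinfun.diff_right blinfun.add_right blinfun.scaleR_right mult.commute)
    have m1: "(\<lambda>x. \<lambda>p\<in>S. blinfun_apply (fst p) x) \<in> measurable \<gamma> (PiM S (\<lambda>_. borel))"
      by (intro measurable_restrict) auto
    have m2: "(\<lambda>q. \<lambda>p\<in>S. blinfun_apply (fst p) (T q))
        \<in> measurable (std_normal_distribution \<Otimes>\<^sub>M \<gamma>) (PiM S (\<lambda>_. borel))"
      by (intro measurable_restrict) auto
    have "emeasure \<gamma> X = emeasure (distr \<gamma> (PiM S (\<lambda>_. borel)) (\<lambda>x. \<lambda>p\<in>S. blinfun_apply (fst p) x)) Q"
      by (subst emeasure_distr[OF m1]) (simp_all add: QX vimage_def)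
    also have "\<dots> = emeasure (distr (std_normal_distribution \<Otimes>\<^sub>M \<gamma>) (PiM S (\<lambda>_. borel))
        (\<lambda>q. \<lambda>p\<in>S. blinfun_apply (fst p) (T q))) Q"
      unfolding Tp gaussian_split[OF S(1) e c_def] ..
    also have "\<dots> = emeasure (distr (std_normal_distribution \<Otimes>\<^sub>M \<gamma>) borel T) X"
      using \<open>X \<in> sets borel\<close>
      by (subst (1 2) emeasure_distr) (simp_all add: QX vimage_def m2)
    finally show "emeasure \<gamma> X = emeasure (distr (std_normal_distribution \<Otimes>\<^sub>M \<gamma>) borel T) X" .
  qed (auto simp: emeasure_eq_measure)
qed

lemma zero_variance:
  assumes "(LINT x|\<gamma>. (blinfun_apply l x)\<^sup>2) = 0"
  shows "AE x in \<gamma>. blinfun_apply l x = 0" "R_map \<gamma> l = 0"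
proof -
  show "AE x in \<gamma>. blinfun_apply l x = 0"
    using assms integral_nonneg_eq_0_iff_AE[OF gaussian_square_integrable[of l]] by simp
  show "R_map \<gamma> l = 0" using norm_R_map[OF blinfun_L2, of l] assms by simp
qed

lemma normalize_functional:
  assumes "(LINT x|\<gamma>. (blinfun_apply l x)\<^sup>2) \<noteq> 0"
  obtains s e where "0 < s" "l = s *\<^sub>R e" "(LINT x|\<gamma>. (blinfun_apply e x)\<^sup>2) = 1"
    "R_map \<gamma> l = s *\<^sub>R R_map \<gamma> e"
proof -
  define v where "v = (LINT x|\<gamma>. (blinfun_apply l x)\<^sup>2)"
  have "0 \<le> v" by (simp add: v_def)
  then have v: "0 < v" using assms by (simp add: v_def less_le)
  define e where "e = (1 / sqrt v) *\<^sub>R l"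
  have l: "l = sqrt v *\<^sub>R e" using v by (simp add: e_def)
  show thesis
  proof (rule that[of "sqrt v" e])
    show "(LINT x|\<gamma>. (blinfun_apply e x)\<^sup>2) = 1"
      using v by (simp add: e_def blinfun.scaleR_left power_mult_distrib power_divide v_def[symmetric])
    have "R_map \<gamma> l = (LINT x|\<gamma>. sqrt v *\<^sub>R (e x *\<^sub>R x))"
      by (subst l) (simp add: R_map_def blinfun.scaleR_left)
    then show "R_map \<gamma> l = sqrt v *\<^sub>R R_map \<gamma> e"
      by (simp only: integral_scaleR_right R_map_def)
  qed (use v l in auto)
qed

text \<open>A measurable set meeting each line parallel to a Cameron--Martin direction in at most one
  point is null, since the normal law along the line has no atoms.\<close>

lemma thin_along_direction_null:
  assumes A[measurable]: "A \<in> sets borel"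
    and thin: "\<And>x t. x \<in> A \<Longrightarrow> 0 < t \<Longrightarrow> x + t *\<^sub>R R_map \<gamma> (blinfun_apply l) \<notin> A"
    and l: "(LINT x|\<gamma>. (blinfun_apply l x)\<^sup>2) \<noteq> 0"
  shows "emeasure \<gamma> A = 0"
proof -
  interpret N: prob_space std_normal_distribution by (rule prob_space_normal_density) simp
  interpret P: pair_prob_space std_normal_distribution \<gamma> ..
  obtain s e where s: "0 < s" "(LINT x|\<gamma>. (blinfun_apply e x)\<^sup>2) = 1" "R_map \<gamma> l = s *\<^sub>R R_map \<gamma> e"
    using l by (rule normalize_functional) (rule that)
  define T where "T p = snd p - e (snd p) *\<^sub>R R_map \<gamma> e + fst p *\<^sub>R R_map \<gamma> e" for p
  note T = gaussian_split_borel[OF s(2), folded T_def]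
  note [measurable] = T(1)
  have TA: "T -` A \<inter> space (std_normal_distribution \<Otimes>\<^sub>M \<gamma>) \<in> sets (std_normal_distribution \<Otimes>\<^sub>M \<gamma>)"
    by measurable
  have one: "t = t'" if "T (t, x) \<in> A" "T (t', x) \<in> A" for t t' x
  proof (rule ccontr)
    have *: False if "u < u'" "T (u, x) \<in> A" "T (u', x) \<in> A" for u u'
    proof -
      have "((u' - u) / s) *\<^sub>R R_map \<gamma> l = (u' - u) *\<^sub>R R_map \<gamma> e"
        using s(1) by (simp add: s(3))
      then have "T (u', x) = T (u, x) + ((u' - u) / s) *\<^sub>R R_map \<gamma> l"
        by (simp add: T_def algebra_simps)
      then show False using thin[OF that(2), of "(u' - u) / s"] that s(1) by simp
    qed
    assume "t \<noteq> t'"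
    then show False using *[of t t'] *[of t' t] that by linarith
  qed
  have "emeasure std_normal_distribution ((\<lambda>t. (t, x)) -` (T -` A \<inter> space (std_normal_distribution \<Otimes>\<^sub>M \<gamma>))) = 0" for x
  proof -
    let ?B = "(\<lambda>t. (t, x)) -` (T -` A \<inter> space (std_normal_distribution \<Otimes>\<^sub>M \<gamma>))"
    have "\<exists>t. ?B \<subseteq> {t}" using one by blast
    then obtain t where "?B \<subseteq> {t}" by blast
    then have "emeasure std_normal_distribution ?B \<le> emeasure std_normal_distribution {t}"
      by (rule emeasure_mono) simp
    also have "\<dots> = 0"
      by (subst emeasure_density) (auto simp: nn_integral_0_iff_AE intro!: AE_I[where N = "{t}"])
    finally show ?thesis by simp
  qed
  then have "emeasure (std_normal_distribution \<Otimes>\<^sub>M \<gamma>) (T -` A \<inter> space (std_normal_distribution \<Otimes>\<^sub>M \<gamma>)) = 0"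
    by (subst P.emeasure_pair_measure_alt2[OF TA]) simp
  then have "emeasure (distr (std_normal_distribution \<Otimes>\<^sub>M \<gamma>) borel T) A = 0"
    by (subst emeasure_distr) auto
  then show ?thesis using T(2) by simp
qed

end

section \<open>Null boundaries of convex sets\<close>

text \<open>Replacing \<open>x\<close> by a nearby point of \<open>C\<close> can be compensated by moving \<open>p\<close> within \<open>C\<close>.\<close>

lemma open_convex_segment:
  fixes C :: "'a::real_normed_vector set"
  assumes C: "convex C" "open C" and x: "x \<in> closure C" and p: "p \<in> C" and u: "0 < u" "u < 1"
  shows "(1 - u) *\<^sub>R x + u *\<^sub>R p \<in> C"
proof -
  obtain d where d: "0 < d" "ball p d \<subseteq> C" using C p by (auto simp: open_contains_ball)
  obtain c where c: "c \<in> C" "dist c x < d * u / (1 - u)"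
    using x d u unfolding closure_approachable by (metis diff_gt_0_iff_gt divide_pos_pos mult_pos_pos)
  define p' where "p' = p + ((1 - u) / u) *\<^sub>R (x - c)"
  have "dist p p' = ((1 - u) / u) * dist c x"
    using u by (simp add: p'_def dist_norm norm_minus_commute)
  also have "\<dots> < ((1 - u) / u) * (d * u / (1 - u))"
    using c u by (intro mult_strict_left_mono) auto
  also have "\<dots> = d" using u by (simp add: field_simps)
  finally have "p' \<in> C" using d by auto
  have "u *\<^sub>R p' = u *\<^sub>R p + (1 - u) *\<^sub>R (x - c)"
    using u by (simp add: p'_def scaleR_right_distrib)
  then have "(1 - u) *\<^sub>R x + u *\<^sub>R p = (1 - u) *\<^sub>R c + u *\<^sub>R p'"
    by (simp add: algebra_simps)
  also have "\<dots> \<in> C" using C(1) c(1) \<open>p' \<in> C\<close> u by (intro convexD) auto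
  finally show ?thesis .
qed

locale wiener_measure = gaussian_measure +
  assumes nondeg: "nondegenerate \<gamma>"
begin

text \<open>Otherwise some nonzero functional \<open>l\<close> vanishes on the range of \<open>R_map\<close>, in particular at
  \<open>R_map \<gamma> l\<close>, where its value is its own variance.\<close>

lemma R_map_dense: "closure (range (\<lambda>l :: 'a \<Rightarrow>\<^sub>L real. R_map \<gamma> l)) = UNIV"
proof (rule ccontr)
  let ?S = "range (\<lambda>l :: 'a \<Rightarrow>\<^sub>L real. R_map \<gamma> l)"
  assume "closure ?S \<noteq> UNIV"
  then obtain y where y: "y \<notin> closure ?S" by auto
  then obtain d where d: "0 < d" "\<And>z. z \<in> ?S \<Longrightarrow> d \<le> dist z y"
    unfolding closure_approachable by (auto simp: not_less)
  define C where "C = (\<Union>a\<in>?S. \<Union>b\<in>ball 0 (d / 2). {a + b})"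
  have lin: "s *\<^sub>R R_map \<gamma> l + t *\<^sub>R R_map \<gamma> k \<in> ?S" for s t :: real and l k :: "'a \<Rightarrow>\<^sub>L real"
  proof -
    have "R_map \<gamma> (s *\<^sub>R l + t *\<^sub>R k) = (LINT x|\<gamma>. s *\<^sub>R (l x *\<^sub>R x) + t *\<^sub>R (k x *\<^sub>R x))"
      by (simp add: R_map_def blinfun.add_left blinfun.scaleR_left scaleR_add_left)
    also have "\<dots> = s *\<^sub>R R_map \<gamma> l + t *\<^sub>R R_map \<gamma> k"
      by (simp only: Bochner_Integration.integral_add integrable_scaleR_right R_integrable[OF blinfun_L2]
          integral_scaleR_right R_map_def)
    finally show ?thesis by (metis rangeI)
  qed
  have "convex ?S" unfolding convex_def using lin by blast
  then have C: "convex C" unfolding C_def by (intro convex_sums) auto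
  have zS: "0 \<in> ?S" using lin[of 0 0 0 0] by simp
  have ball: "ball 0 (d / 2) \<subseteq> C" unfolding C_def using zS by force
  have "y \<notin> closure C"
  proof
    assume "y \<in> closure C"
    then obtain z where z: "z \<in> C" "dist z y < d / 2" 
      using half_gt_zero[OF d(1)] unfolding closure_approachable by blast
    then obtain a b where ab: "a \<in> ?S" "b \<in> ball 0 (d / 2)" "z = a + b"
      unfolding C_def by blast
    have "dist a y \<le> dist a z + dist z y" by (rule dist_triangle)
    also have "\<dots> < d" using ab z by (simp add: dist_norm)
    finally show False using d(2)[OF ab(1)] by simp
  qed
  then obtain l :: "'a \<Rightarrow>\<^sub>L real" where l: "\<And>x. x \<in> C \<Longrightarrow> l (x - 0) \<le> 1" "1 < l (y - 0)"
    by (rule separate_point_from_convex[OF C _ ball, rotated]) (use d in \<open>auto intro: that\<close>)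
  have "l (R_map \<gamma> l) = 0"
  proof -
    have "t * l (R_map \<gamma> l) \<le> 1" for t
    proof -
      have "t *\<^sub>R R_map \<gamma> l \<in> ?S" using lin[of t l 0 l] by simp
      then have "t *\<^sub>R R_map \<gamma> l \<in> C" 
        unfolding C_def by (intro UN_I[of "t *\<^sub>R R_map \<gamma> l"] UN_I[of 0]) (use d(1) in auto)
      then show ?thesis using l(1)[of "t *\<^sub>R R_map \<gamma> l"] by (simp add: blinfun.scaleR_right)
    qed
    from this[of "2 / l (R_map \<gamma> l)"] show ?thesis by (cases "l (R_map \<gamma> l) = 0") auto
  qed
  then have "(LINT x|\<gamma>. (l x)\<^sup>2) = 0"
    using blinfun_R_map[OF blinfun_L2, of l l] by (simp add: power2_eq_square)
  then have "l = 0" using nondeg unfolding nondegenerate_def by force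
  then show False using l(2) by simp
qed

text \<open>From a boundary point the set is entered in some direction \<open>h\<close> of the dense range of \<open>R_map\<close>. A
  line parallel to \<open>h\<close> contains at most one boundary point \<open>x\<close> with \<open>x + h \<in> C\<close>: a second one,
  \<open>x + t *\<^sub>R h\<close> with \<open>0 < t\<close>, would lie strictly between \<open>x\<close> and \<open>x + t *\<^sub>R h + h\<close>, hence in \<open>C\<close>. By
  the Lindeloef property countably many \<open>h\<close> suffice.\<close>

theorem frontier_convex_null:
  assumes C: "open C" "convex C"
  shows "emeasure \<gamma> (frontier C) = 0"
proof (cases "C = {}")
  case False
  then obtain p where p: "p \<in> C" by auto
  define U where "U l = {x. x + R_map \<gamma> (blinfun_apply l) \<in> C}" for l
  have Uo: "open (U l)" for l
  proof -
    have "open ((\<lambda>x. x + R_map \<gamma> (blinfun_apply l)) -` C)"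
      by (intro open_vimage C continuous_intros)
    then show ?thesis by (simp add: U_def vimage_def)
  qed
  have cover: "\<exists>l. x \<in> U l" for x
  proof -
    obtain d where d: "0 < d" "ball p d \<subseteq> C" using C p by (auto simp: open_contains_ball)
    have "p - x \<in> closure (range (\<lambda>l :: 'a \<Rightarrow>\<^sub>L real. R_map \<gamma> l))" using R_map_dense by simp
    then obtain l :: "'a \<Rightarrow>\<^sub>L real" where "dist (R_map \<gamma> l) (p - x) < d"
      using d(1) unfolding closure_approachable by blast
    then have "x + R_map \<gamma> l \<in> ball p d"
      by (simp add: dist_norm norm_minus_commute algebra_simps)
    then show ?thesis using d(2) by (auto simp: U_def)
  qed
  have null: "emeasure \<gamma> (frontier C \<inter> U l) = 0" for l
  proof (cases "(LINT x|\<gamma>. (blinfun_apply l x)\<^sup>2) = 0")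
    case True
    then have "U l = C" by (simp add: U_def zero_variance)
    then have "frontier C \<inter> U l = {}" using C by (auto simp: frontier_def interior_open)
    then show ?thesis by simp
  next
    case l: False
    show ?thesis
    proof (rule thin_along_direction_null[OF _ _ l])
      show "frontier C \<inter> U l \<in> sets borel"
        using Uo[of l] by (intro sets.Int borel_closed borel_open) auto
      fix x and t :: real assume x: "x \<in> frontier C \<inter> U l" and t: "0 < t"
      let ?h = "R_map \<gamma> (blinfun_apply l)"
      show "x + t *\<^sub>R ?h \<notin> frontier C \<inter> U l"
      proof
        assume y: "x + t *\<^sub>R ?h \<in> frontier C \<inter> U l"
        define u where "u = t / (t + 1)"
        have u: "0 < u" "u < 1" "u * (t + 1) = t" using t by (auto simp: u_def)
        have "(1 - u) *\<^sub>R x + u *\<^sub>R (x + t *\<^sub>R ?h + ?h) \<in> C"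
          using x y u by (intro open_convex_segment C) (auto simp: frontier_def U_def)
        also have "(1 - u) *\<^sub>R x + u *\<^sub>R (x + t *\<^sub>R ?h + ?h) = x + (u * (t + 1)) *\<^sub>R ?h"
          by (simp add: algebra_simps)
        finally have "x + t *\<^sub>R ?h \<in> C" unfolding u(3) .
        then show False using y C by (auto simp: frontier_def interior_open)
      qed
    qed
  qed
  have "\<And>B. B \<in> range U \<Longrightarrow> open B" using Uo by auto
  from Lindelof[OF this] obtain F where F: "F \<subseteq> range U" "countable F" "\<Union>F = \<Union>(range U)" by blast
  have "(\<Union>B\<in>F. frontier C \<inter> B) \<in> null_sets \<gamma>"
    using F(1,2) null Uo by (intro null_sets_UN') (auto intro!: null_setsI sets.Int borel_closed borel_open)
  moreover have "frontier C = (\<Union>B\<in>F. frontier C \<inter> B)" using F(3) cover by auto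
  ultimately show ?thesis by auto
qed simp

end

section \<open>Functions with bounded gradient\<close>

text \<open>Bounded \<open>C\<^sup>1\<close> functions with bounded derivative. Differentiability is required along lines, as
  this is what integration by parts uses, and continuity of the gradient in the dual norm makes
  the derivative along each line continuous.\<close>

definition has_gradient :: "('a::real_normed_vector \<Rightarrow> real) \<Rightarrow> ('a \<Rightarrow> 'a \<Rightarrow>\<^sub>L real) \<Rightarrow> bool" where
  "has_gradient f G \<longleftrightarrow> continuous_on UNIV f \<and> bounded (range f) \<and>
     continuous_on UNIV G \<and> bounded (range G) \<and>
     (\<forall>x h. ((\<lambda>t. f (x + t *\<^sub>R h)) has_real_derivative blinfun_apply (G x) h) (at 0))"

lemma has_gradient_line:
  assumes "has_gradient f G"
  shows "((\<lambda>t. f (x + t *\<^sub>R h)) has_real_derivative blinfun_apply (G (x + s *\<^sub>R h)) h) (at s)"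
proof -
  have "((\<lambda>t. f ((x + s *\<^sub>R h) + t *\<^sub>R h)) has_real_derivative blinfun_apply (G (x + s *\<^sub>R h)) h) (at 0)"
    using assms by (simp add: has_gradient_def)
  then have "((\<lambda>t. f (x + (t + s) *\<^sub>R h)) has_real_derivative blinfun_apply (G (x + s *\<^sub>R h)) h) (at 0)"
    by (simp add: algebra_simps)
  then show ?thesis
    using DERIV_shift[of "\<lambda>t. f (x + t *\<^sub>R h)" "blinfun_apply (G (x + s *\<^sub>R h)) h" 0 s] by simp
qed

lemma has_gradient_bounds:
  assumes "has_gradient f G"
  obtains B where "0 \<le> B" "\<And>x. \<bar>f x\<bar> \<le> B" "\<And>x h. \<bar>blinfun_apply (G x) h\<bar> \<le> B * norm h"
proof -
  obtain B1 B2 where B: "\<And>x. \<bar>f x\<bar> \<le> B1" "\<And>x. norm (G x) \<le> B2"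
    using assms by (auto simp: has_gradient_def bounded_iff)
  show thesis
  proof (rule that[of "max B1 B2"])
    show "0 \<le> max B1 B2" using B(2)[of 0] norm_ge_zero[of "G 0"] by linarith
    show "\<bar>f x\<bar> \<le> max B1 B2" for x using B(1)[of x] by simp
    show "\<bar>blinfun_apply (G x) h\<bar> \<le> max B1 B2 * norm h" for x h
    proof -
      have "\<bar>blinfun_apply (G x) h\<bar> \<le> norm (G x) * norm h" using norm_blinfun[of "G x" h] by simp
      also have "\<dots> \<le> max B1 B2 * norm h" using B(2)[of x] by (intro mult_right_mono) auto
      finally show ?thesis .
    qed
  qed
qed

lemma has_gradient_measurable:
  assumes "has_gradient f G"
  shows "f \<in> borel_measurable borel" "(\<lambda>x. blinfun_apply (G x) h) \<in> borel_measurable borel"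
  using assms by (auto simp: has_gradient_def intro!: borel_measurable_continuous_onI continuous_intros)

lemma has_gradient_mult:
  assumes f: "has_gradient f F" and g: "has_gradient g G"
  shows "has_gradient (\<lambda>x. f x * g x) (\<lambda>x. f x *\<^sub>R G x + g x *\<^sub>R F x)"
  unfolding has_gradient_def
proof (intro conjI allI)
  obtain A where A: "0 \<le> A" "\<And>x. \<bar>f x\<bar> \<le> A" "\<And>x h. \<bar>blinfun_apply (F x) h\<bar> \<le> A * norm h"
    by (rule has_gradient_bounds[OF f]) (rule that)
  obtain B where B: "0 \<le> B" "\<And>x. \<bar>g x\<bar> \<le> B" "\<And>x h. \<bar>blinfun_apply (G x) h\<bar> \<le> B * norm h"
    by (rule has_gradient_bounds[OF g]) (rule that)
  show "continuous_on UNIV (\<lambda>x. f x * g x)" "continuous_on UNIV (\<lambda>x. f x *\<^sub>R G x + g x *\<^sub>R F x)"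
    using f g by (auto simp: has_gradient_def intro!: continuous_intros)
  have "\<bar>f x * g x\<bar> \<le> A * B" for x
    unfolding abs_mult by (intro mult_mono A B) auto
  then show "bounded (range (\<lambda>x. f x * g x))" by (auto simp: bounded_iff)
  have "norm (f x *\<^sub>R G x + g x *\<^sub>R F x) \<le> A * B + B * A" for x
  proof -
    have n: "norm (G x) \<le> B" "norm (F x) \<le> A"
      using A B by (auto intro!: norm_blinfun_bound)
    have "norm (f x *\<^sub>R G x + g x *\<^sub>R F x) \<le> \<bar>f x\<bar> * norm (G x) + \<bar>g x\<bar> * norm (F x)"
      using norm_triangle_ineq[of "f x *\<^sub>R G x" "g x *\<^sub>R F x"] by simp
    also have "\<dots> \<le> A * B + B * A"
      using n A B by (intro add_mono mult_mono) auto
    finally show ?thesis .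
  qed
  then show "bounded (range (\<lambda>x. f x *\<^sub>R G x + g x *\<^sub>R F x))" by (auto simp: bounded_iff)
  fix x h
  have "((\<lambda>t. f (x + t *\<^sub>R h)) has_real_derivative blinfun_apply (F x) h) (at 0)"
    "((\<lambda>t. g (x + t *\<^sub>R h)) has_real_derivative blinfun_apply (G x) h) (at 0)"
    using f g by (auto simp: has_gradient_def)
  from DERIV_mult[OF this]
  show "((\<lambda>t. f (x + t *\<^sub>R h) * g (x + t *\<^sub>R h)) has_real_derivative
    blinfun_apply (f x *\<^sub>R G x + g x *\<^sub>R F x) h) (at 0)"
    by (simp add: blinfun.add_left blinfun.scaleR_left algebra_simps)
qed

lemma mean_value_from_0:
  fixes \<psi> \<psi>' :: "real \<Rightarrow> real"
  assumes "\<And>s. (\<psi> has_real_derivative \<psi>' s) (at s)"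
  obtains s where "\<bar>s\<bar> \<le> \<bar>a\<bar>" "\<psi> a - \<psi> 0 = a * \<psi>' s"
proof -
  consider "a = 0" | "0 < a" | "a < 0" by linarith
  then show thesis
  proof cases
    case 1
    then show ?thesis by (intro that[of 0]) auto
  next
    case 2
    then obtain s where "0 < s" "s < a" "\<psi> a - \<psi> 0 = (a - 0) * \<psi>' s"
      using MVT2[of 0 a \<psi> \<psi>'] assms by blast
    then show ?thesis by (intro that[of s]) auto
  next
    case 3
    then obtain s where "a < s" "s < 0" "\<psi> 0 - \<psi> a = (0 - a) * \<psi>' s"
      using MVT2[of a 0 \<psi> \<psi>'] assms by blast
    then show ?thesis by (intro that[of s]) (auto simp: algebra_simps)
  qed
qed

text \<open>Chain rule for a function with continuous partial derivatives on \<open>Rn m\<close>: move from \<open>u\<close> to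
  \<open>u + t * b\<close> one coordinate at a time and apply the mean value theorem on each piece.\<close>

lemma C1_chain_rule:
  fixes \<phi> :: "(nat \<Rightarrow> real) \<Rightarrow> real"
  assumes Dc: "\<And>i. i < m \<Longrightarrow> continuous_on (Rn m) (D i)"
    and D: "\<And>i u. i < m \<Longrightarrow> u \<in> Rn m \<Longrightarrow> ((\<lambda>t. \<phi> (u(i := t))) has_real_derivative D i u) (at (u i))"
    and u: "u \<in> Rn m"
  shows "((\<lambda>t. \<phi> (\<lambda>i\<in>{..<m}. u i + t * b i)) has_real_derivative (\<Sum>i<m. b i * D i u)) (at 0)"
proof -
  \<comment> \<open>The first \<open>k\<close> coordinates have been moved by \<open>fst p\<close> times \<open>b\<close>, coordinate \<open>k\<close> by \<open>snd p\<close>.\<close>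
  define Z where "Z k p = (\<lambda>i\<in>{..<m}. if i < k then u i + fst p * b i else if i = k then u i + snd p else u i)"
    for k and p :: "real \<times> real"
  have ZR: "Z k p \<in> Rn m" for k p by (auto simp: Z_def Rn_def)
  have Zc: "continuous_on UNIV (Z k)" for k
  proof (rule continuous_on_coordinatewise_then_product)
    fix i
    show "continuous_on UNIV (\<lambda>p. Z k p i)"
      unfolding Z_def restrict_def
      by (cases "i < m"; cases "i < k"; cases "i = k") (auto intro!: continuous_intros)
  qed
  have ext: "u i = undefined" if "\<not> i < m" for i
    using u that by (auto simp: Rn_def PiE_def extensional_def)
  have Z0: "Z k (0, 0) = u" for k
    by (auto simp: Z_def fun_eq_iff ext)
  have Zder: "((\<lambda>s. \<phi> (Z k (t, s))) has_real_derivative D k (Z k (t, s))) (at s)" if k: "k < m" for k t s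
  proof -
    have e: "(Z k (t, s))(k := r + u k) = Z k (t, r)" "Z k (t, s) k = u k + s" for r
      using k by (auto simp: Z_def fun_eq_iff)
    have "((\<lambda>r. \<phi> ((Z k (t, s))(k := r))) has_real_derivative D k (Z k (t, s))) (at (s + u k))"
      using D[OF k ZR[of k "(t, s)"]] unfolding e(2) by (simp only: add.commute)
    then have "((\<lambda>r. \<phi> ((Z k (t, s))(k := r + u k))) has_real_derivative D k (Z k (t, s))) (at s)"
      unfolding DERIV_shift .
    then show ?thesis unfolding e .
  qed
  have "\<exists>s. \<bar>s\<bar> \<le> \<bar>t * b k\<bar> \<and> \<phi> (Z k (t, t * b k)) - \<phi> (Z k (t, 0)) = t * b k * D k (Z k (t, s))"
    if k: "k < m" for k t
    using mean_value_from_0[of "\<lambda>s. \<phi> (Z k (t, s))" "\<lambda>s. D k (Z k (t, s))" "t * b k", OF Zder[OF k]] by blast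
  then obtain s where s: "\<And>k t. k < m \<Longrightarrow> \<bar>s k t\<bar> \<le> \<bar>t * b k\<bar>"
    "\<And>k t. k < m \<Longrightarrow> \<phi> (Z k (t, t * b k)) - \<phi> (Z k (t, 0)) = t * b k * D k (Z k (t, s k t))"
    by metis
  have lim: "((\<lambda>t. b k * D k (Z k (t, s k t))) \<longlongrightarrow> b k * D k u) (at 0)" if k: "k < m" for k
  proof -
    have "continuous_on UNIV (\<lambda>p. D k (Z k p))"
      by (rule continuous_on_compose2[OF Dc[OF k] Zc]) (use ZR in auto)
    then have "((\<lambda>p. D k (Z k p)) \<longlongrightarrow> D k (Z k (0, 0))) (nhds (0, 0))"
      by (simp add: continuous_on_eq_continuous_at isCont_def tendsto_nhds_iff)
    moreover have "((\<lambda>t. s k t) \<longlongrightarrow> 0) (at 0)"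
    proof (rule Lim_null_comparison)
      show "\<forall>\<^sub>F t in at 0. norm (s k t) \<le> \<bar>t * b k\<bar>"
        using s(1)[OF k] by (intro always_eventually allI) simp
      show "((\<lambda>t. \<bar>t * b k\<bar>) \<longlongrightarrow> 0) (at 0)"
        by (rule tendsto_eq_intros refl | simp)+
    qed
    then have "((\<lambda>t. (t, s k t)) \<longlongrightarrow> (0, 0)) (at 0)"
      by (intro tendsto_Pair tendsto_ident_at)
    ultimately have "((\<lambda>t. D k (Z k (t, s k t))) \<longlongrightarrow> D k (Z k (0, 0))) (at 0)"
      by (rule filterlim_compose)
    then show ?thesis unfolding Z0 by (rule tendsto_mult_left)
  qed
  have step: "Z k (t, t * b k) = Z (Suc k) (t, 0)" for k t
    by (auto simp: Z_def fun_eq_iff less_Suc_eq)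
  have "\<phi> (\<lambda>i\<in>{..<m}. u i + t * b i) - \<phi> u = (\<Sum>k<m. t * b k * D k (Z k (t, s k t)))" for t
  proof -
    have "(\<lambda>i\<in>{..<m}. u i + t * b i) = Z m (t, 0)" "u = Z 0 (t, 0)"
      by (auto simp: Z_def fun_eq_iff ext)
    then have "\<phi> (\<lambda>i\<in>{..<m}. u i + t * b i) - \<phi> u = \<phi> (Z m (t, 0)) - \<phi> (Z 0 (t, 0))" by simp
    also have "\<dots> = (\<Sum>k<m. \<phi> (Z (Suc k) (t, 0)) - \<phi> (Z k (t, 0)))"
      by (rule sum_lessThan_telescope[symmetric])
    also have "\<dots> = (\<Sum>k<m. t * b k * D k (Z k (t, s k t)))"
      by (intro sum.cong refl) (simp add: s(2) step[symmetric])
    finally show ?thesis .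
  qed
  then have "(\<phi> (\<lambda>i\<in>{..<m}. u i + t * b i) - \<phi> u) / t = (\<Sum>k<m. b k * D k (Z k (t, s k t)))"
    if "t \<noteq> 0" for t
    using that by (simp add: sum_divide_distrib)
  then have ev: "\<forall>\<^sub>F t in at 0. (\<Sum>k<m. b k * D k (Z k (t, s k t))) = (\<phi> (\<lambda>i\<in>{..<m}. u i + t * b i) - \<phi> u) / t"
    by (auto simp: eventually_at_filter)
  have "((\<lambda>t. \<Sum>k<m. b k * D k (Z k (t, s k t))) \<longlongrightarrow> (\<Sum>k<m. b k * D k u)) (at 0)"
    by (intro tendsto_sum lim) simp
  then have "((\<lambda>t. (\<phi> (\<lambda>i\<in>{..<m}. u i + t * b i) - \<phi> u) / t) \<longlongrightarrow> (\<Sum>k<m. b k * D k u)) (at 0)"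
    by (rule Lim_transform_eventually[OF _ ev])
  moreover have "(\<lambda>i\<in>{..<m}. u i + 0 * b i) = u"
    by (auto simp: fun_eq_iff ext)
  ultimately show ?thesis by (simp add: DERIV_def)
qed

text \<open>The gradient is the sum of the partial derivatives times the functionals; the rest of the argument
  uses nothing else about cylinder functions.\<close>

lemma FC1b_has_gradient:
  fixes f :: "'a::real_normed_vector \<Rightarrow> real"
  assumes "f \<in> FC1b"
  obtains G where "has_gradient f G"
proof -
  obtain m and l :: "nat \<Rightarrow> 'a \<Rightarrow>\<^sub>L real" and \<phi> where \<phi>: "\<phi> \<in> C1b m"
    and f: "f = (\<lambda>x. \<phi> (\<lambda>i\<in>{..<m}. blinfun_apply (l i) x))"
    using assms unfolding FC1b_def by blast
  define L where "L x = (\<lambda>i\<in>{..<m}. blinfun_apply (l i) x)" for x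
  have LR: "L x \<in> Rn m" for x by (auto simp: L_def Rn_def)
  have Lc: "continuous_on UNIV L"
  proof (rule continuous_on_coordinatewise_then_product)
    fix i show "continuous_on UNIV (\<lambda>x. L x i)"
      unfolding L_def restrict_def by (cases "i < m") (auto intro!: continuous_intros)
  qed
  have "\<forall>i. \<exists>Di. i < m \<longrightarrow> continuous_on (Rn m) Di \<and> bounded (Di ` Rn m) \<and>
    (\<forall>u\<in>Rn m. ((\<lambda>t. \<phi> (u(i := t))) has_real_derivative Di u) (at (u i)))"
    using \<phi> unfolding C1b_def by blast
  then obtain D where D: "\<And>i. i < m \<Longrightarrow> continuous_on (Rn m) (D i)"
    "\<And>i. i < m \<Longrightarrow> bounded (D i ` Rn m)"
    "\<And>i u. i < m \<Longrightarrow> u \<in> Rn m \<Longrightarrow> ((\<lambda>t. \<phi> (u(i := t))) has_real_derivative D i u) (at (u i))"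
    by metis
  have "\<forall>i. \<exists>B. i < m \<longrightarrow> (\<forall>u\<in>Rn m. \<bar>D i u\<bar> \<le> B)"
    using D(2) by (auto simp: bounded_iff)
  then obtain B where B: "\<And>i u. i < m \<Longrightarrow> u \<in> Rn m \<Longrightarrow> \<bar>D i u\<bar> \<le> B i" by metis
  define G where "G x = (\<Sum>i<m. D i (L x) *\<^sub>R l i)" for x
  have "has_gradient f G"
    unfolding has_gradient_def
  proof (intro conjI allI)
    have "continuous_on (Rn m) \<phi>" "bounded (\<phi> ` Rn m)" using \<phi> by (auto simp: C1b_def)
    then show "continuous_on UNIV f" "bounded (range f)"
      unfolding f L_def[symmetric] using LR continuous_on_compose2[OF _ Lc, of "Rn m" \<phi>]
      by (auto intro: bounded_subset)
    have "continuous_on UNIV (\<lambda>x. D i (L x))" if "i < m" for i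
      by (rule continuous_on_compose2[OF D(1)[OF that] Lc]) (use LR in auto)
    then show "continuous_on UNIV G" unfolding G_def by (intro continuous_intros) auto
    have "norm (G x) \<le> (\<Sum>i<m. B i * norm (l i))" for x
      unfolding G_def using B LR by (intro order_trans[OF norm_sum] sum_mono) (auto intro!: mult_right_mono)
    then show "bounded (range G)" by (auto simp: bounded_iff)
    fix x h
    have "((\<lambda>t. \<phi> (\<lambda>i\<in>{..<m}. L x i + t * l i h)) has_real_derivative (\<Sum>i<m. l i h * D i (L x))) (at 0)"
      by (rule C1_chain_rule[OF D(1) D(3) LR])
    moreover have "(\<lambda>i\<in>{..<m}. L x i + t * l i h) = L (x + t *\<^sub>R h)" for t
      by (auto simp: L_def blinfun.add_right blinfun.scaleR_right)
    moreover have "(\<Sum>i<m. l i h * D i (L x)) = blinfun_apply (G x) h"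
      by (simp add: G_def blinfun.sum_left blinfun.scaleR_left mult.commute)
    ultimately show "((\<lambda>t. f (x + t *\<^sub>R h)) has_real_derivative blinfun_apply (G x) h) (at 0)"
      by (simp add: f L_def[symmetric])
  qed
  then show thesis by (rule that)
qed

section \<open>Gaussian integration by parts\<close>

lemma std_normal_density_tendsto_0:
  "(std_normal_density \<longlongrightarrow> 0) at_top" "(std_normal_density \<longlongrightarrow> 0) at_bot"
proof -
  have "filterlim (\<lambda>t::real. t\<^sup>2 * (1 / 2)) at_top at_top"
    by (intro filterlim_at_top_mult_tendsto_pos[OF tendsto_const] filterlim_pow_at_top filterlim_ident) auto
  then have "filterlim (\<lambda>t::real. - (t\<^sup>2 * (1 / 2))) at_bot at_top"
    by (simp add: filterlim_uminus_at_bot)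
  then have "((\<lambda>t::real. exp (- (t\<^sup>2 * (1 / 2)))) \<longlongrightarrow> 0) at_top"
    by (rule filterlim_compose[OF exp_at_bot])
  from tendsto_mult_right[OF this, of "1 / sqrt (2 * pi)"]
  show 1: "(std_normal_density \<longlongrightarrow> 0) at_top"
    by (simp add: std_normal_density_def[abs_def])
  have "(\<lambda>t. std_normal_density (- t)) = std_normal_density"
    by (simp add: std_normal_density_def[abs_def])
  then show "(std_normal_density \<longlongrightarrow> 0) at_bot"
    using 1 filterlim_at_bot_mirror[of std_normal_density] by simp
qed

lemma normal_integration_by_parts:
  fixes F F' :: "real \<Rightarrow> real"
  assumes F: "\<And>t. (F has_real_derivative F' t) (at t)" and F': "continuous_on UNIV F'"
    and B: "\<And>t. \<bar>F t\<bar> \<le> B" "\<And>t. \<bar>F' t\<bar> \<le> B'"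
  shows "(LINT t|std_normal_distribution. F' t - t * F t) = 0"
proof -
  let ?d = std_normal_density
  have Fc: "continuous_on UNIV F" using F by (meson DERIV_isCont continuous_at_imp_continuous_on)
  have [measurable]: "F \<in> borel_measurable borel" "F' \<in> borel_measurable borel"
    by (intro borel_measurable_continuous_onI Fc F')+
  have d: "(?d has_real_derivative - t * ?d t) (at t)" for t
  proof -
    have "((\<lambda>t. exp (- t\<^sup>2 / 2)) has_real_derivative exp (- t\<^sup>2 / 2) * - t) (at t)"
      by (auto intro!: derivative_eq_intros)
    from DERIV_cmult[OF this, of "1 / sqrt (2 * pi)"] show ?thesis
      by (simp add: std_normal_density_def[abs_def] mult_ac)
  qed
  have int: "integrable lborel (\<lambda>t. ?d t * (F' t - t * F t))"
  proof (rule Bochner_Integration.integrable_bound)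
    show "integrable lborel (\<lambda>t. B' * ?d t + B * (?d t * \<bar>t\<bar> ^ 1))"
      by (intro Bochner_Integration.integrable_add integrable_mult_right integrable_std_normal_moment_abs) auto
    have "\<bar>?d t * (F' t - t * F t)\<bar> \<le> \<bar>B' * ?d t + B * (?d t * \<bar>t\<bar> ^ 1)\<bar>" for t
    proof -
      have "\<bar>F' t - t * F t\<bar> \<le> \<bar>F' t\<bar> + \<bar>t\<bar> * \<bar>F t\<bar>"
        by (metis abs_mult abs_triangle_ineq4)
      also have "\<dots> \<le> B' + \<bar>t\<bar> * B" using B by (intro add_mono mult_left_mono) auto
      finally have le: "\<bar>F' t - t * F t\<bar> \<le> B' + \<bar>t\<bar> * B" .
      have "\<bar>?d t * (F' t - t * F t)\<bar> = ?d t * \<bar>F' t - t * F t\<bar>" by (simp add: abs_mult)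
      also have "\<dots> \<le> ?d t * (B' + \<bar>t\<bar> * B)" by (rule mult_left_mono[OF le]) simp
      also have "\<dots> = B' * ?d t + B * (?d t * \<bar>t\<bar> ^ 1)" by (simp add: algebra_simps)
      also have "\<dots> \<le> \<bar>B' * ?d t + B * (?d t * \<bar>t\<bar> ^ 1)\<bar>" by (rule abs_ge_self)
      finally show ?thesis .
    qed
    then show "AE t in lborel. norm (?d t * (F' t - t * F t)) \<le> norm (B' * ?d t + B * (?d t * \<bar>t\<bar> ^ 1))"
      by (intro AE_I2) simp
  qed measurable
  have lim: "((\<lambda>t. ?d t * F t) \<longlongrightarrow> 0) N" if "(?d \<longlongrightarrow> 0) N" for N
  proof (rule Lim_null_comparison)
    show "\<forall>\<^sub>F t in N. norm (?d t * F t) \<le> ?d t * B"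
      using B by (intro always_eventually allI) (auto simp: abs_mult intro!: mult_left_mono)
    show "((\<lambda>t. ?d t * B) \<longlongrightarrow> 0) N" by (rule tendsto_mult_left_zero[OF that])
  qed
  have "(LBINT t=-\<infinity>..\<infinity>. ?d t * (F' t - t * F t)) = 0 - 0"
  proof (rule interval_integral_FTC_integrable)
    fix t :: real
    have "((\<lambda>t. ?d t * F t) has_real_derivative ?d t * (F' t - t * F t)) (at t)"
      by (rule derivative_eq_intros d F | simp add: algebra_simps)+
    then show "((\<lambda>t. ?d t * F t) has_vector_derivative ?d t * (F' t - t * F t)) (at t)"
      by (simp add: has_real_derivative_iff_has_vector_derivative)
    show "isCont (\<lambda>t. ?d t * (F' t - t * F t)) t"
      using F' Fc d by (intro continuous_intros DERIV_isCont[OF d])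
        (auto simp: continuous_on_eq_continuous_at)
  qed (use int lim std_normal_density_tendsto_0 in
      \<open>auto simp: ereal_tendsto_simps set_integrable_def\<close>)
  then show ?thesis
    by (simp add: integral_density interval_lebesgue_integral_def set_lebesgue_integral_def)
qed

context gaussian_measure
begin

lemma has_gradient_random_variable:
  assumes "has_gradient g G"
  shows "g \<in> borel_measurable \<gamma>" "(\<lambda>x. blinfun_apply (G x) h) \<in> borel_measurable \<gamma>"
  using has_gradient_measurable[OF assms] by (simp_all add: measurable_cong_sets[OF gaussian_sets refl])

lemma has_gradient_L2:
  assumes "has_gradient g G"
  shows "g \<in> L2 \<gamma>" "(\<lambda>x. blinfun_apply (G x) h) \<in> L2 \<gamma>"
proof -
  obtain B where B: "0 \<le> B" "\<And>x. \<bar>g x\<bar> \<le> B" "\<And>x h. \<bar>blinfun_apply (G x) h\<bar> \<le> B * norm h"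
    by (rule has_gradient_bounds[OF assms]) (rule that)
  have one: "(\<lambda>x. 1) \<in> L2 \<gamma>" by (simp add: L2_def)
  show "g \<in> L2 \<gamma>" "(\<lambda>x. blinfun_apply (G x) h) \<in> L2 \<gamma>"
    using L2_mult_bounded[OF one, of g B] L2_mult_bounded[OF one, of "\<lambda>x. blinfun_apply (G x) h" "B * norm h"]
      B has_gradient_random_variable[OF assms] by auto
qed

text \<open>The splitting along \<open>R_map \<gamma> l\<close> reduces this to integration by parts for the normal law on each
  line, where \<open>l\<close> is the coordinate.\<close>

lemma integration_by_parts_dual:
  assumes g: "has_gradient g G"
  shows "(LINT x|\<gamma>. G x (R_map \<gamma> (blinfun_apply l)) - l x * g x) = 0"
proof (cases "(LINT x|\<gamma>. (blinfun_apply l x)\<^sup>2) = 0")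
  case True
  have "(LINT x|\<gamma>. G x (R_map \<gamma> (blinfun_apply l)) - l x * g x) = (LINT x|\<gamma>. 0)"
    using zero_variance[OF True] has_gradient_measurable[OF g]
    by (intro integral_cong_AE) (auto simp: blinfun.zero_right)
  then show ?thesis by simp
next
  case False
  interpret N: prob_space std_normal_distribution by (rule prob_space_normal_density) simp
  interpret P: pair_prob_space std_normal_distribution \<gamma> ..
  obtain B where B: "0 \<le> B" "\<And>x. \<bar>g x\<bar> \<le> B" "\<And>x h. \<bar>blinfun_apply (G x) h\<bar> \<le> B * norm h"
    by (rule has_gradient_bounds[OF g]) (rule that)
  obtain s e where s: "0 < s" "l = s *\<^sub>R e" "(LINT x|\<gamma>. (blinfun_apply e x)\<^sup>2) = 1"
    "R_map \<gamma> l = s *\<^sub>R R_map \<gamma> e"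
    using False by (rule normalize_functional) (rule that)
  define h where "h = R_map \<gamma> (blinfun_apply e)"
  define T where "T p = snd p - e (snd p) *\<^sub>R h + fst p *\<^sub>R h" for p
  note T = gaussian_split_borel[OF s(3), folded h_def, folded T_def]
  define v where "v x = G x h - e x * g x" for x
  have eh: "blinfun_apply e h = 1"
    unfolding h_def using blinfun_R_map[OF blinfun_L2, of e e] s(3) by (simp add: power2_eq_square)
  have vm[measurable]: "v \<in> borel_measurable borel"
    unfolding v_def using has_gradient_measurable[OF g] by (intro borel_measurable_diff borel_measurable_times) auto
  have vi: "integrable \<gamma> v"
    unfolding v_def using has_gradient_L2[OF g]
    by (intro Bochner_Integration.integrable_diff L2_mult_integrable[OF blinfun_L2]
        integrable_const_bound[of _ "B * norm h"])
      (auto simp: B has_gradient_random_variable[OF g])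
  have vT: "integrable (std_normal_distribution \<Otimes>\<^sub>M \<gamma>) (\<lambda>p. v (T p))"
    using vi integrable_distr[OF T(1), of v] T(2) by simp
  have line: "(LINT t|std_normal_distribution. v (T (t, x))) = 0" for x
  proof -
    define z where "z = x - e x *\<^sub>R h"
    have Tz: "T (t, x) = z + t *\<^sub>R h" for t by (simp add: T_def z_def)
    have ez: "blinfun_apply e (z + t *\<^sub>R h) = t" for t
      by (simp add: z_def blinfun.diff_right blinfun.add_right blinfun.scaleR_right eh)
    have c: "continuous_on UNIV (\<lambda>t. blinfun_apply (G (z + t *\<^sub>R h)) h)"
    proof -
      have "continuous_on UNIV G" using g by (simp add: has_gradient_def)
      then have "continuous_on UNIV (\<lambda>t. G (z + t *\<^sub>R h))"
        by (rule continuous_on_compose2) (auto intro!: continuous_intros)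
      then show ?thesis by (intro continuous_intros)
    qed
    show ?thesis
      unfolding Tz v_def ez
      by (rule normal_integration_by_parts[OF has_gradient_line[OF g] c B(2,3)])
  qed
  have "(LINT x|\<gamma>. v x) = (LINT x|distr (std_normal_distribution \<Otimes>\<^sub>M \<gamma>) borel T. v x)"
    using T(2) by simp
  also have "\<dots> = (LINT p|(std_normal_distribution \<Otimes>\<^sub>M \<gamma>). v (T p))"
    by (rule integral_distr[OF T(1) vm])
  also have "\<dots> = (LINT x|\<gamma>. (LINT t|std_normal_distribution. v (T (t, x))))"
    using P.integral_snd[of "\<lambda>t x. v (T (t, x))"] vT by (simp add: split_beta')
  also have "\<dots> = 0" by (simp add: line)
  finally have "(LINT x|\<gamma>. s * v x) = 0" by simp
  moreover have "s * v x = G x (R_map \<gamma> l) - l x * g x" for x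
    unfolding v_def s(4) h_def by (simp add: blinfun.scaleR_right right_diff_distrib s(2) blinfun.scaleR_left)
  ultimately show ?thesis by simp
qed

text \<open>Both sides are continuous in \<open>f\<close> for the \<open>L2\<close> norm, the left one by \<open>norm_R_map\<close>, so the identity
  passes from the dual to its closure.\<close>

lemma integration_by_parts:
  assumes g: "has_gradient g G" and f: "f \<in> dual_closure \<gamma>"
  shows "(LINT x|\<gamma>. G x (R_map \<gamma> f)) = (LINT x|\<gamma>. f x * g x)"
proof -
  obtain B where B: "0 \<le> B" "\<And>x. \<bar>g x\<bar> \<le> B" "\<And>x h. \<bar>blinfun_apply (G x) h\<bar> \<le> B * norm h"
    by (rule has_gradient_bounds[OF g]) (rule that)
  obtain l where "L2_tendsto \<gamma> (\<lambda>n. blinfun_apply (l n)) f"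
    using f by (rule dual_closureE)
  then have l: "(\<lambda>n. LINT x|\<gamma>. (blinfun_apply (l n) x - f x)\<^sup>2) \<longlonglongrightarrow> 0"
    by (simp add: L2_tendsto_def)
  note f2 = dual_closure_L2[OF f] and g2 = has_gradient_L2[OF g]
  have Gi: "integrable \<gamma> (\<lambda>x. blinfun_apply (G x) h)" for h
    by (rule integrable_const_bound[of _ "B * norm h"]) (auto simp: B has_gradient_random_variable[OF g])
  define d where "d n = sqrt (LINT x|\<gamma>. (blinfun_apply (l n) x - f x)\<^sup>2)" for n
  define K where "K = B * norm_bound + sqrt (LINT x|\<gamma>. (g x)\<^sup>2)"
  have "\<bar>(LINT x|\<gamma>. G x (R_map \<gamma> f)) - (LINT x|\<gamma>. f x * g x)\<bar> \<le> K * d n" for n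
  proof -
    have df: "(\<lambda>x. blinfun_apply (l n) x - f x) \<in> L2 \<gamma>" by (intro L2_diff blinfun_L2 f2)
    have "(LINT x|\<gamma>. G x (R_map \<gamma> (l n))) = (LINT x|\<gamma>. l n x * g x)"
      using integration_by_parts_dual[OF g, of "l n"] Gi L2_mult_integrable[OF blinfun_L2 g2(1), of "l n"] by simp
    then have "(LINT x|\<gamma>. G x (R_map \<gamma> f)) - (LINT x|\<gamma>. f x * g x)
      = (LINT x|\<gamma>. (l n x - f x) * g x) - (LINT x|\<gamma>. G x (R_map \<gamma> (\<lambda>x. l n x - f x)))"
      using Gi L2_mult_integrable[OF blinfun_L2 g2(1), of "l n"] L2_mult_integrable[OF f2 g2(1)]
      by (simp add: left_diff_distrib R_map_diff[OF blinfun_L2 f2] blinfun.diff_right)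
    moreover have "\<bar>LINT x|\<gamma>. (l n x - f x) * g x\<bar> \<le> d n * sqrt (LINT x|\<gamma>. (g x)\<^sup>2)"
      unfolding d_def by (rule Cauchy_Schwarz_L2[OF df g2(1)])
    moreover have "\<bar>LINT x|\<gamma>. G x (R_map \<gamma> (\<lambda>x. l n x - f x))\<bar> \<le> B * (norm_bound * d n)"
    proof -
      let ?h = "R_map \<gamma> (\<lambda>x. l n x - f x)"
      have "\<bar>LINT x|\<gamma>. G x ?h\<bar> \<le> (LINT x|\<gamma>. \<bar>blinfun_apply (G x) ?h\<bar>)"
        using integral_norm_bound[of \<gamma> "\<lambda>x. blinfun_apply (G x) ?h"] by simp
      also have "\<dots> \<le> (LINT x|\<gamma>. B * norm ?h)" using Gi B(3) by (intro integral_mono) auto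
      also have "\<dots> \<le> B * (norm_bound * d n)"
        using norm_R_map[OF df] B(1) by (auto simp: d_def intro!: mult_left_mono)
      finally show ?thesis .
    qed
    ultimately show ?thesis by (simp add: K_def algebra_simps abs_le_iff)
  qed
  moreover have "(\<lambda>n. K * d n) \<longlonglongrightarrow> K * sqrt 0"
    unfolding d_def by (intro tendsto_intros l)
  ultimately have "\<bar>(LINT x|\<gamma>. G x (R_map \<gamma> f)) - (LINT x|\<gamma>. f x * g x)\<bar> \<le> K * sqrt 0"
    by (intro LIMSEQ_le_const) auto
  then show ?thesis by simp
qed

end

section \<open>Orthonormal expansions in the Cameron--Martin space\<close>

context gaussian_measure
begin

lemma R_map_cameron_martin: "f \<in> dual_closure \<gamma> \<Longrightarrow> R_map \<gamma> f \<in> cameron_martin \<gamma>"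
  by (simp add: cameron_martin_def)

lemma cameron_martin_lincomb:
  assumes "finite I" "\<And>i. i \<in> I \<Longrightarrow> h i \<in> cameron_martin \<gamma>"
  shows "(\<Sum>i\<in>I. a i *\<^sub>R h i) \<in> cameron_martin \<gamma>"
    and "AE x in \<gamma>. hat \<gamma> (\<Sum>i\<in>I. a i *\<^sub>R h i) x = (\<Sum>i\<in>I. a i * hat \<gamma> (h i) x)"
proof -
  have d: "(\<lambda>x. \<Sum>i\<in>I. a i * hat \<gamma> (h i) x) \<in> dual_closure \<gamma>"
    by (intro dual_closure_sum hat_dual_closure assms)
  have "R_map \<gamma> (\<lambda>x. \<Sum>i\<in>I. a i * hat \<gamma> (h i) x) = (\<Sum>i\<in>I. a i *\<^sub>R R_map \<gamma> (hat \<gamma> (h i)))"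
    using assms by (intro R_map_sum dual_closure_L2 hat_dual_closure)
  also have "\<dots> = (\<Sum>i\<in>I. a i *\<^sub>R h i)"
    using assms by (intro sum.cong refl) (simp add: R_map_hat)
  finally have R: "R_map \<gamma> (\<lambda>x. \<Sum>i\<in>I. a i * hat \<gamma> (h i) x) = (\<Sum>i\<in>I. a i *\<^sub>R h i)" .
  show "(\<Sum>i\<in>I. a i *\<^sub>R h i) \<in> cameron_martin \<gamma>"
    unfolding R[symmetric] by (rule R_map_cameron_martin[OF d])
  show "AE x in \<gamma>. hat \<gamma> (\<Sum>i\<in>I. a i *\<^sub>R h i) x = (\<Sum>i\<in>I. a i * hat \<gamma> (h i) x)"
    unfolding R[symmetric] by (rule hat_R_map[OF d])
qed

lemma cameron_martin_diff:
  assumes h: "h \<in> cameron_martin \<gamma>" and k: "k \<in> cameron_martin \<gamma>"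
  shows "h - k \<in> cameron_martin \<gamma>" "AE x in \<gamma>. hat \<gamma> (h - k) x = hat \<gamma> h x - hat \<gamma> k x"
proof -
  note d = hat_dual_closure[OF h] hat_dual_closure[OF k]
  have R: "R_map \<gamma> (\<lambda>x. hat \<gamma> h x - hat \<gamma> k x) = h - k"
    using R_map_diff[OF d[THEN dual_closure_L2]] h k by (simp add: R_map_hat)
  show "h - k \<in> cameron_martin \<gamma>"
    unfolding R[symmetric] by (rule R_map_cameron_martin[OF dual_closure_diff[OF d]])
  show "AE x in \<gamma>. hat \<gamma> (h - k) x = hat \<gamma> h x - hat \<gamma> k x"
    unfolding R[symmetric] by (rule hat_R_map[OF dual_closure_diff[OF d]])
qed

lemma inner_H_sum_left:
  assumes "finite I" "\<And>i. i \<in> I \<Longrightarrow> h i \<in> cameron_martin \<gamma>" "k \<in> cameron_martin \<gamma>"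
  shows "inner_H \<gamma> (\<Sum>i\<in>I. a i *\<^sub>R h i) k = (\<Sum>i\<in>I. a i * inner_H \<gamma> (h i) k)"
proof -
  have lin: "(\<Sum>i\<in>I. a i *\<^sub>R h i) \<in> cameron_martin \<gamma>"
    "AE x in \<gamma>. hat \<gamma> (\<Sum>i\<in>I. a i *\<^sub>R h i) x = (\<Sum>i\<in>I. a i * hat \<gamma> (h i) x)"
    by (rule cameron_martin_lincomb; use assms in simp)+
  have L: "hat \<gamma> (h i) \<in> L2 \<gamma>" if "i \<in> I" for i
    using assms that by (intro dual_closure_L2 hat_dual_closure)
  have k: "hat \<gamma> k \<in> L2 \<gamma>" and s: "hat \<gamma> (\<Sum>i\<in>I. a i *\<^sub>R h i) \<in> L2 \<gamma>"
    using assms lin by (auto intro!: dual_closure_L2 hat_dual_closure)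
  have i: "integrable \<gamma> (\<lambda>x. a i * (hat \<gamma> (h i) x * hat \<gamma> k x))" if "i \<in> I" for i
    using that L k by (intro integrable_mult_right L2_mult_integrable)
  have "inner_H \<gamma> (\<Sum>i\<in>I. a i *\<^sub>R h i) k = (LINT x|\<gamma>. (\<Sum>i\<in>I. a i * (hat \<gamma> (h i) x * hat \<gamma> k x)))"
    unfolding inner_H_def
  proof (rule integral_cong_AE)
    show "(\<lambda>x. hat \<gamma> (\<Sum>i\<in>I. a i *\<^sub>R h i) x * hat \<gamma> k x) \<in> borel_measurable \<gamma>"
      by (rule borel_measurable_integrable[OF L2_mult_integrable[OF s k]])
    show "(\<lambda>x. \<Sum>i\<in>I. a i * (hat \<gamma> (h i) x * hat \<gamma> k x)) \<in> borel_measurable \<gamma>"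
      using i by (intro borel_measurable_integrable Bochner_Integration.integrable_sum)
    show "AE x in \<gamma>. hat \<gamma> (\<Sum>i\<in>I. a i *\<^sub>R h i) x * hat \<gamma> k x = (\<Sum>i\<in>I. a i * (hat \<gamma> (h i) x * hat \<gamma> k x))"
      using lin(2) by eventually_elim (simp add: sum_distrib_right mult.assoc)
  qed
  also have "\<dots> = (\<Sum>i\<in>I. LINT x|\<gamma>. a i * (hat \<gamma> (h i) x * hat \<gamma> k x))"
    by (rule Bochner_Integration.integral_sum[OF i])
  finally show ?thesis by (simp add: inner_H_def)
qed

end

text \<open>Completing the square shows that the Fourier coefficients \<open>b = a\<close> give the best approximation.\<close>

lemma orthonormal_distance:
  assumes A: "finite A" and f: "f \<in> L2 M" and E: "\<And>j. j \<in> A \<Longrightarrow> E j \<in> L2 M"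
    and on: "\<And>i j. i \<in> A \<Longrightarrow> j \<in> A \<Longrightarrow> (LINT x|M. E i x * E j x) = (if i = j then 1 else 0)"
    and a: "\<And>j. j \<in> A \<Longrightarrow> a j = (LINT x|M. f x * E j x)"
  shows "(LINT x|M. (f x - (\<Sum>j\<in>A. b j * E j x))\<^sup>2)
    = (LINT x|M. (f x)\<^sup>2) - (\<Sum>j\<in>A. (a j)\<^sup>2) + (\<Sum>j\<in>A. (a j - b j)\<^sup>2)"
proof -
  have ex: "(f x - (\<Sum>j\<in>A. b j * E j x))\<^sup>2
    = (f x)\<^sup>2 - (\<Sum>j\<in>A. 2 * b j * (f x * E j x)) + (\<Sum>i\<in>A. \<Sum>j\<in>A. b i * b j * (E i x * E j x))" for x
  proof -
    have "(\<Sum>j\<in>A. 2 * b j * (f x * E j x)) = 2 * f x * (\<Sum>j\<in>A. b j * E j x)"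
      by (simp add: sum_distrib_left mult_ac)
    moreover have "(\<Sum>i\<in>A. \<Sum>j\<in>A. b i * b j * (E i x * E j x)) = (\<Sum>j\<in>A. b j * E j x) * (\<Sum>j\<in>A. b j * E j x)"
      by (simp add: sum_product mult_ac)
    ultimately show ?thesis by (simp add: power2_eq_square algebra_simps)
  qed
  have i: "integrable M (\<lambda>x. (f x)\<^sup>2)" "integrable M (\<lambda>x. \<Sum>j\<in>A. 2 * b j * (f x * E j x))"
    "integrable M (\<lambda>x. \<Sum>i\<in>A. \<Sum>j\<in>A. b i * b j * (E i x * E j x))"
    using f E by (auto intro!: L2_square_integrable Bochner_Integration.integrable_sum integrable_mult_right L2_mult_integrable)
  have "(LINT x|M. (\<Sum>j\<in>A. 2 * b j * (f x * E j x))) = (\<Sum>j\<in>A. 2 * b j * a j)"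
    using f E by (subst Bochner_Integration.integral_sum)
      (auto intro!: integrable_mult_right L2_mult_integrable sum.cong simp: a)
  moreover have "(LINT x|M. (\<Sum>i\<in>A. \<Sum>j\<in>A. b i * b j * (E i x * E j x))) = (\<Sum>j\<in>A. (b j)\<^sup>2)"
  proof -
    have ij: "integrable M (\<lambda>x. b i * b j * (E i x * E j x))" if "i \<in> A" "j \<in> A" for i j
      using that E by (intro integrable_mult_right L2_mult_integrable)
    have "(LINT x|M. (\<Sum>i\<in>A. \<Sum>j\<in>A. b i * b j * (E i x * E j x)))
        = (\<Sum>i\<in>A. \<Sum>j\<in>A. LINT x|M. b i * b j * (E i x * E j x))"
      using ij by (subst Bochner_Integration.integral_sum)
        (auto intro!: Bochner_Integration.integrable_sum sum.cong Bochner_Integration.integral_sum)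
    also have "\<dots> = (\<Sum>i\<in>A. \<Sum>j\<in>A. if i = j then (b j)\<^sup>2 else 0)"
      by (intro sum.cong refl) (auto simp: on power2_eq_square)
    also have "\<dots> = (\<Sum>j\<in>A. (b j)\<^sup>2)" using A by (simp add: sum.delta')
    finally show ?thesis .
  qed
  ultimately have "(LINT x|M. (f x - (\<Sum>j\<in>A. b j * E j x))\<^sup>2)
      = (LINT x|M. (f x)\<^sup>2) - (\<Sum>j\<in>A. 2 * b j * a j) + (\<Sum>j\<in>A. (b j)\<^sup>2)"
    unfolding ex using i by simp
  also have "\<dots> = (LINT x|M. (f x)\<^sup>2) - (\<Sum>j\<in>A. (a j)\<^sup>2) + (\<Sum>j\<in>A. (a j - b j)\<^sup>2)"
    by (simp add: power2_diff sum.distrib sum_subtractf mult_ac)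
  finally show ?thesis .
qed

section \<open>The divergence of a cylindrical field\<close>

locale wiener_basis = wiener_measure +
  fixes J :: "nat set" and xs :: "nat \<Rightarrow> 'a \<Rightarrow>\<^sub>L real"
  assumes onb: "dual_onb \<gamma> J xs"
begin

definition basis :: "nat \<Rightarrow> 'a" where
  "basis j = R_map \<gamma> (xs j)"

lemma basis_cameron_martin: "basis j \<in> cameron_martin \<gamma>"
  by (simp add: basis_def R_map_cameron_martin blinfun_dual_closure)

lemma basis_expansion:
  assumes h: "h \<in> cameron_martin \<gamma>"
  shows "L2_tendsto \<gamma> (\<lambda>n x. \<Sum>j\<in>J \<inter> {..<n}. inner_H \<gamma> h (basis j) * hat \<gamma> (basis j) x) (hat \<gamma> h)"
proof -
  define E where "E j = hat \<gamma> (basis j)" for j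
  have E: "E j \<in> L2 \<gamma>" for j
    unfolding E_def by (intro dual_closure_L2 hat_dual_closure basis_cameron_martin)
  have f: "hat \<gamma> h \<in> L2 \<gamma>" using h by (intro dual_closure_L2 hat_dual_closure)
  define a where "a j = (LINT x|\<gamma>. hat \<gamma> h x * E j x)" for j
  have a: "inner_H \<gamma> h (basis j) = a j" for j by (simp add: inner_H_def a_def E_def)
  have on: "(LINT x|\<gamma>. E i x * E j x) = (if i = j then 1 else 0)" if "i \<in> J" "j \<in> J" for i j
    using onb that unfolding dual_onb_def inner_H_def E_def basis_def by blast
  define d where "d n = (LINT x|\<gamma>. ((\<Sum>j\<in>J \<inter> {..<n}. a j * E j x) - hat \<gamma> h x)\<^sup>2)" for n
  have "d \<longlonglongrightarrow> 0"
  proof (rule LIMSEQ_I)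
    fix r :: real assume "0 < r"
    then have "0 < sqrt r" by simp
    then obtain F c where F: "finite F" "F \<subseteq> J" "norm_H \<gamma> (h - (\<Sum>j\<in>F. c j *\<^sub>R basis j)) < sqrt r"
      using onb h unfolding dual_onb_def basis_def by meson
    obtain n0 where n0: "\<And>j. j \<in> F \<Longrightarrow> j < n0"
      using F(1) finite_nat_set_iff_bounded by auto
    define k where "k = (\<Sum>j\<in>F. c j *\<^sub>R basis j)"
    have k: "k \<in> cameron_martin \<gamma>" "AE x in \<gamma>. hat \<gamma> k x = (\<Sum>j\<in>F. c j * E j x)"
      unfolding k_def E_def using F(1) by (rule cameron_martin_lincomb; simp add: basis_cameron_martin)+
    have "AE x in \<gamma>. hat \<gamma> (h - k) x = hat \<gamma> h x - (\<Sum>j\<in>F. c j * E j x)"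
      using cameron_martin_diff(2)[OF h k(1)] k(2) by eventually_elim simp
    moreover have "h - k \<in> cameron_martin \<gamma>" by (rule cameron_martin_diff(1)[OF h k(1)])
    then have "hat \<gamma> (h - k) \<in> borel_measurable \<gamma>"
      by (intro L2_measurable dual_closure_L2 hat_dual_closure)
    ultimately have "inner_H \<gamma> (h - k) (h - k)
        = (LINT x|\<gamma>. (hat \<gamma> h x - (\<Sum>j\<in>F. c j * E j x))\<^sup>2)"
      unfolding inner_H_def using L2_measurable[OF f] L2_measurable[OF E]
      by (intro integral_cong_AE) (auto simp: power2_eq_square)
    then have Fr: "(LINT x|\<gamma>. (hat \<gamma> h x - (\<Sum>j\<in>F. c j * E j x))\<^sup>2) < r"
      using F(3) by (simp add: norm_H_def k_def)
    have "d n < r" if n: "n0 \<le> n" for n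
    proof -
      let ?A = "J \<inter> {..<n}"
      define b where "b j = (if j \<in> F then c j else 0)" for j
      have FA: "F \<subseteq> ?A" using F(2) n0 n by (auto intro: less_le_trans)
      have bs: "(\<Sum>j\<in>?A. b j * E j x) = (\<Sum>j\<in>F. c j * E j x)" for x
        using FA by (intro sum.mono_neutral_cong_right) (auto simp: b_def)
      have dist: "(LINT x|\<gamma>. (hat \<gamma> h x - (\<Sum>j\<in>?A. k j * E j x))\<^sup>2)
          = (LINT x|\<gamma>. (hat \<gamma> h x)\<^sup>2) - (\<Sum>j\<in>?A. (a j)\<^sup>2) + (\<Sum>j\<in>?A. (a j - k j)\<^sup>2)" for k
        by (rule orthonormal_distance) (auto simp: f E on a_def)
      have "d n = (LINT x|\<gamma>. (hat \<gamma> h x - (\<Sum>j\<in>?A. a j * E j x))\<^sup>2)"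
        by (simp add: d_def power2_commute)
      also have "\<dots> \<le> (LINT x|\<gamma>. (hat \<gamma> h x - (\<Sum>j\<in>?A. b j * E j x))\<^sup>2)"
        unfolding dist by (simp add: sum_nonneg)
      also have "\<dots> < r" unfolding bs by (rule Fr)
      finally show ?thesis .
    qed
    moreover have "0 \<le> d n" for n by (simp add: d_def)
    ultimately show "\<exists>no. \<forall>n\<ge>no. norm (d n - 0) < r" by auto
  qed
  moreover have "(\<lambda>x. \<Sum>j\<in>J \<inter> {..<n}. a j * E j x) \<in> L2 \<gamma>" for n
    by (intro L2_sum L2_cmult E) auto
  ultimately show ?thesis
    unfolding L2_tendsto_def a d_def E_def[symmetric] using f by blast
qed

text \<open>The series defining the divergence converges because the expansion of \<open>h\<close> in the basis
  converges in \<open>L2\<close>, hence also in norm, and the divergence of \<open>f h\<close> depends continuously on \<open>h\<close>.\<close>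

lemma gauss_div_term_tendsto:
  assumes f: "has_gradient f G" and h: "h \<in> cameron_martin \<gamma>"
  shows "L2_tendsto \<gamma> (\<lambda>n x. \<Sum>j\<in>J \<inter> {..<n}. inner_H \<gamma> h (basis j) * (G x (basis j) - hat \<gamma> (basis j) x * f x))
    (\<lambda>x. G x h - hat \<gamma> h x * f x)"
proof -
  obtain B where B: "0 \<le> B" "\<And>x. \<bar>f x\<bar> \<le> B" "\<And>x h. \<bar>blinfun_apply (G x) h\<bar> \<le> B * norm h"
    by (rule has_gradient_bounds[OF f]) (rule that)
  let ?a = "\<lambda>j. inner_H \<gamma> h (basis j)"
  define e where "e n x = (\<Sum>j\<in>J \<inter> {..<n}. ?a j * hat \<gamma> (basis j) x)" for n x
  define k where "k n = (\<Sum>j\<in>J \<inter> {..<n}. ?a j *\<^sub>R basis j)" for n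
  have T: "L2_tendsto \<gamma> e (hat \<gamma> h)"
    unfolding e_def by (rule basis_expansion[OF h])
  then have e2: "e n \<in> L2 \<gamma>" "hat \<gamma> h \<in> L2 \<gamma>" for n by (auto simp: L2_tendsto_def)
  have k: "k n = R_map \<gamma> (e n)" for n
    unfolding e_def k_def
    by (subst R_map_sum) (auto simp: R_map_hat basis_cameron_martin intro!: dual_closure_L2 hat_dual_closure)
  have L: "(\<lambda>x. G x v - u x * f x) \<in> L2 \<gamma>" if "u \<in> L2 \<gamma>" for u v
    using L2_diff[OF has_gradient_L2(2)[OF f] L2_mult_bounded[OF that has_gradient_random_variable(1)[OF f] B(2)]]
    by (simp add: mult.commute)
  have sum_eq: "(\<Sum>j\<in>J \<inter> {..<n}. ?a j * (G x (basis j) - hat \<gamma> (basis j) x * f x)) = G x (k n) - e n x * f x" for n x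
    by (simp add: k_def e_def blinfun.sum_right blinfun.scaleR_right right_diff_distrib sum_subtractf
        sum_distrib_right mult.assoc)
  have bound: "(LINT x|\<gamma>. (G x (k n) - e n x * f x - (G x h - hat \<gamma> h x * f x))\<^sup>2)
    \<le> 2 * B\<^sup>2 * (norm_bound\<^sup>2 + 1) * (LINT x|\<gamma>. (e n x - hat \<gamma> h x)\<^sup>2)" for n
  proof -
    let ?D = "LINT x|\<gamma>. (e n x - hat \<gamma> h x)\<^sup>2"
    have d2: "(\<lambda>x. e n x - hat \<gamma> h x) \<in> L2 \<gamma>" using e2 by (intro L2_diff)
    have "k n - h = R_map \<gamma> (\<lambda>x. e n x - hat \<gamma> h x)"
      using e2 by (simp add: R_map_diff k R_map_hat h)
    then have nk: "(norm (k n - h))\<^sup>2 \<le> norm_bound\<^sup>2 * ?D"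
      using power_mono[OF norm_R_map[OF d2], of 2] by (simp add: power_mult_distrib)
    have pt: "(G x (k n) - e n x * f x - (G x h - hat \<gamma> h x * f x))\<^sup>2
      \<le> 2 * B\<^sup>2 * (norm (k n - h))\<^sup>2 + 2 * B\<^sup>2 * (e n x - hat \<gamma> h x)\<^sup>2" for x
    proof -
      define p q where "p = blinfun_apply (G x) (k n - h)" and "q = (e n x - hat \<gamma> h x) * f x"
      have "G x (k n) - e n x * f x - (G x h - hat \<gamma> h x * f x) = p - q"
        by (simp add: p_def q_def blinfun.diff_right algebra_simps)
      moreover have "(p - q)\<^sup>2 \<le> 2 * p\<^sup>2 + 2 * q\<^sup>2"
        using zero_le_power2[of "p + q"] by (simp add: power2_eq_square algebra_simps)
      moreover have "p\<^sup>2 \<le> B\<^sup>2 * (norm (k n - h))\<^sup>2"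
        using power_mono[OF B(3)[of x "k n - h"], of 2] by (simp add: p_def power_mult_distrib)
      moreover have "q\<^sup>2 \<le> B\<^sup>2 * (e n x - hat \<gamma> h x)\<^sup>2"
        using mult_right_mono[OF power_mono[OF B(2)[of x], of 2], of "(e n x - hat \<gamma> h x)\<^sup>2"]
        by (simp add: q_def power_mult_distrib mult.commute)
      ultimately show ?thesis by simp
    qed
    have "(LINT x|\<gamma>. (G x (k n) - e n x * f x - (G x h - hat \<gamma> h x * f x))\<^sup>2)
      \<le> (LINT x|\<gamma>. 2 * B\<^sup>2 * (norm (k n - h))\<^sup>2 + 2 * B\<^sup>2 * (e n x - hat \<gamma> h x)\<^sup>2)"
      using pt L2_square_integrable[OF d2] e2
      by (intro integral_mono L2_square_integrable L2_diff L) auto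
    also have "\<dots> = 2 * B\<^sup>2 * (norm (k n - h))\<^sup>2 + 2 * B\<^sup>2 * ?D"
      using L2_square_integrable[OF d2] by simp
    also have "\<dots> \<le> 2 * B\<^sup>2 * (norm_bound\<^sup>2 * ?D) + 2 * B\<^sup>2 * ?D"
      using nk by (intro add_right_mono mult_left_mono) auto
    finally show ?thesis by (simp add: algebra_simps)
  qed
  have "(\<lambda>n. 2 * B\<^sup>2 * (norm_bound\<^sup>2 + 1) * (LINT x|\<gamma>. (e n x - hat \<gamma> h x)\<^sup>2)) \<longlonglongrightarrow> 0"
    using T by (intro tendsto_mult_right_zero) (simp add: L2_tendsto_def)
  then have "(\<lambda>n. LINT x|\<gamma>. (G x (k n) - e n x * f x - (G x h - hat \<gamma> h x * f x))\<^sup>2) \<longlonglongrightarrow> 0"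
    by (rule Lim_null_comparison[OF always_eventually, rotated])
      (intro allI ord_eq_le_trans[OF _ bound], simp)
  then show ?thesis
    unfolding L2_tendsto_def sum_eq using e2 L by blast
qed

lemma gauss_div_eq:
  fixes n :: nat
  assumes f: "\<And>i. i < n \<Longrightarrow> has_gradient (f i) (G i)" and h: "\<And>i. i < n \<Longrightarrow> h i \<in> cameron_martin \<gamma>"
    and \<phi>: "\<phi> = (\<lambda>x. \<Sum>i<n. c i *\<^sub>R (f i x *\<^sub>R h i))"
  shows "gauss_div \<gamma> J xs \<phi> \<in> L2 \<gamma>"
    and "AE x in \<gamma>. gauss_div \<gamma> J xs \<phi> x = (\<Sum>i<n. c i * (G i x (h i) - hat \<gamma> (h i) x * f i x))"
proof -
  let ?a = "\<lambda>i j. inner_H \<gamma> (h i) (basis j)"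
  have inner: "inner_H \<gamma> (\<phi> y) (basis j) = (\<Sum>i<n. (c i * ?a i j) * f i y)" for y j
  proof -
    have "\<phi> y = (\<Sum>i<n. (c i * f i y) *\<^sub>R h i)" by (simp add: \<phi>)
    then show ?thesis
      using inner_H_sum_left[of "{..<n}" h "basis j" "\<lambda>i. c i * f i y"] h basis_cameron_martin
      by (simp add: mult_ac)
  qed
  have dir: "dir_deriv (basis j) (\<lambda>y. inner_H \<gamma> (\<phi> y) (basis j)) x = (\<Sum>i<n. (c i * ?a i j) * G i x (basis j))" for j x
    unfolding inner dir_deriv_def
    using f by (intro DERIV_imp_deriv DERIV_sum DERIV_cmult) (auto simp: has_gradient_def)
  have trm: "dir_deriv_adj \<gamma> (basis j) (\<lambda>y. inner_H \<gamma> (\<phi> y) (basis j)) x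
      = (\<Sum>i<n. c i * (?a i j * (G i x (basis j) - hat \<gamma> (basis j) x * f i x)))" for j x
    unfolding dir_deriv_adj_def dir unfolding inner
    by (simp add: sum_distrib_left sum_subtractf algebra_simps)
  define S where "S N x = (\<Sum>j\<in>J \<inter> {..<N}. dir_deriv_adj \<gamma> (basis j) (\<lambda>y. inner_H \<gamma> (\<phi> y) (basis j)) x)" for N x
  have "L2_tendsto \<gamma> S (\<lambda>x. \<Sum>i<n. c i * (G i x (h i) - hat \<gamma> (h i) x * f i x))" (is "L2_tendsto _ _ ?g")
  proof -
    have S: "S N x = (\<Sum>i<n. c i * (\<Sum>j\<in>J \<inter> {..<N}. ?a i j * (G i x (basis j) - hat \<gamma> (basis j) x * f i x)))" for N x
      unfolding S_def trm by (subst sum.swap) (simp add: sum_distrib_left)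
    show ?thesis
      unfolding S
      using L2_tendsto_sum[of "{..<n}" \<gamma> "\<lambda>i N x. \<Sum>j\<in>J \<inter> {..<N}. ?a i j * (G i x (basis j) - hat \<gamma> (basis j) x * f i x)"
          "\<lambda>i x. G i x (h i) - hat \<gamma> (h i) x * f i x" c] gauss_div_term_tendsto f h
      by simp
  qed
  moreover have "gauss_div \<gamma> J xs \<phi> = (SOME g. L2_tendsto \<gamma> S g)"
    unfolding gauss_div_def S_def[abs_def] basis_def ..
  with someI[of "L2_tendsto \<gamma> S" ?g, OF calculation] have "L2_tendsto \<gamma> S (gauss_div \<gamma> J xs \<phi>)"
    by simp
  ultimately show "gauss_div \<gamma> J xs \<phi> \<in> L2 \<gamma>" "AE x in \<gamma>. gauss_div \<gamma> J xs \<phi> x = ?g x"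
    using L2_tendsto_unique by (auto simp: L2_tendsto_def)
qed

end

section \<open>Smooth log-concave cutoffs\<close>

text \<open>The exponential of minus a sum of convex functions is log-concave. The softplus function is
  smooth and convex, and \<open>softplus (N * u)\<close> tends to zero for \<open>u < 0\<close> and to infinity for \<open>u > 0\<close>,
  so such exponentials approximate indicators of polyhedra.\<close>

definition softplus :: "real \<Rightarrow> real" where
  "softplus u = ln (1 + exp u)"

definition sigmoid :: "real \<Rightarrow> real" where
  "sigmoid u = exp u / (1 + exp u)"

lemma one_plus_exp_pos: "0 < 1 + exp (u :: real)"
  by (simp add: add_pos_pos)

lemma softplus_deriv: "(softplus has_real_derivative sigmoid u) (at u)"
  unfolding softplus_def[abs_def] sigmoid_def using one_plus_exp_pos[of u]
  by (auto intro!: derivative_eq_intros)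

lemma sigmoid_bounds: "0 \<le> sigmoid u" "sigmoid u \<le> 1"
  using one_plus_exp_pos[of u] by (auto simp: sigmoid_def field_simps)

lemma sigmoid_continuous: "continuous_on A sigmoid"
  unfolding sigmoid_def[abs_def] using one_plus_exp_pos by (intro continuous_intros) (metis less_irrefl)

lemma softplus_nonneg: "0 \<le> softplus u"
  by (simp add: softplus_def)

lemma softplus_ge: "u \<le> softplus u"
proof -
  have "ln (exp u) \<le> ln (1 + exp u)" by (intro ln_mono) (auto simp: one_plus_exp_pos)
  then show ?thesis by (simp add: softplus_def)
qed

lemma softplus_le_exp: "softplus u \<le> exp u"
  unfolding softplus_def by (rule ln_add_one_self_le_self) simp

lemma softplus_mono: "u \<le> v \<Longrightarrow> softplus u \<le> softplus v"
  unfolding softplus_def by (intro ln_mono) (auto simp: one_plus_exp_pos)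

lemma softplus_midpoint: "2 * softplus ((u + v) / 2) \<le> softplus u + softplus v"
proof -
  have e: "exp u = (exp (u / 2))\<^sup>2" for u :: real by (simp add: exp_double[symmetric])
  have m: "exp ((u + v) / 2) = exp (u / 2) * exp (v / 2)" by (simp add: exp_add[symmetric] add_divide_distrib)
  have "(1 + exp ((u + v) / 2))\<^sup>2 \<le> (1 + exp u) * (1 + exp v)"
    using zero_le_power2[of "exp (u / 2) - exp (v / 2)"]
    unfolding m e[of u] e[of v] by (simp add: power2_eq_square algebra_simps)
  then have "ln ((1 + exp ((u + v) / 2))\<^sup>2) \<le> ln ((1 + exp u) * (1 + exp v))"
    by (intro ln_mono zero_less_power mult_pos_pos one_plus_exp_pos)
  moreover have "ln ((1 + exp ((u + v) / 2))\<^sup>2) = 2 * softplus ((u + v) / 2)"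
    using one_plus_exp_pos[of "(u + v) / 2"] by (simp add: softplus_def ln_realpow)
  moreover have "ln ((1 + exp u) * (1 + exp v)) = softplus u + softplus v"
    using one_plus_exp_pos[of u] one_plus_exp_pos[of v] by (simp add: softplus_def ln_mult)
  ultimately show ?thesis by simp
qed

text \<open>Smoothed indicator of the polyhedron given by \<open>l k (x - x0) \<le> 1 + \<tau>\<close> for all \<open>k < N\<close>;
  \<open>cutoff_slope\<close> is its derivative in \<open>\<tau>\<close> and \<open>cutoff_gradient\<close> the one in \<open>x\<close> at \<open>\<tau> = 0\<close>.\<close>

definition cutoff :: "(nat \<Rightarrow> 'a::real_normed_vector \<Rightarrow>\<^sub>L real) \<Rightarrow> 'a \<Rightarrow> nat \<Rightarrow> real \<Rightarrow> 'a \<Rightarrow> real" where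
  "cutoff l x0 N \<tau> x = exp (- (\<Sum>k<N. softplus (real N * (l k (x - x0) - 1 - \<tau>))))"

definition cutoff_slope :: "(nat \<Rightarrow> 'a::real_normed_vector \<Rightarrow>\<^sub>L real) \<Rightarrow> 'a \<Rightarrow> nat \<Rightarrow> real \<Rightarrow> 'a \<Rightarrow> real" where
  "cutoff_slope l x0 N \<tau> x
    = cutoff l x0 N \<tau> x * (\<Sum>k<N. real N * sigmoid (real N * (l k (x - x0) - 1 - \<tau>)))"

definition cutoff_gradient :: "(nat \<Rightarrow> 'a::real_normed_vector \<Rightarrow>\<^sub>L real) \<Rightarrow> 'a \<Rightarrow> nat \<Rightarrow> 'a \<Rightarrow> 'a \<Rightarrow>\<^sub>L real" where
  "cutoff_gradient l x0 N x
    = (- cutoff l x0 N 0 x) *\<^sub>R (\<Sum>k<N. (real N * sigmoid (real N * (l k (x - x0) - 1 - 0))) *\<^sub>R l k)"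

lemma cutoff_bounds: "0 < cutoff l x0 N \<tau> x" "cutoff l x0 N \<tau> x \<le> 1"
  by (auto simp: cutoff_def softplus_nonneg sum_nonneg)

lemma cutoff_slope_bounds: "0 \<le> cutoff_slope l x0 N \<tau> x" "cutoff_slope l x0 N \<tau> x \<le> real N * real N"
proof -
  let ?s = "\<Sum>k<N. real N * sigmoid (real N * (l k (x - x0) - 1 - \<tau>))"
  have s: "0 \<le> ?s" using sigmoid_bounds by (intro sum_nonneg mult_nonneg_nonneg) auto
  then show "0 \<le> cutoff_slope l x0 N \<tau> x"
    using cutoff_bounds(1)[of l x0 N \<tau> x] by (simp add: cutoff_slope_def)
  have "?s \<le> (\<Sum>k<N. real N)" using sigmoid_bounds by (intro sum_mono mult_left_le) auto
  then have "cutoff l x0 N \<tau> x * ?s \<le> 1 * (real N * real N)"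
    using s cutoff_bounds[of l x0 N \<tau> x] by (intro mult_mono) auto
  then show "cutoff_slope l x0 N \<tau> x \<le> real N * real N" by (simp add: cutoff_slope_def)
qed

lemma cutoff_deriv: "((\<lambda>\<tau>. cutoff l x0 N \<tau> x) has_real_derivative cutoff_slope l x0 N \<tau> x) (at \<tau>)"
proof -
  have "((\<lambda>\<tau>. softplus (real N * (l k (x - x0) - 1 - \<tau>))) has_real_derivative
      sigmoid (real N * (l k (x - x0) - 1 - \<tau>)) * (- real N)) (at \<tau>)" for k
    by (rule DERIV_chain2[OF softplus_deriv]) (auto intro!: derivative_eq_intros)
  then have "((\<lambda>\<tau>. - (\<Sum>k<N. softplus (real N * (l k (x - x0) - 1 - \<tau>)))) has_real_derivative
      - (\<Sum>k<N. sigmoid (real N * (l k (x - x0) - 1 - \<tau>)) * (- real N))) (at \<tau>)"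
    by (intro DERIV_minus DERIV_sum)
  from DERIV_fun_exp[OF this] show ?thesis
    by (simp add: cutoff_def cutoff_slope_def sum_negf mult.commute)
qed

lemma cutoff_has_gradient: "has_gradient (cutoff l x0 N 0) (cutoff_gradient l x0 N)"
  unfolding has_gradient_def
proof (intro conjI allI)
  have "continuous_on UNIV softplus"
    using softplus_deriv by (meson DERIV_isCont continuous_at_imp_continuous_on)
  then have sp: "continuous_on UNIV (\<lambda>x. softplus (real N * (l k (x - x0) - 1 - 0)))" for k
    by (rule continuous_on_compose2) (auto intro!: continuous_intros)
  then show c: "continuous_on UNIV (cutoff l x0 N 0)"
    unfolding cutoff_def[abs_def] by (intro continuous_intros)
  have "continuous_on UNIV (\<lambda>x. sigmoid (real N * (l k (x - x0) - 1 - 0)))" for k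
    by (rule continuous_on_compose2[OF sigmoid_continuous]) (auto intro!: continuous_intros)
  then show "continuous_on UNIV (cutoff_gradient l x0 N)"
    unfolding cutoff_gradient_def[abs_def] by (intro continuous_intros c)
  have "\<bar>cutoff l x0 N 0 x\<bar> \<le> 1" for x using cutoff_bounds[of l x0 N 0 x] by simp
  then show "bounded (range (cutoff l x0 N 0))" by (auto simp: bounded_iff)
  have "norm (cutoff_gradient l x0 N x) \<le> 1 * (\<Sum>k<N. real N * norm (l k))" for x
  proof -
    have "norm ((real N * sigmoid (real N * (l k (x - x0) - 1 - 0))) *\<^sub>R l k) \<le> real N * norm (l k)" for k
    proof -
      have "real N * sigmoid (real N * (l k (x - x0) - 1 - 0)) \<le> real N"
        using sigmoid_bounds by (intro mult_left_le) auto
      then show ?thesis using sigmoid_bounds by (simp add: abs_mult mult_right_mono)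
    qed
    then have "norm (\<Sum>k<N. (real N * sigmoid (real N * (l k (x - x0) - 1 - 0))) *\<^sub>R l k) \<le> (\<Sum>k<N. real N * norm (l k))"
      by (intro order_trans[OF norm_sum] sum_mono)
    then show ?thesis
      unfolding cutoff_gradient_def norm_scaleR using cutoff_bounds[of l x0 N 0 x] by (intro mult_mono) auto
  qed
  then show "bounded (range (cutoff_gradient l x0 N))" by (auto simp: bounded_iff)
  fix x h
  have "((\<lambda>t. softplus (real N * (l k (x + t *\<^sub>R h - x0) - 1 - 0))) has_real_derivative
      sigmoid (real N * (l k (x + 0 *\<^sub>R h - x0) - 1 - 0)) * (real N * l k h)) (at 0)" for k
  proof (rule DERIV_chain2[OF softplus_deriv])
    have "((\<lambda>t. real N * (l k (x - x0) + t * l k h - 1 - 0)) has_real_derivative real N * l k h) (at 0)"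
      by (auto intro!: derivative_eq_intros)
    then show "((\<lambda>t. real N * (l k (x + t *\<^sub>R h - x0) - 1 - 0)) has_real_derivative real N * l k h) (at 0)"
      by (simp add: blinfun.add_right blinfun.diff_right blinfun.scaleR_right algebra_simps)
  qed
  then have "((\<lambda>t. - (\<Sum>k<N. softplus (real N * (l k (x + t *\<^sub>R h - x0) - 1 - 0)))) has_real_derivative
      - (\<Sum>k<N. sigmoid (real N * (l k (x + 0 *\<^sub>R h - x0) - 1 - 0)) * (real N * l k h))) (at 0)"
    by (intro DERIV_minus DERIV_sum)
  from DERIV_fun_exp[OF this]
  show "((\<lambda>t. cutoff l x0 N 0 (x + t *\<^sub>R h)) has_real_derivative blinfun_apply (cutoff_gradient l x0 N x) h) (at 0)"
    by (simp add: cutoff_def cutoff_gradient_def blinfun.minus_left blinfun.scaleR_left blinfun.sum_left mult_ac)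
qed

text \<open>Moving \<open>x\<close> in direction \<open>v\<close> changes each functional at a rate of at most \<open>b / r\<close>, which is the
  effect of moving all half-spaces at that speed.\<close>

lemma cutoff_gradient_le:
  fixes l :: "nat \<Rightarrow> 'a::real_normed_vector \<Rightarrow>\<^sub>L real"
  assumes l: "\<And>k v. l k v \<le> norm v / r" and r: "0 < r" and v: "norm v \<le> b"
  shows "- (cutoff_gradient l x0 N x v) \<le> (b / r) * cutoff_slope l x0 N 0 x"
proof -
  let ?s = "\<lambda>k. real N * sigmoid (real N * (l k (x - x0) - 1 - 0))"
  have "(\<Sum>k<N. ?s k * l k v) \<le> (\<Sum>k<N. ?s k * (b / r))"
  proof (intro sum_mono mult_left_mono)
    show "l k v \<le> b / r" for k using l[of k v] divide_right_mono[OF v, of r] r by simp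
  qed (simp add: sigmoid_bounds)
  then have "cutoff l x0 N 0 x * (\<Sum>k<N. ?s k * l k v) \<le> cutoff l x0 N 0 x * (\<Sum>k<N. ?s k * (b / r))"
    using cutoff_bounds(1)[of l x0 N 0 x] by (intro mult_left_mono) auto
  also have "\<dots> = cutoff l x0 N 0 x * ((\<Sum>k<N. ?s k) * (b / r))"
    by (simp only: sum_distrib_right)
  also have "\<dots> = (b / r) * cutoff_slope l x0 N 0 x"
    by (simp add: cutoff_slope_def)
  finally show ?thesis
    by (simp add: cutoff_gradient_def blinfun.minus_left blinfun.scaleR_left blinfun.sum_left)
qed

text \<open>With \<open>softplus u \<le> exp u\<close>, a margin \<open>\<delta>\<close> beats the number \<open>N\<close> of factors, as \<open>N * exp (- \<delta> * N)\<close> tends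
  to zero.\<close>

lemma cutoff_lower:
  fixes l :: "nat \<Rightarrow> 'a::real_normed_vector \<Rightarrow>\<^sub>L real"
  assumes "\<And>k. k < N \<Longrightarrow> l k (x - x0) - 1 - \<tau> \<le> - \<delta>"
  shows "exp (- (real N * exp (- \<delta>) ^ N)) \<le> cutoff l x0 N \<tau> x"
proof -
  have "(\<Sum>k<N. softplus (real N * (l k (x - x0) - 1 - \<tau>))) \<le> (\<Sum>k<N. exp (- \<delta>) ^ N)"
  proof (rule sum_mono)
    fix k assume "k \<in> {..<N}"
    then have "real N * (l k (x - x0) - 1 - \<tau>) \<le> real N * (- \<delta>)"
      using assms by (intro mult_left_mono) auto
    then have "softplus (real N * (l k (x - x0) - 1 - \<tau>)) \<le> softplus (real N * (- \<delta>))"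
      by (rule softplus_mono)
    also have "\<dots> \<le> exp (real N * (- \<delta>))" by (rule softplus_le_exp)
    also have "\<dots> = exp (- \<delta>) ^ N" by (rule exp_of_nat_mult)
    finally show "softplus (real N * (l k (x - x0) - 1 - \<tau>)) \<le> exp (- \<delta>) ^ N" .
  qed
  then show ?thesis by (simp add: cutoff_def)
qed

lemma cutoff_tendsto_1:
  fixes l :: "nat \<Rightarrow> 'a::real_normed_vector \<Rightarrow>\<^sub>L real"
  assumes \<delta>: "0 < \<delta>" and "\<And>k. l k (x - x0) - 1 \<le> - \<delta>"
  shows "(\<lambda>N. cutoff l x0 N 0 x) \<longlonglongrightarrow> 1"
proof (rule tendsto_sandwich)
  have "(\<lambda>N. real N * exp (- \<delta>) ^ N) \<longlonglongrightarrow> 0"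
    using powser_times_n_limit_0[of "exp (- \<delta>)"] \<delta> by simp
  from tendsto_exp[OF tendsto_minus[OF this]]
  show "(\<lambda>N. exp (- (real N * exp (- \<delta>) ^ N))) \<longlonglongrightarrow> 1" by simp
  show "\<forall>\<^sub>F N in sequentially. exp (- (real N * exp (- \<delta>) ^ N)) \<le> cutoff l x0 N 0 x"
    using assms(2) by (intro always_eventually allI cutoff_lower) simp
  show "\<forall>\<^sub>F N in sequentially. cutoff l x0 N 0 x \<le> 1"
    using cutoff_bounds by (intro always_eventually allI)
qed simp

lemma cutoff_tendsto_0:
  fixes l :: "nat \<Rightarrow> 'a::real_normed_vector \<Rightarrow>\<^sub>L real"
  assumes k: "1 < l k (x - x0)"
  shows "(\<lambda>N. cutoff l x0 N 0 x) \<longlonglongrightarrow> 0"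
proof (rule tendsto_sandwich[OF _ _ tendsto_const])
  define \<theta> where "\<theta> = l k (x - x0) - 1"
  have \<theta>: "0 < \<theta>" using k by (simp add: \<theta>_def)
  show "(\<lambda>N. exp (- \<theta>) ^ N) \<longlonglongrightarrow> 0" using \<theta> by (intro LIMSEQ_realpow_zero) auto
  show "\<forall>\<^sub>F N in sequentially. 0 \<le> cutoff l x0 N 0 x"
    by (intro always_eventually allI less_imp_le cutoff_bounds(1))
  have "cutoff l x0 N 0 x \<le> exp (- \<theta>) ^ N" if "k < N" for N
  proof -
    have "real N * \<theta> \<le> softplus (real N * \<theta>)" by (rule softplus_ge)
    also have "\<dots> = (\<Sum>k\<in>{k}. softplus (real N * (l k (x - x0) - 1 - 0)))" by (simp add: \<theta>_def)
    also have "\<dots> \<le> (\<Sum>k<N. softplus (real N * (l k (x - x0) - 1 - 0)))"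
      using that softplus_nonneg by (intro sum_mono2) auto
    finally have "cutoff l x0 N 0 x \<le> exp (real N * (- \<theta>))" by (simp add: cutoff_def)
    then show ?thesis by (simp only: exp_of_nat_mult)
  qed
  then show "\<forall>\<^sub>F N in sequentially. cutoff l x0 N 0 x \<le> exp (- \<theta>) ^ N"
    unfolding eventually_sequentially by (intro exI[of _ "Suc k"]) auto
qed

context gaussian_measure
begin

lemma cutoff_measurable [measurable]: "cutoff l x0 N \<tau> \<in> borel_measurable borel"
proof -
  have "continuous_on UNIV softplus"
    using softplus_deriv by (meson DERIV_isCont continuous_at_imp_continuous_on)
  then have "continuous_on UNIV (\<lambda>x. softplus (real N * (l k (x - x0) - 1 - \<tau>)))" for k
    by (rule continuous_on_compose2) (auto intro!: continuous_intros)
  then show ?thesis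
    unfolding cutoff_def[abs_def] by (intro borel_measurable_continuous_onI continuous_intros)
qed

lemma cutoff_random_variable: "cutoff l x0 N \<tau> \<in> borel_measurable \<gamma>"
  using cutoff_measurable by (simp add: measurable_cong_sets[OF gaussian_sets refl])

lemma cutoff_integrable: "integrable \<gamma> (cutoff l x0 N \<tau>)"
proof (rule integrable_const_bound[of _ 1])
  have "norm (cutoff l x0 N \<tau> x) \<le> 1" for x using cutoff_bounds[of l x0 N \<tau> x] by simp
  then show "AE x in \<gamma>. norm (cutoff l x0 N \<tau> x) \<le> 1" by simp
qed (rule cutoff_random_variable)

lemma cutoff_integral_log_concave:
  "(LINT x|\<gamma>. cutoff l x0 N s x) * (LINT x|\<gamma>. cutoff l x0 N t x)
    \<le> (LINT x|\<gamma>. cutoff l x0 N ((s + t) / 2) x)\<^sup>2"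
proof -
  define F where "F \<tau> a = exp (- (\<Sum>k<N. softplus (real N * (a k - l k x0 - 1 - \<tau>))))"
    for \<tau> and a :: "nat \<Rightarrow> real"
  have F: "cutoff l x0 N \<tau> x = F \<tau> (\<lambda>k\<in>{..<N}. blinfun_apply (l k) x)" for \<tau> x
    by (simp add: cutoff_def F_def blinfun.diff_right)
  have "continuous_on UNIV softplus"
    using softplus_deriv by (meson DERIV_isCont continuous_at_imp_continuous_on)
  then have [measurable]: "softplus \<in> borel_measurable borel"
    by (rule borel_measurable_continuous_onI)
  have Fm: "F \<tau> \<in> borel_measurable (PiM {..<N} (\<lambda>_. borel))" for \<tau>
    unfolding F_def[abs_def] by measurable
  have F01: "0 \<le> F \<tau> a" "F \<tau> a \<le> 1" for \<tau> a
    by (auto simp: F_def softplus_nonneg sum_nonneg)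
  have Fr: "F \<tau> (\<lambda>k\<in>{..<N}. a k) = F \<tau> a" for \<tau> a
    unfolding F_def by (intro arg_cong[where f = "\<lambda>s. exp (- s)"] sum.cong) auto
  have mid: "F s (\<lambda>k\<in>{..<N}. a k) * F t (\<lambda>k\<in>{..<N}. b k)
      \<le> (F ((s + t) / 2) (\<lambda>k\<in>{..<N}. (a k + b k) / 2))\<^sup>2" for a b
  proof -
    let ?u = "\<lambda>k. real N * (a k - l k x0 - 1 - s)" and ?v = "\<lambda>k. real N * (b k - l k x0 - 1 - t)"
    have m: "real N * ((a k + b k) / 2 - l k x0 - 1 - (s + t) / 2) = (?u k + ?v k) / 2" for k
      by (simp add: field_simps)
    have "(\<Sum>k<N. 2 * softplus ((?u k + ?v k) / 2)) \<le> (\<Sum>k<N. softplus (?u k) + softplus (?v k))"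
      by (intro sum_mono softplus_midpoint)
    then have "exp (- (\<Sum>k<N. softplus (?u k)) + - (\<Sum>k<N. softplus (?v k)))
        \<le> exp (2 * - (\<Sum>k<N. softplus ((?u k + ?v k) / 2)))"
      by (simp add: sum.distrib sum_distrib_left[symmetric])
    then show ?thesis
      unfolding Fr unfolding F_def m by (simp only: exp_add exp_double)
  qed
  show ?thesis
    unfolding F by (rule prekopa_leindler_gaussian[of "F s" N "F t" "F ((s + t) / 2)" l, OF Fm F01 Fm F01 Fm F01 mid])
qed

text \<open>The logarithm of the integral of the cutoff is midpoint concave in its parameter, so its slope at
  zero is at most the slope of a chord to the left. This makes the bound independent of \<open>N\<close>.\<close>

lemma cutoff_slope_integral_le:
  assumes \<beta>: "0 < \<beta>" "\<beta> \<le> (LINT x|\<gamma>. cutoff l x0 N (- \<tau>) x)" and \<tau>: "0 < \<tau>"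
  shows "(LINT x|\<gamma>. cutoff_slope l x0 N 0 x) \<le> - ln \<beta> / \<tau>"
proof -
  define G where "G \<tau> = (LINT x|\<gamma>. cutoff l x0 N \<tau> x)" for \<tau>
  define d where "d n = \<tau> / 2 ^ n" for n :: nat
  have d: "0 < d n" for n using \<tau> by (simp add: d_def)
  have mono: "cutoff l x0 N s x \<le> cutoff l x0 N t x" if "s \<le> t" for s t x
    by (rule DERIV_nonneg_imp_nondecreasing[OF that, where f = "\<lambda>\<tau>. cutoff l x0 N \<tau> x"])
      (rule exI, rule conjI, rule cutoff_deriv, rule cutoff_slope_bounds(1))
  have G1: "G s \<le> 1" for s
  proof -
    have "G s \<le> (LINT x|\<gamma>. 1)"
      unfolding G_def using cutoff_bounds by (intro integral_mono cutoff_integrable) auto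
    then show ?thesis by simp
  qed
  have Gmono: "G s \<le> G t" if "s \<le> t" for s t
    unfolding G_def using mono[OF that] by (intro integral_mono cutoff_integrable)
  have Gpos: "0 < G (- d n)" for n
  proof -
    have "d n \<le> \<tau>" using \<tau> by (simp add: d_def field_simps)
    then have "G (- \<tau>) \<le> G (- d n)" by (intro Gmono) simp
    then show ?thesis using \<beta> by (simp add: G_def)
  qed
  have G0: "0 < G 0" using Gpos[of 0] Gmono[of "- d 0" 0] d[of 0] by simp
  \<comment> \<open>By midpoint concavity, halving the step leaves at most half of the increment.\<close>
  have chord: "ln (G 0) - ln (G (- d n)) \<le> - ln \<beta> / 2 ^ n" for n
  proof (induction n)
    case 0
    have "ln (G 0) \<le> 0" using G1 G0 by simp
    moreover have "ln \<beta> \<le> ln (G (- \<tau>))" using \<beta> by (simp add: G_def)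
    ultimately show ?case by (simp add: d_def)
  next
    case (Suc n)
    have "G 0 * G (- d n) \<le> (G ((0 + - d n) / 2))\<^sup>2"
      unfolding G_def by (rule cutoff_integral_log_concave)
    also have "(0 + - d n) / 2 = - d (Suc n)" by (simp add: d_def)
    finally have "ln (G 0 * G (- d n)) \<le> ln ((G (- d (Suc n)))\<^sup>2)"
      using G0 Gpos[of n] Gpos[of "Suc n"] by (intro ln_mono) auto
    then have "ln (G 0) + ln (G (- d n)) \<le> 2 * ln (G (- d (Suc n)))"
      using G0 Gpos[of n] Gpos[of "Suc n"] by (simp add: ln_mult ln_realpow)
    then have "2 * (ln (G 0) - ln (G (- d (Suc n)))) \<le> ln (G 0) - ln (G (- d n))" by simp
    also have "\<dots> \<le> - ln \<beta> / 2 ^ n" by (rule Suc)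
    finally show ?case by simp
  qed
  \<comment> \<open>Since \<open>G 0 \<le> 1\<close>, differences of \<open>G\<close> are at most differences of its logarithm.\<close>
  have quot: "(LINT x|\<gamma>. (cutoff l x0 N (- d n) x - cutoff l x0 N 0 x) / (- d n)) \<le> - ln \<beta> / \<tau>" for n
  proof -
    define q where "q = G (- d n) / G 0"
    have q: "0 < q" "G (- d n) = q * G 0" using Gpos[of n] G0 by (auto simp: q_def)
    have "q \<le> 1" using Gmono[of "- d n" 0] d[of n] G0 by (simp add: q_def)
    have "G 0 - G (- d n) = (1 - q) * G 0" by (simp add: q algebra_simps)
    also have "\<dots> \<le> 1 - q" using G1[of 0] \<open>q \<le> 1\<close> by (intro mult_left_le) auto
    also have "\<dots> \<le> - ln q" using ln_le_minus_one[OF q(1)] by simp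
    also have "\<dots> = ln (G 0) - ln (G (- d n))" using q G0 by (simp add: ln_mult)
    also have "\<dots> \<le> - ln \<beta> / 2 ^ n" by (rule chord)
    finally have "(G 0 - G (- d n)) / d n \<le> (- ln \<beta> / 2 ^ n) / d n"
      using d[of n] by (intro divide_right_mono) auto
    also have "\<dots> = - ln \<beta> / \<tau>" by (simp add: d_def)
    finally show ?thesis
      using d[of n] by (simp add: G_def cutoff_integrable minus_divide_right[symmetric] diff_divide_distrib)
  qed
  have dlim: "d \<longlonglongrightarrow> 0"
  proof -
    have "(\<lambda>n. \<tau> * (1 / 2) ^ n) \<longlonglongrightarrow> \<tau> * 0"
      by (intro tendsto_intros LIMSEQ_realpow_zero) auto
    then show ?thesis by (simp add: d_def[abs_def] power_one_over)
  qed
  have lim: "(\<lambda>n. (cutoff l x0 N (- d n) x - cutoff l x0 N 0 x) / (- d n)) \<longlonglongrightarrow> cutoff_slope l x0 N 0 x" for x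
  proof -
    have "((\<lambda>h. (cutoff l x0 N (0 + h) x - cutoff l x0 N 0 x) / h) \<longlongrightarrow> cutoff_slope l x0 N 0 x) (at 0)"
      using cutoff_deriv by (simp only: DERIV_def)
    moreover have "filterlim (\<lambda>n. - d n) (at 0) sequentially"
      using tendsto_minus[OF dlim] d by (auto simp: filterlim_at intro!: always_eventually less_imp_neq[symmetric])
    ultimately show ?thesis by (auto dest: filterlim_compose)
  qed
  have bound: "\<bar>(cutoff l x0 N (- d n) x - cutoff l x0 N 0 x) / (- d n)\<bar> \<le> real N * real N" for n x
  proof -
    have "- d n < 0" using d by simp
    from MVT2[OF this, of "\<lambda>\<tau>. cutoff l x0 N \<tau> x" "\<lambda>\<tau>. cutoff_slope l x0 N \<tau> x", OF cutoff_deriv]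
    obtain z where "cutoff l x0 N 0 x - cutoff l x0 N (- d n) x = (0 - - d n) * cutoff_slope l x0 N z x"
      by blast
    then have "(cutoff l x0 N (- d n) x - cutoff l x0 N 0 x) / (- d n) = cutoff_slope l x0 N z x"
      using d[of n] by (simp add: field_simps)
    then show ?thesis using cutoff_slope_bounds[of l x0 N z x] by simp
  qed
  have "(\<lambda>n. LINT x|\<gamma>. (cutoff l x0 N (- d n) x - cutoff l x0 N 0 x) / (- d n))
      \<longlonglongrightarrow> (LINT x|\<gamma>. cutoff_slope l x0 N 0 x)"
  proof (rule integral_dominated_convergence[where w = "\<lambda>_. real N * real N"])
    show m: "(\<lambda>x. (cutoff l x0 N (- d n) x - cutoff l x0 N 0 x) / (- d n)) \<in> borel_measurable \<gamma>" for n
      by (intro borel_measurable_divide borel_measurable_diff cutoff_random_variable borel_measurable_const)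
    show "cutoff_slope l x0 N 0 \<in> borel_measurable \<gamma>"
      by (rule borel_measurable_LIMSEQ_real[OF lim m])
    show "AE x in \<gamma>. norm ((cutoff l x0 N (- d n) x - cutoff l x0 N 0 x) / (- d n)) \<le> real N * real N" for n
      using bound by (intro AE_I2) simp
    show "AE x in \<gamma>. (\<lambda>n. (cutoff l x0 N (- d n) x - cutoff l x0 N 0 x) / (- d n)) \<longlonglongrightarrow> cutoff_slope l x0 N 0 x"
      using lim by (intro AE_I2)
  qed simp
  then show ?thesis using quot by (intro LIMSEQ_le_const2) auto
qed

lemma cutoff_slope_integrable: "integrable \<gamma> (cutoff_slope l x0 N 0)"
proof (rule integrable_const_bound[of _ "real N * real N"])
  have "continuous_on UNIV (\<lambda>x. sigmoid (real N * (l k (x - x0) - 1 - 0)))" for k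
    by (rule continuous_on_compose2[OF sigmoid_continuous]) (auto intro!: continuous_intros)
  moreover have "continuous_on UNIV (cutoff l x0 N 0)"
    using cutoff_has_gradient[of l x0 N] by (simp add: has_gradient_def)
  ultimately have "continuous_on UNIV (cutoff_slope l x0 N 0)"
    unfolding cutoff_slope_def[abs_def] by (intro continuous_intros)
  from borel_measurable_continuous_onI[OF this]
  show "cutoff_slope l x0 N 0 \<in> borel_measurable \<gamma>"
    by (simp add: measurable_cong_sets[OF gaussian_sets refl])
  show "AE x in \<gamma>. norm (cutoff_slope l x0 N 0 x) \<le> real N * real N"
    using cutoff_slope_bounds[of l x0 N 0] by (intro AE_I2) simp
qed

end


section \<open>Finite perimeter of convex sets\<close>

context wiener_basis
begin

text \<open>Integration by parts for the product of \<open>w\<close> with each coefficient function moves the divergence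
  onto \<open>w\<close>.\<close>

lemma divergence_weighted:
  fixes n :: nat
  assumes w: "has_gradient w W"
    and f: "\<And>i. i < n \<Longrightarrow> has_gradient (f i) (G i)" and h: "\<And>i. i < n \<Longrightarrow> h i \<in> cameron_martin \<gamma>"
  shows "integrable \<gamma> (\<lambda>x. W x (\<Sum>i<n. c i *\<^sub>R (f i x *\<^sub>R h i)))"
    and "(LINT x|\<gamma>. w x * (\<Sum>i<n. c i * (G i x (h i) - hat \<gamma> (h i) x * f i x)))
      = - (LINT x|\<gamma>. W x (\<Sum>i<n. c i *\<^sub>R (f i x *\<^sub>R h i)))"
proof -
  obtain B where B: "0 \<le> B" "\<And>x. \<bar>w x\<bar> \<le> B" "\<And>x h. \<bar>blinfun_apply (W x) h\<bar> \<le> B * norm h"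
    by (rule has_gradient_bounds[OF w]) (rule that)
  have i2: "integrable \<gamma> (\<lambda>x. c i * (f i x * W x (h i)))" if "i < n" for i
    using that by (intro integrable_mult_right L2_mult_integrable has_gradient_L2(1)[OF f] has_gradient_L2(2)[OF w])
  have lin: "W x (\<Sum>i<n. c i *\<^sub>R (f i x *\<^sub>R h i)) = (\<Sum>i<n. c i * (f i x * W x (h i)))" for x
    by (simp add: blinfun.sum_right blinfun.scaleR_right mult.assoc)
  show "integrable \<gamma> (\<lambda>x. W x (\<Sum>i<n. c i *\<^sub>R (f i x *\<^sub>R h i)))"
    unfolding lin by (intro Bochner_Integration.integrable_sum i2) simp
  have div: "integrable \<gamma> (\<lambda>x. c i * (w x * (G i x (h i) - hat \<gamma> (h i) x * f i x)))"
    "(LINT x|\<gamma>. c i * (w x * (G i x (h i) - hat \<gamma> (h i) x * f i x)))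
      = - (LINT x|\<gamma>. c i * (f i x * W x (h i)))" if i: "i < n" for i
  proof -
    note fi = f[OF i] and hi = hat_dual_closure[OF h[OF i]]
    obtain A where A: "0 \<le> A" "\<And>x. \<bar>f i x\<bar> \<le> A" "\<And>x h. \<bar>blinfun_apply (G i x) h\<bar> \<le> A * norm h"
      by (rule has_gradient_bounds[OF fi]) (rule that)
    note wf = has_gradient_mult[OF w fi]
    have "(\<lambda>x. f i x * hat \<gamma> (h i) x) \<in> L2 \<gamma>"
      by (rule L2_mult_bounded[OF dual_closure_L2[OF hi] has_gradient_random_variable(1)[OF fi] A(2)])
    then have "(\<lambda>x. G i x (h i) - hat \<gamma> (h i) x * f i x) \<in> L2 \<gamma>"
      using L2_diff[OF has_gradient_L2(2)[OF fi, of "h i"]] by (simp add: mult.commute)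
    then have i1: "integrable \<gamma> (\<lambda>x. w x * (G i x (h i) - hat \<gamma> (h i) x * f i x))"
      by (intro L2_mult_integrable has_gradient_L2(1)[OF w])
    then show "integrable \<gamma> (\<lambda>x. c i * (w x * (G i x (h i) - hat \<gamma> (h i) x * f i x)))"
      by (rule integrable_mult_right)
    have i3: "integrable \<gamma> (\<lambda>x. f i x * W x (h i))"
      by (intro L2_mult_integrable has_gradient_L2(1)[OF fi] has_gradient_L2(2)[OF w])
    have "(LINT x|\<gamma>. w x * (G i x (h i) - hat \<gamma> (h i) x * f i x) + f i x * W x (h i))
      = (LINT x|\<gamma>. (w x *\<^sub>R G i x + f i x *\<^sub>R W x) (h i) - hat \<gamma> (h i) x * (w x * f i x))"
      by (simp add: blinfun.add_left blinfun.scaleR_left algebra_simps)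
    also have "\<dots> = (LINT x|\<gamma>. (w x *\<^sub>R G i x + f i x *\<^sub>R W x) (h i)) - (LINT x|\<gamma>. hat \<gamma> (h i) x * (w x * f i x))"
      by (intro Bochner_Integration.integral_diff L2_integrable[OF has_gradient_L2(2)[OF wf]]
          L2_mult_integrable[OF dual_closure_L2[OF hi] has_gradient_L2(1)[OF wf]])
    also have "\<dots> = 0"
      using integration_by_parts[OF wf hi] R_map_hat[OF h[OF i]] by simp
    finally have "(LINT x|\<gamma>. w x * (G i x (h i) - hat \<gamma> (h i) x * f i x)) = - (LINT x|\<gamma>. f i x * W x (h i))"
      using Bochner_Integration.integral_add[OF i1 i3] by linarith
    then show "(LINT x|\<gamma>. c i * (w x * (G i x (h i) - hat \<gamma> (h i) x * f i x)))
      = - (LINT x|\<gamma>. c i * (f i x * W x (h i)))"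
      by (simp only: integral_mult_right_zero mult_minus_right)
  qed
  have "(LINT x|\<gamma>. w x * (\<Sum>i<n. c i * (G i x (h i) - hat \<gamma> (h i) x * f i x)))
    = (LINT x|\<gamma>. (\<Sum>i<n. c i * (w x * (G i x (h i) - hat \<gamma> (h i) x * f i x))))"
    by (simp add: sum_distrib_left mult_ac)
  also have "\<dots> = (\<Sum>i<n. LINT x|\<gamma>. c i * (w x * (G i x (h i) - hat \<gamma> (h i) x * f i x)))"
    by (rule Bochner_Integration.integral_sum) (rule div(1), simp)
  also have "\<dots> = - (\<Sum>i<n. LINT x|\<gamma>. c i * (f i x * W x (h i)))"
    unfolding sum_negf[symmetric] by (intro sum.cong refl div(2)) simp
  also have "\<dots> = - (LINT x|\<gamma>. W x (\<Sum>i<n. c i *\<^sub>R (f i x *\<^sub>R h i)))"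
    unfolding lin
    by (rule arg_cong[where f = uminus], rule Bochner_Integration.integral_sum[symmetric]) (rule i2, simp)
  finally show "(LINT x|\<gamma>. w x * (\<Sum>i<n. c i * (G i x (h i) - hat \<gamma> (h i) x * f i x)))
      = - (LINT x|\<gamma>. W x (\<Sum>i<n. c i *\<^sub>R (f i x *\<^sub>R h i)))" .
qed

lemma FC1b_H_E:
  assumes "\<phi> \<in> FC1b_H \<gamma>"
  obtains n :: nat and c f h G where "\<And>i. i < n \<Longrightarrow> has_gradient (f i) (G i)"
    "\<And>i. i < n \<Longrightarrow> h i \<in> cameron_martin \<gamma>" "\<phi> = (\<lambda>x. \<Sum>i<n. c i *\<^sub>R (f i x *\<^sub>R h i))"
proof -
  obtain n :: nat and c f h where fh: "\<forall>i<n. f i \<in> FC1b \<and> h i \<in> cameron_martin \<gamma>"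
    and \<phi>: "\<phi> = (\<lambda>x. \<Sum>i<n. c i *\<^sub>R (f i x *\<^sub>R h i))"
    using assms unfolding FC1b_H_def by blast
  have "\<exists>G. i < n \<longrightarrow> has_gradient (f i) G" for i
    using fh FC1b_has_gradient[of "f i"] by blast
  then obtain G where "\<And>i. i < n \<Longrightarrow> has_gradient (f i) (G i)" by metis
  then show thesis using fh \<phi> by (intro that[of n f G h c]) auto
qed

text \<open>The cutoffs of the first \<open>N\<close> half-spaces converge almost everywhere to the indicator of \<open>C\<close>, so it
  suffices to bound the integral of cutoff times divergence uniformly in \<open>N\<close> and \<open>\<phi>\<close>. It is at
  most \<open>norm_bound / r\<close> times the integral of \<open>cutoff_slope\<close>, where \<open>r\<close> is the radius of a ball in \<open>C\<close>,
  and the slope is controlled by the measure of a smaller homothetic copy of \<open>C\<close>.\<close>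

lemma divergence_integral_bound:
  assumes C: "open C" "convex C" and pos: "0 < prob C"
  shows "\<exists>K. \<forall>\<phi>\<in>FC1b_H \<gamma>. (\<forall>x. norm_H \<gamma> (\<phi> x) \<le> 1) \<longrightarrow> (LINT x:C|\<gamma>. gauss_div \<gamma> J xs \<phi> x) \<le> K"
proof -
  have "C \<noteq> {}" using pos by auto
  then obtain x0 where "x0 \<in> C" by auto
  then obtain r where r: "0 < r" "ball x0 r \<subseteq> C" using C(1) by (auto simp: open_contains_ball)
  obtain l :: "nat \<Rightarrow> 'a \<Rightarrow>\<^sub>L real" where l: "\<And>k v. l k v \<le> norm v / r"
    and cl: "closure C = {x. \<forall>k. l k (x - x0) \<le> 1}"
    by (rule closure_convex_countable_halfspaces[OF C(2) r]) (rule that)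
  have strict: "\<exists>\<delta>>0. \<forall>k. l k (x - x0) - 1 \<le> - \<delta>" if x: "x \<in> C" for x
  proof -
    obtain e where e: "0 < e" "ball x e \<subseteq> C" using C(1) x by (auto simp: open_contains_ball)
    define y where "y = norm (x - x0) + 1"
    have y: "0 < y" "norm (x - x0) \<le> y" by (auto simp: y_def add_nonneg_pos)
    define s where "s = e / (2 * y)"
    have s: "0 < s" using e y by (simp add: s_def)
    have "s * norm (x - x0) \<le> s * y" using s y by (intro mult_left_mono) auto
    also have "\<dots> = e / 2" using y by (simp add: s_def)
    finally have "s * norm (x - x0) < e" using e by simp
    then have "x + s *\<^sub>R (x - x0) \<in> ball x e" using s by (simp add: dist_norm)
    then have "x + s *\<^sub>R (x - x0) \<in> closure C" using e closure_subset by blast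
    then have "l k (x + s *\<^sub>R (x - x0) - x0) \<le> 1" for k by (simp add: cl)
    then have le: "(1 + s) * l k (x - x0) \<le> 1" for k
      by (simp add: blinfun.add_right blinfun.diff_right blinfun.scaleR_right algebra_simps)
    have "l k (x - x0) - 1 \<le> - (s / (1 + s))" for k
      using le[of k] s by (simp add: field_simps)
    then show ?thesis using s by (intro exI[of _ "s / (1 + s)"]) auto
  qed
  \<comment> \<open>Some smaller homothetic copy of the closure of \<open>C\<close> still has positive measure.\<close>
  define D where "D m = {x. \<forall>k. l k (x - x0) - 1 \<le> - (1 / real (Suc m))}" for m
  have Dc: "closed (D m)" for m
    unfolding D_def by (intro closed_Collect_all closed_Collect_le continuous_intros)
  then have [measurable]: "D m \<in> sets borel" for m by (intro borel_closed)
  have "\<exists>m. 0 < prob (D m)"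
  proof (rule ccontr)
    assume "\<not> (\<exists>m. 0 < prob (D m))"
    then have "D m \<in> null_sets \<gamma>" for m
      by (auto simp: null_sets_def emeasure_eq_measure not_less measure_le_0_iff)
    then have null: "(\<Union>m. D m) \<in> null_sets \<gamma>" by (rule null_sets_UN)
    have sub: "C \<subseteq> (\<Union>m. D m)"
    proof
      fix x assume "x \<in> C"
      then obtain \<delta> where \<delta>: "0 < \<delta>" "\<And>k. l k (x - x0) - 1 \<le> - \<delta>" using strict by blast
      obtain m where "1 / real (Suc m) < \<delta>" using nat_approx_posE[OF \<delta>(1)] by blast
      then have "x \<in> D m" unfolding D_def using \<delta>(2) by (auto intro: order_trans[OF \<delta>(2)])
      then show "x \<in> (\<Union>m. D m)" by blast
    qed
    have "C \<in> null_sets \<gamma>" by (rule null_sets_subset[OF null _ sub]) (use C(1) in simp)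
    then show False using pos by (simp add: null_sets_def emeasure_eq_measure)
  qed
  then obtain m where m: "0 < prob (D m)" by blast
  define \<tau> where "\<tau> = 1 / (2 * real (Suc m))"
  have \<tau>: "0 < \<tau>" by (simp add: \<tau>_def)
  define \<beta> where "\<beta> = prob (D m) * exp (- (1 / \<tau>))"
  have \<beta>: "0 < \<beta>" using m by (simp add: \<beta>_def)
  have lower: "\<beta> \<le> (LINT x|\<gamma>. cutoff l x0 N (- \<tau>) x)" for N
  proof -
    have "exp (- (1 / \<tau>)) \<le> cutoff l x0 N (- \<tau>) x" if x: "x \<in> D m" for x
    proof -
      have "l k (x - x0) - 1 - - \<tau> \<le> - \<tau>" for k
      proof -
        have "l k (x - x0) - 1 \<le> - (1 / real (Suc m))" using x by (simp add: D_def)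
        also have "1 / real (Suc m) = 2 * \<tau>" by (simp add: \<tau>_def field_simps)
        finally show ?thesis by simp
      qed
      then have c: "exp (- (real N * exp (- \<tau>) ^ N)) \<le> cutoff l x0 N (- \<tau>) x"
        by (rule cutoff_lower)
      have "real N * \<tau> \<le> exp (real N * \<tau>)" using exp_ge_add_one_self[of "real N * \<tau>"] by linarith
      then have "real N * \<tau> * exp (- (real N * \<tau>)) \<le> 1"
        by (simp add: exp_minus field_simps)
      then have "real N * exp (- \<tau>) ^ N \<le> 1 / \<tau>"
        using \<tau> by (simp add: exp_of_nat_mult[symmetric] field_simps)
      then show ?thesis using c by (intro order_trans[OF _ c]) simp
    qed
    then have "exp (- (1 / \<tau>)) * indicator (D m) x \<le> cutoff l x0 N (- \<tau>) x" for x
      using cutoff_bounds(1)[of l x0 N "- \<tau>" x] by (auto simp: indicator_def less_imp_le)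
    then have "(LINT x|\<gamma>. exp (- (1 / \<tau>)) * indicator (D m) x) \<le> (LINT x|\<gamma>. cutoff l x0 N (- \<tau>) x)"
      by (intro integral_mono cutoff_integrable) (auto simp: emeasure_eq_measure)
    then show ?thesis by (simp add: \<beta>_def mult.commute)
  qed
  define K where "K = (norm_bound / r) * (- ln \<beta> / \<tau>)"
  have ae: "AE x in \<gamma>. (\<lambda>N. cutoff l x0 N 0 x) \<longlonglongrightarrow> indicator C x"
  proof -
    have "frontier C \<in> null_sets \<gamma>"
      using frontier_convex_null[OF C] by (intro null_setsI) (auto intro: borel_closed)
    then have "AE x in \<gamma>. x \<notin> frontier C" by (rule AE_not_in)
    then show ?thesis
    proof eventually_elim
      fix x assume x: "x \<notin> frontier C"
      show "(\<lambda>N. cutoff l x0 N 0 x) \<longlonglongrightarrow> indicator C x"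
      proof (cases "x \<in> C")
        case True
        then obtain \<delta> where "0 < \<delta>" "\<And>k. l k (x - x0) - 1 \<le> - \<delta>" using strict by blast
        then show ?thesis using True cutoff_tendsto_1[of \<delta> l x x0] by simp
      next
        case False
        then have "x \<notin> closure C" using x C(1) by (auto simp: frontier_def interior_open)
        then obtain k where "1 < l k (x - x0)" by (auto simp: cl not_le)
        then show ?thesis using False cutoff_tendsto_0[of l k x x0] by simp
      qed
    qed
  qed
  show ?thesis
  proof (intro exI[of _ K] ballI impI)
    fix \<phi> assume \<phi>: "\<phi> \<in> FC1b_H \<gamma>" and unit: "\<forall>x. norm_H \<gamma> (\<phi> x) \<le> 1"
    obtain n :: nat and c f h G where f: "\<And>i. i < n \<Longrightarrow> has_gradient (f i) (G i)"
      and h: "\<And>i. i < n \<Longrightarrow> h i \<in> cameron_martin \<gamma>"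
      and \<phi>_eq: "\<phi> = (\<lambda>x. \<Sum>i<n. c i *\<^sub>R (f i x *\<^sub>R h i))"
      by (rule FC1b_H_E[OF \<phi>]) (rule that)
    have div: "gauss_div \<gamma> J xs \<phi> \<in> L2 \<gamma>"
      "AE x in \<gamma>. gauss_div \<gamma> J xs \<phi> x = (\<Sum>i<n. c i * (G i x (h i) - hat \<gamma> (h i) x * f i x))"
      by (rule gauss_div_eq[OF f h \<phi>_eq]; simp)+
    let ?g = "\<lambda>x. \<Sum>i<n. c i * (G i x (h i) - hat \<gamma> (h i) x * f i x)"
    note dL2 = L2_integrable[OF div(1)]
    have small: "norm (\<phi> x) \<le> norm_bound" for x
    proof -
      have "\<phi> x = (\<Sum>i<n. (c i * f i x) *\<^sub>R h i)" by (simp add: \<phi>_eq)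
      then have "\<phi> x \<in> cameron_martin \<gamma>"
        using cameron_martin_lincomb(1)[of "{..<n}" h "\<lambda>i. c i * f i x"] h by simp
      then have "norm (\<phi> x) \<le> norm_bound * norm_H \<gamma> (\<phi> x)" by (rule norm_le_norm_H)
      also have "\<dots> \<le> norm_bound" using unit by (intro mult_left_le) (auto simp: norm_bound_def)
      finally show ?thesis .
    qed
    have bound: "(LINT x|\<gamma>. cutoff l x0 N 0 x * gauss_div \<gamma> J xs \<phi> x) \<le> K" for N
    proof -
      note dw = divergence_weighted[OF cutoff_has_gradient[of l x0 N] f h, where c = c]
      have g_meas: "?g \<in> borel_measurable \<gamma>"
        using f h by (intro borel_measurable_sum borel_measurable_times borel_measurable_diff borel_measurable_const
            has_gradient_random_variable L2_measurable[OF dual_closure_L2[OF hat_dual_closure]]) auto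
      have "(LINT x|\<gamma>. cutoff l x0 N 0 x * gauss_div \<gamma> J xs \<phi> x) = (LINT x|\<gamma>. cutoff l x0 N 0 x * ?g x)"
      proof (rule integral_cong_AE)
        show "AE x in \<gamma>. cutoff l x0 N 0 x * gauss_div \<gamma> J xs \<phi> x = cutoff l x0 N 0 x * ?g x"
          using div(2) by eventually_elim simp
      qed (intro borel_measurable_times cutoff_random_variable g_meas borel_measurable_integrable[OF dL2])+
      also have "\<dots> = (LINT x|\<gamma>. - (cutoff_gradient l x0 N x (\<phi> x)))"
        using dw(2) by (simp add: \<phi>_eq)
      also have "\<dots> \<le> (LINT x|\<gamma>. (norm_bound / r) * cutoff_slope l x0 N 0 x)"
        using dw(1) by (intro integral_mono cutoff_gradient_le l r small integrable_mult_right cutoff_slope_integrable)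
          (simp add: \<phi>_eq)
      also have "\<dots> = (norm_bound / r) * (LINT x|\<gamma>. cutoff_slope l x0 N 0 x)" by simp
      also have "\<dots> \<le> K"
        unfolding K_def using r by (intro mult_left_mono cutoff_slope_integral_le \<beta> lower \<tau>) (simp add: norm_bound_def)
      finally show ?thesis .
    qed
    have "(\<lambda>N. LINT x|\<gamma>. cutoff l x0 N 0 x * gauss_div \<gamma> J xs \<phi> x)
        \<longlonglongrightarrow> (LINT x|\<gamma>. indicator C x * gauss_div \<gamma> J xs \<phi> x)"
    proof (rule integral_dominated_convergence[where w = "\<lambda>x. \<bar>gauss_div \<gamma> J xs \<phi> x\<bar>"])
      show "(\<lambda>x. indicator C x * gauss_div \<gamma> J xs \<phi> x) \<in> borel_measurable \<gamma>"
        using C(1) dL2 by (intro borel_measurable_times borel_measurable_indicator borel_measurable_integrable) auto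
      show "(\<lambda>x. cutoff l x0 N 0 x * gauss_div \<gamma> J xs \<phi> x) \<in> borel_measurable \<gamma>" for N
        by (intro borel_measurable_times cutoff_random_variable borel_measurable_integrable[OF dL2])
      show "integrable \<gamma> (\<lambda>x. \<bar>gauss_div \<gamma> J xs \<phi> x\<bar>)" by (rule integrable_abs[OF dL2])
      show "AE x in \<gamma>. (\<lambda>N. cutoff l x0 N 0 x * gauss_div \<gamma> J xs \<phi> x)
          \<longlonglongrightarrow> indicator C x * gauss_div \<gamma> J xs \<phi> x"
        using ae by eventually_elim (intro tendsto_mult tendsto_const)
      have "\<bar>cutoff l x0 N 0 x\<bar> * \<bar>gauss_div \<gamma> J xs \<phi> x\<bar> \<le> \<bar>gauss_div \<gamma> J xs \<phi> x\<bar>" for N x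
        using cutoff_bounds[of l x0 N 0 x] by (intro mult_left_le_one_le) auto
      then show "AE x in \<gamma>. norm (cutoff l x0 N 0 x * gauss_div \<gamma> J xs \<phi> x) \<le> \<bar>gauss_div \<gamma> J xs \<phi> x\<bar>" for N
        by (intro AE_I2) (simp add: abs_mult)
    qed
    then have "(LINT x|\<gamma>. indicator C x * gauss_div \<gamma> J xs \<phi> x) \<le> K"
      using bound by (intro LIMSEQ_le_const2) auto
    then show "(LINT x:C|\<gamma>. gauss_div \<gamma> J xs \<phi> x) \<le> K"
      by (simp add: set_lebesgue_integral_def)
  qed
qed

theorem gauss_perimeter_convex_finite:
  assumes C: "open C" "convex C"
  shows "gauss_perimeter \<gamma> J xs C < \<infinity>"
proof -
  have "\<exists>K. \<forall>\<phi>\<in>FC1b_H \<gamma>. (\<forall>x. norm_H \<gamma> (\<phi> x) \<le> 1) \<longrightarrow> (LINT x:C|\<gamma>. gauss_div \<gamma> J xs \<phi> x) \<le> K"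
  proof (cases "prob C = 0")
    case True
    then have "C \<in> null_sets \<gamma>" using C(1) by (intro null_setsI) (auto simp: emeasure_eq_measure)
    then have "AE x in \<gamma>. x \<notin> C" by (rule AE_not_in)
    then have "(LINT x:C|\<gamma>. gauss_div \<gamma> J xs \<phi> x) = 0" for \<phi>
      unfolding set_lebesgue_integral_def
      by (intro integral_eq_zero_AE) (auto elim!: eventually_mono)
    then show ?thesis by (intro exI[of _ 0]) simp
  next
    case False
    then have "0 < prob C" using measure_nonneg[of \<gamma> C] by linarith
    then show ?thesis by (rule divergence_integral_bound[OF C])
  qed
  then obtain K where K: "\<And>\<phi>. \<phi> \<in> FC1b_H \<gamma> \<Longrightarrow> \<forall>x. norm_H \<gamma> (\<phi> x) \<le> 1
      \<Longrightarrow> (LINT x:C|\<gamma>. gauss_div \<gamma> J xs \<phi> x) \<le> K" by blast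
  have "gauss_perimeter \<gamma> J xs C \<le> ereal K"
    unfolding gauss_perimeter_def by (rule SUP_least) (auto intro: K)
  also have "\<dots> < \<infinity>" by simp
  finally show ?thesis .
qed

end

theorem proposition9:
  fixes \<gamma> :: "'a::{banach, second_countable_topology} measure"
    and J :: "nat set"
    and xs :: "nat \<Rightarrow> 'a \<Rightarrow>\<^sub>L real"
    and C :: "'a set"
  assumes "abstract_wiener_space \<gamma>"
    and "dual_onb \<gamma> J xs"
    and "open C" and "convex C"
  shows "emeasure \<gamma> (frontier C) = 0 \<and> gauss_perimeter \<gamma> J xs C < \<infinity>"
proof -
  interpret wiener_basis \<gamma> J xs
    using assms(1,2) by unfold_locales (auto simp: abstract_wiener_space_def)
  show ?thesis
    using frontier_convex_null gauss_perimeter_convex_finite assms(3,4) by blast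
qed

end
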